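(* Let $N\ge 2$ and let $B$ be the open unit ball in $\mathbb{R}^N$. For $1<p<N$ let \[ \mathscr{B}_p=\left\{u\in W^{1,p}_{0,rad}(B): \|\nabla u\|_{L^p(B)}\le 1\right\},\qquad X_p=\left\{\{u_n\}\subset\mathscr{B}_p:\ \lim_{n\to\infty}\|\nabla u_n\|_{L^p(B_\varepsilon)}=1 \text{ for every }\varepsilon>0\right\}. \] Then \[ \sup_{\{u_n\}\in X_p}\left(\limsup_{n\to\infty}\int_B F_p(u_n)\,dx\right)\to |B|\left(1+e^{\sum_{k=1}^{N-1}\frac1k}\right)\quad\text{as } p\to N . \]
   Context: $W^{1,p}_0(B)$ is the completion of $C_c^\infty(B)$ with respect to the norm $(\|u\|_{L^p(B)}^p+\|\nabla u\|_{L^p(B)}^p)^{1/p}$, and $W^{1,p}_{0,rad}(B)$ is the set of radially symmetric functions in $W^{1,p}_0(B)$. $B_\varepsilon$ is the ball centered at the origin of radius $\varepsilon$. $\omega_{N-1}$ is the surface measure of the unit sphere in $\mathbb{R}^N$ and $\alpha_N=N\omega_{N-1}^{\frac{1}{N-1}}$. For $1<p<N$, $F_p:\mathbb{R}\to\mathbb{R}_+$ is defined by \[ F_p(s)=\left[1+\frac{N-p}{N(p-1)}\alpha_p|s|^{\frac{p}{p-1}}\right]^{\frac{N(p-1)}{N-p}},\qquad \alpha_p=\left(\alpha_N^{\frac{N-1}{N}}|B|^{\frac1p-\frac1N}\right)^{\frac{p}{p-1}} . \] *)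

theory Defs
  imports "HOL-Analysis.Analysis"
begin

fun Ck :: "nat \<Rightarrow> ('a::euclidean_space \<Rightarrow> real) \<Rightarrow> bool" where
  "Ck 0 f = continuous_on UNIV f"
| "Ck (Suc k) f = (f differentiable_on UNIV \<and>
      (\<forall>i\<in>Basis. Ck k (\<lambda>x. frechet_derivative f (at x) i)))"

definition smooth :: "('a::euclidean_space \<Rightarrow> real) \<Rightarrow> bool" where
  "smooth f \<longleftrightarrow> (\<forall>k. Ck k f)"

definition test_fn :: "'a::euclidean_space set \<Rightarrow> ('a \<Rightarrow> real) \<Rightarrow> bool" where
  "test_fn S \<phi> \<longleftrightarrow> smooth \<phi> \<and> compact (closure {x. \<phi> x \<noteq> 0}) \<and> closure {x. \<phi> x \<noteq> 0} \<subseteq> S"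

definition grad :: "('a::euclidean_space \<Rightarrow> real) \<Rightarrow> 'a \<Rightarrow> 'a" where
  "grad f x = (\<Sum>b\<in>Basis. frechet_derivative f (at x) b *\<^sub>R b)"

definition lp_int :: "real \<Rightarrow> 'a::euclidean_space set \<Rightarrow> ('a \<Rightarrow> 'b::real_normed_vector) \<Rightarrow> ennreal" where
  "lp_int p A f = (\<integral>\<^sup>+ x\<in>A. ennreal (norm (f x) powr p) \<partial>lebesgue)"

(* \<parallel>f\<parallel>_{L^p(A)} (only used for functions with finite lp_int) *)
definition lp_norm :: "real \<Rightarrow> 'a::euclidean_space set \<Rightarrow> ('a \<Rightarrow> 'b::real_normed_vector) \<Rightarrow> real" where
  "lp_norm p A f = enn2real (lp_int p A f) powr (1 / p)"

(* u \<in> W^{1,p}_0(S) with weak gradient g: u, g are L^p(S) functions that are the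
   W^{1,p}(S)-limit of a sequence of C_c^\<infinity>(S) functions (and their gradients),
   i.e. (u,g) represents an element of the completion of C_c^\<infinity>(S). *)
definition W0 :: "real \<Rightarrow> 'a::euclidean_space set \<Rightarrow> ('a \<Rightarrow> real) \<Rightarrow> ('a \<Rightarrow> 'a) \<Rightarrow> bool" where
  "W0 p S u g \<longleftrightarrow>
     u \<in> borel_measurable lebesgue \<and> g \<in> borel_measurable lebesgue \<and>
     lp_int p S u < \<infinity> \<and> lp_int p S g < \<infinity> \<and>
     (\<exists>\<phi>::nat \<Rightarrow> 'a \<Rightarrow> real. (\<forall>k. test_fn S (\<phi> k)) \<and>
        ((\<lambda>k. lp_int p S (\<lambda>x. \<phi> k x - u x)) \<longlonglongrightarrow> 0) \<and>
        ((\<lambda>k. lp_int p S (\<lambda>x. grad (\<phi> k) x - g x)) \<longlonglongrightarrow> 0))"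

definition radial :: "('a::real_normed_vector \<Rightarrow> real) \<Rightarrow> bool" where
  "radial u \<longleftrightarrow> (\<exists>v. \<forall>x. u x = v (norm x))"

(* N = dimension, vB = |B|. omega_{N-1} = surface measure of S^{N-1} = N |B| *)
definition omega :: "nat \<Rightarrow> real \<Rightarrow> real" where
  "omega N vB = real N * vB"

definition alphaN :: "nat \<Rightarrow> real \<Rightarrow> real" where
  "alphaN N vB = real N * omega N vB powr (1 / (real N - 1))"

definition alpha_p :: "nat \<Rightarrow> real \<Rightarrow> real \<Rightarrow> real" where
  "alpha_p N vB p = (alphaN N vB powr ((real N - 1) / real N) * vB powr (1/p - 1/real N)) powr (p / (p - 1))"

definition Fp :: "nat \<Rightarrow> real \<Rightarrow> real \<Rightarrow> real \<Rightarrow> real" where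
  "Fp N vB p s = (1 + (real N - p) / (real N * (p - 1)) * alpha_p N vB p * \<bar>s\<bar> powr (p / (p - 1)))
                  powr (real N * (p - 1) / (real N - p))"

definition Xp :: "real \<Rightarrow> ((nat \<Rightarrow> 'a::euclidean_space \<Rightarrow> real) \<times> (nat \<Rightarrow> 'a \<Rightarrow> 'a)) set" where
  "Xp p = {(u, g). (\<forall>n. W0 p (ball 0 1) (u n) (g n) \<and> radial (u n) \<and>
                         lp_norm p (ball 0 1) (g n) \<le> 1) \<and>
                   (\<forall>\<epsilon>>0. (\<lambda>n. lp_norm p (ball 0 \<epsilon> \<inter> ball 0 1) (g n)) \<longlonglongrightarrow> 1)}"

end

theory Submission
  imports Defs
begin

text \<open>
For \<open>p\<close> near \<open>N\<close> the supremum is computed exactly. Along a sequence in \<open>Xp p\<close> the functions tend to 0 in measure, so that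
\<open>Fp(u)\<close> may be replaced by \<open>1\<close> plus its leading term, a multiple of \<open>|u|\<close> to the critical Sobolev exponent; conversely
\<open>Fp(u)\<close> is at least this sum. The supremum is therefore \<open>|B|\<close> plus that multiple of the best constant in the radial Sobolev
inequality of Bliss.

The sharp inequality is proved by the mass transport argument of Cordero-Erausquin, Nazaret and Villani, applied to the
radial map from the density of \<open>|u|\<close> to the critical exponent to the density of the bubble \<open>(1 + |x| powr p') powr (- N)\<close>, where \<open>p' = p/(p - 1)\<close>. Only
the identity \<open>\<integral> \<theta>(u) div \<Psi> = - \<integral> \<theta>'(u) g \<bullet> \<Psi>\<close> for radial fields \<open>\<Psi>\<close> is needed, and it passes to the limit from (non-radial) test
functions. Truncated and dilated bubbles show that the constant is optimal.

With \<open>x = N/p\<close> the supremum equals \<open>|B| (1 + (\<Gamma>(N) / (\<Gamma>(x) \<Gamma>(N + 1 - x))) powr (1 / (x - 1)))\<close>, and as \<open>x\<close> tends to 1 the power tends to the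
exponential of \<open>\<psi>(N) - \<psi>(1) = 1 + 1/2 + \<dots> + 1/(N - 1)\<close>.
\<close>

subsection \<open>Radial integration\<close>

text \<open>The obstacle is regularity. An element of \<open>W0\<close> comes with no differentiable
  representative, while the divergence identity asks for a bounded continuous
  \<open>\<theta>'\<close> and a Lipschitz profile. So \<open>|u|\<close> is replaced by the bounded
  function \<open>wfun \<mu> u\<close>, its density by continuous densities bounded away from 0, and
  the bubble by its restriction to the ball of radius \<open>R\<close>. The transport map is then
  Lipschitz, and the regularizations are removed one after another: the continuous density, then
  \<open>R\<close>, then \<open>\<mu>\<close>. The constant becomes explicit because mass and moment
  of the whole bubble are proportional, \<open>M\<close> and \<open>q * M\<close>. The lower
  estimate contains their sum, which is \<open>\<beta> * M\<close>, and the upper one contains the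
  factor \<open>\<beta>\<close> of the chain rule, so that \<open>\<beta>\<close> cancels. Mass and
  energy of the bubble reproduce exactly this constant. That \<open>Fp\<close> dominates 1 plus its
  leading term needs \<open>q \<ge> 1\<close>, and this is what \<open>p\<close> near
  \<open>N\<close> means for the exact formula.\<close>

lemma emeasure_norm_atMost:
  "emeasure lborel {x::'a::euclidean_space. norm x \<le> r} =
     ennreal (measure lebesgue (ball (0::'a) 1) * (max 0 r)^DIM('a))"
proof (cases "r \<ge> 0")
  case True
  have "{x::'a. norm x \<le> r} = cball 0 r" by auto
  moreover have "emeasure lborel (cball (0::'a) r) = emeasure lborel (ball (0::'a) r)"
    using True by (simp add: emeasure_cball emeasure_ball)
  moreover have "emeasure lborel (ball (0::'a) r) = ennreal (measure lebesgue (ball (0::'a) r))"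
    using emeasure_lborel_ball_finite[of "0::'a" r]
    by (simp add: emeasure_eq_ennreal_measure)
  ultimately show ?thesis using True content_ball_conv_unit_ball[of r "0::'a"] by (simp add: mult.commute)
next
  case False
  then have "{x::'a. norm x \<le> r} = {}"
    by (auto simp: not_le intro: less_le_trans)
  then show ?thesis using False by simp
qed

text \<open>Polar coordinates without a surface measure: the law of the norm is determined by the
  volumes of balls, because the half-lines \<open>{..r}\<close> form an intersection-stable
  generator, and the density is the derivative of the volume in the radius.\<close>

lemma distr_norm_lborel:
  "distr lborel borel (norm :: 'a::euclidean_space \<Rightarrow> real) =
    density lborel (\<lambda>r. ennreal (real DIM('a) * measure lebesgue (ball (0::'a) 1) * r^(DIM('a) - 1)) * indicator {0..} r)"
  (is "?M = ?N")
proof -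
  let ?B = "measure lebesgue (ball (0::'a) 1)"
  let ?d = "\<lambda>r. ennreal (real DIM('a) * ?B * r^(DIM('a) - 1)) * indicator {0..} r"
  have 1: "emeasure ?M {..r} = ennreal (?B * (max 0 r)^DIM('a))" for r
    using emeasure_norm_atMost[of r, where 'a='a] by (subst emeasure_distr) (auto simp: vimage_def)
  have 2: "emeasure ?N {..r} = ennreal (?B * (max 0 r)^DIM('a))" for r
  proof (cases "r \<ge> 0")
    case True
    have "emeasure ?N {..r} = (\<integral>\<^sup>+x\<in>{0..r}. ennreal (real DIM('a) * ?B * x^(DIM('a) - 1)) \<partial>lborel)"
      by (subst emeasure_density) (auto intro!: nn_integral_cong simp: indicator_def)
    also have "\<dots> = ennreal (?B * r ^ DIM('a) - ?B * 0^DIM('a))"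
      using True by (intro nn_integral_FTC_Icc) (auto intro!: derivative_eq_intros)
    finally show ?thesis using True by (simp add: power_0_left)
  next
    case False
    have "emeasure ?N {..r} = (\<integral>\<^sup>+x. ?d x * indicator {..r} x \<partial>lborel)"
      by (subst emeasure_density) auto
    also have "\<dots> = (\<integral>\<^sup>+(x::real). 0 \<partial>lborel)"
      by (rule nn_integral_cong) (use False in \<open>auto simp: indicator_def\<close>)
    finally have "emeasure ?N {..r} = 0" by simp
    then show ?thesis using False by simp
  qed
  show ?thesis
  proof (rule measure_eqI_generator_eq[where E="range atMost" and \<Omega>=UNIV and A="\<lambda>i. {..real i}"])
    show "Int_stable (range (atMost::real \<Rightarrow> real set))"
      by (auto simp: Int_stable_def)
    show "sets ?M = sigma_sets UNIV (range atMost)" "sets ?N = sigma_sets UNIV (range atMost)"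
      by (simp_all add: borel_eq_atMost)
    show "(\<Union>i. {..real i}) = UNIV"
      using real_arch_simple by auto
  qed (use 1 2 in auto)
qed

lemma nn_integral_radial:
  fixes h :: "real \<Rightarrow> ennreal"
  assumes [measurable]: "h \<in> borel_measurable borel"
  shows "(\<integral>\<^sup>+x. h (norm (x::'a::euclidean_space)) \<partial>lborel) =
    (\<integral>\<^sup>+r\<in>{0..}. h r * ennreal (real DIM('a) * measure lebesgue (ball (0::'a) 1) * r^(DIM('a) - 1)) \<partial>lborel)"
proof -
  have "(\<integral>\<^sup>+x. h (norm (x::'a)) \<partial>lborel) = (\<integral>\<^sup>+r. h r \<partial>distr lborel borel (norm :: 'a \<Rightarrow> real))"
    by (subst nn_integral_distr) auto
  also have "\<dots> = (\<integral>\<^sup>+r\<in>{0..}. h r * ennreal (real DIM('a) * measure lebesgue (ball (0::'a) 1) * r^(DIM('a) - 1)) \<partial>lborel)"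
    unfolding distr_norm_lborel by (subst nn_integral_density) (auto simp: ac_simps)
  finally show ?thesis .
qed

text \<open>The profile of a radial Lebesgue measurable function need not be Borel. By inner regularity its superlevel sets
contain sigma-compact sets of full measure, and the norm maps these to Borel sets.\<close>

lemma radial_borel_representative:
  fixes f :: "'a::euclidean_space \<Rightarrow> real"
  assumes f: "f \<in> borel_measurable lebesgue" and rad: "\<And>x. f x = v (norm x)"
    and f0: "\<And>x. 0 \<le> f x" and fC: "\<And>x. f x \<le> C"
  obtains w :: "real \<Rightarrow> real" where "w \<in> borel_measurable borel" "\<And>r. 0 \<le> w r" "\<And>r. w r \<le> C"
    "AE x in lebesgue. f x = w (norm x)"
proof -
  \<comment> \<open>The Borel set \<open>A\<close> of radii describes the superlevel set of
    \<open>f\<close> at level \<open>a\<close> off the null set \<open>N\<close>. The clause that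
    each radius in \<open>A\<close> is realized by a point holds without exception; it carries the
    bound \<open>C\<close> over to all radii.\<close>
  define P where "P a A N \<longleftrightarrow> A \<in> sets borel \<and> negligible N \<and> (\<forall>r\<in>A. \<exists>x. norm x = r \<and> a < f x) \<and>
          (\<forall>x. x \<notin> N \<longrightarrow> (norm x \<in> A \<longleftrightarrow> a < f x))" for a A N
  have "\<exists>A N. P a A N" for a
  proof -
    have "{x. a < f x} \<in> sets lebesgue"
      using f[THEN measurable_sets, of "{a<..}"] by (simp add: vimage_def)
    then obtain C t where C: "fsigma C" "t \<in> null_sets lebesgue" "C \<union> t = {x. a < f x}" "disjnt C t"
      by (rule lebesgue_set_almost_fsigma)
    then obtain F :: "nat \<Rightarrow> 'a set" where F: "range F \<subseteq> Collect compact" "C = \<Union>(F ` UNIV)"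
      using fsigma_Union_compact[of C] by blast
    have "norm ` F n \<in> sets borel" for n
      using F(1) by (intro borel_compact compact_continuous_image continuous_intros) auto
    then have "(\<Union>n. norm ` F n) \<in> sets borel" by auto
    moreover have "\<forall>r\<in>(\<Union>n. norm ` F n). \<exists>x. norm x = r \<and> a < f x"
      using F(2) C(3) by auto
    moreover have "norm x \<in> (\<Union>n. norm ` F n) \<longleftrightarrow> a < f x" if "x \<notin> t" for x
    proof
      assume "norm x \<in> (\<Union>n. norm ` F n)"
      then obtain y n where "y \<in> F n" "norm x = norm y" by auto
      moreover from this have "a < f y" using F(2) C(3) by auto
      ultimately show "a < f x" using rad[of x] rad[of y] by simp
    next
      assume "a < f x"
      then have "x \<in> C" using C(3) that by auto
      then show "norm x \<in> (\<Union>n. norm ` F n)" using F(2) by auto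
    qed
    ultimately show ?thesis using C(2) unfolding P_def negligible_iff_null_sets by blast
  qed
  then obtain A N where AN: "\<And>a. P a (A a) (N a)" by metis
  have A: "\<And>a. A a \<in> sets borel" and N: "\<And>a. negligible (N a)"
    and A1: "\<And>a r. r \<in> A a \<Longrightarrow> \<exists>x. norm x = r \<and> a < f x"
    and A2: "\<And>a x. x \<notin> N a \<Longrightarrow> norm x \<in> A a \<longleftrightarrow> a < f x"
    using AN unfolding P_def by blast+
  define Q where "Q = (\<rat> \<inter> {0..} :: real set)"
  have Q: "countable Q" unfolding Q_def using countable_rat by blast
  have C0: "0 \<le> C" using f0[of 0] fC[of 0] by simp
  \<comment> \<open>Reconstruction from rational levels only, so that the union of the exceptional
    sets is still null.\<close>
  define we where "we r = (SUP a\<in>Q. ennreal a * indicator (A a) r)" for r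
  have we: "we \<in> borel_measurable borel"
    unfolding we_def using A Q by (intro borel_measurable_SUP) auto
  have weC: "we r \<le> ennreal C" for r
    unfolding we_def
  proof (rule SUP_least)
    fix a assume "a \<in> Q"
    show "ennreal a * indicator (A a) r \<le> ennreal C"
    proof (cases "r \<in> A a")
      case True
      then obtain x where "a < f x" using A1 by blast
      then show ?thesis using fC[of x] True by (auto intro!: ennreal_leI)
    qed auto
  qed
  have eq: "we (norm x) = ennreal (f x)" if "x \<notin> (\<Union>a\<in>Q. N a)" for x
  proof (rule antisym)
    show "we (norm x) \<le> ennreal (f x)" unfolding we_def
      using that A2 f0 by (intro SUP_least) (auto simp: indicator_def intro!: ennreal_leI less_imp_le)
    show "ennreal (f x) \<le> we (norm x)"
    proof (rule ccontr)
      assume n: "\<not> ennreal (f x) \<le> we (norm x)"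
      then obtain s where s: "we (norm x) = ennreal s" "s \<ge> 0" 
        using weC[of "norm x"] by (cases "we (norm x)") (auto simp: top_unique)
      then have "s < f x" using n f0[of x] by (metis ennreal_leI leI)
      then obtain a where a: "a \<in> \<rat>" "s < a" "a < f x" using Rats_dense_in_real by blast
      then have "a \<in> Q" unfolding Q_def using s by auto
      then have "ennreal a * indicator (A a) (norm x) \<le> we (norm x)"
        unfolding we_def by (rule SUP_upper)
      moreover have "norm x \<in> A a" using A2 that \<open>a \<in> Q\<close> a by auto
      ultimately have "ennreal a \<le> ennreal s" using s by simp
      then show False using a s by (simp add: ennreal_le_iff)
    qed
  qed
  have "negligible (\<Union>a\<in>Q. N a)"
    using Q N by (intro negligible_countable_Union) auto
  then have "AE x in lebesgue. x \<notin> (\<Union>a\<in>Q. N a)"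
    using AE_not_in negligible_iff_null_sets by blast
  then have "AE x in lebesgue. f x = enn2real (we (norm x))"
    by (rule AE_mp) (use eq f0 in \<open>auto intro!: AE_I2\<close>)
  moreover have "enn2real (we r) \<le> C" for r
    using enn2real_mono[OF weC[of r]] C0 by simp
  ultimately show ?thesis
    using we by (intro that[of "\<lambda>r. enn2real (we r)"]) auto
qed

subsection \<open>The divergence identity for radial vector fields\<close>

text \<open>Lipschitz continuity allows to differentiate the constant function \<open>t \<mapsto> \<integral> h(x + t b) dx\<close> under the integral,
although \<open>h\<close> (built from \<open>x/|x|\<close>) is not differentiable at the origin.\<close>

lemma integral_directional_derivative_eq_0:
  fixes h D :: "'a::euclidean_space \<Rightarrow> real" and b :: 'a
  assumes lip: "\<And>x y. \<bar>h x - h y\<bar> \<le> L * norm (x - y)" 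
    and supp: "\<And>x. norm x > R \<Longrightarrow> h x = 0"
    and D [measurable]: "D \<in> borel_measurable borel"
    and der: "AE x in lborel. ((\<lambda>t. h (x + t *\<^sub>R b)) has_real_derivative D x) (at 0)"
  shows "integrable lborel D" "integral\<^sup>L lborel D = 0"
proof -
  have cont: "continuous_on UNIV h"
  proof (rule continuous_onI)
    fix x e :: real and y :: 'a assume "e > 0"
    show "\<exists>d>0. \<forall>x'\<in>UNIV. dist x' y < d \<longrightarrow> dist (h x') (h y) \<le> e"
    proof (intro exI[of _ "e / (\<bar>L\<bar> + 1)"] conjI ballI impI)
      fix x' assume *: "dist x' y < e / (\<bar>L\<bar> + 1)"
      have "dist (h x') (h y) \<le> L * norm (x' - y)" using lip[of x' y] by (simp add: dist_real_def)
      also have "\<dots> \<le> (\<bar>L\<bar> + 1) * norm (x' - y)" by (intro mult_right_mono) auto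
      also have "\<dots> \<le> e" using * by (simp add: dist_norm field_simps)
      finally show "dist (h x') (h y) \<le> e" .
    qed (use \<open>e > 0\<close> in auto)
  qed
  have [measurable]: "h \<in> borel_measurable borel" using cont by (rule borel_measurable_continuous_onI)
  have hint: "integrable lborel h"
  proof -
    have "integrable lborel (\<lambda>x. indicator (cball 0 R) x *\<^sub>R h x)"
      by (rule borel_integrable_compact) (auto intro: continuous_on_subset[OF cont])
    also have "(\<lambda>x. indicator (cball 0 R) x *\<^sub>R h x) = h"
      using supp by (auto simp: indicator_def fun_eq_iff)
    finally show ?thesis .
  qed
  have L0: "L \<ge> 0"
  proof -
    obtain i :: 'a where "i \<in> Basis" using nonempty_Basis by blast
    then have "0 \<le> L * norm (i - 0)" "norm i = 1" using lip[of i 0] by auto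
    then show ?thesis by simp
  qed
  \<comment> \<open>Translation invariance makes every difference quotient integrate to 0; only the
    passage to the limit remains to be justified.\<close>
  have tint: "integrable lborel (\<lambda>x. h (x + c))" "(\<integral>x. h (x + c) \<partial>lborel) = integral\<^sup>L lborel h" for c
  proof -
    have "integrable (distr lborel borel ((+) c)) h" using hint by (simp add: lborel_distr_plus)
    then show "integrable lborel (\<lambda>x. h (x + c))"
      by (subst (asm) integrable_distr_eq) (auto simp: add.commute)
    have "integral\<^sup>L (distr lborel borel ((+) c)) h = (\<integral>x. h (c + x) \<partial>lborel)"
      by (rule integral_distr) auto
    then show "(\<integral>x. h (x + c) \<partial>lborel) = integral\<^sup>L lborel h"
      by (simp add: lborel_distr_plus add.commute)
  qed
  define t where "t n = inverse (real (Suc n))" for n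
  have t: "t \<longlonglongrightarrow> 0" "\<And>n. t n > 0" "\<And>n. t n \<le> 1"
    unfolding t_def using LIMSEQ_inverse_real_of_nat by (auto simp: field_simps)
  define q where "q n x = (h (x + t n *\<^sub>R b) - h x) / t n" for n x
  have qint: "integrable lborel (q n)" "integral\<^sup>L lborel (q n) = 0" for n
    unfolding q_def using tint hint by (auto simp: integral_diff)
  let ?w = "\<lambda>x::'a. (L * norm b) * indicator (cball 0 (R + norm b)) x"
  have wint: "integrable lborel ?w"
    by (rule integrable_mult_right) (use emeasure_compact_finite[OF compact_cball, of "0::'a" "R + norm b"] in \<open>simp add: integrable_indicator_iff\<close>)
  have bound: "norm (q n x) \<le> ?w x" for n x
  proof (cases "norm x \<le> R + norm b")
    case True
    have "\<bar>h (x + t n *\<^sub>R b) - h x\<bar> \<le> L * norm (t n *\<^sub>R b)" using lip[of "x + t n *\<^sub>R b" x] by simp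
    then show ?thesis using True t(2)[of n] by (simp add: q_def field_simps)
  next
    case False
    have "t n * norm b \<le> 1 * norm b" using t(3) by (rule mult_right_mono) simp
    then have "norm (t n *\<^sub>R b) \<le> norm b" using t(2)[of n] by simp
    then have "norm (x + t n *\<^sub>R b) > R" using False norm_diff_ineq[of x "t n *\<^sub>R b"] by linarith
    moreover have "norm x > R" using False norm_ge_zero[of b] by linarith
    ultimately show ?thesis using False supp by (simp add: q_def)
  qed
  have lim: "AE x in lborel. (\<lambda>n. q n x) \<longlonglongrightarrow> D x"
    using der
  proof (eventually_elim)
    case (elim x)
    then have "((\<lambda>s. (h (x + s *\<^sub>R b) - h x) / s) \<longlongrightarrow> D x) (at 0)"
      by (simp add: DERIV_def)
    moreover have "filterlim t (at 0) sequentially"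
      using t(1) t(2) by (auto simp: filterlim_at intro!: always_eventually) (metis less_irrefl)
    ultimately show ?case unfolding q_def by (rule filterlim_compose)
  qed
  have Dm: "D \<in> borel_measurable lborel" and qm: "\<And>n. q n \<in> borel_measurable lborel"
    using D borel_measurable_integrable[OF qint(1)] by auto
  have bound': "\<And>n. AE x in lborel. norm (q n x) \<le> ?w x" using bound by (intro AE_I2)
  show "integrable lborel D"
    by (rule integrable_dominated_convergence[OF Dm qm wint lim bound'])
  have "(\<lambda>n. integral\<^sup>L lborel (q n)) \<longlonglongrightarrow> integral\<^sup>L lborel D"
    by (rule integral_dominated_convergence[OF Dm qm wint lim bound'])
  then show "integral\<^sup>L lborel D = 0" using qint LIMSEQ_unique[OF _ tendsto_const] by auto
qed

lemma test_fnD: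
  fixes \<phi> :: "'a::euclidean_space \<Rightarrow> real"
  assumes "test_fn S \<phi>"
  shows "\<And>x. (\<phi> has_derivative (\<lambda>v. grad \<phi> x \<bullet> v)) (at x)"
    and "continuous_on UNIV (grad \<phi>)"
    and "\<And>x. x \<notin> closure {x. \<phi> x \<noteq> 0} \<Longrightarrow> grad \<phi> x = 0"
proof -
  have "Ck (Suc 0) \<phi>" using assms unfolding test_fn_def smooth_def by blast
  then have d: "\<phi> differentiable_on UNIV" and c: "\<And>i. i \<in> Basis \<Longrightarrow> continuous_on UNIV (\<lambda>x. frechet_derivative \<phi> (at x) i)"
    by auto
  show hd: "(\<phi> has_derivative (\<lambda>v. grad \<phi> x \<bullet> v)) (at x)" for x
  proof -
    have D: "(\<phi> has_derivative frechet_derivative \<phi> (at x)) (at x)"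
      using d by (simp add: differentiable_on_def frechet_derivative_works)
    have "frechet_derivative \<phi> (at x) = (\<lambda>v. grad \<phi> x \<bullet> v)"
    proof
      fix v
      interpret bounded_linear "frechet_derivative \<phi> (at x)" using D by (rule has_derivative_bounded_linear)
      have "frechet_derivative \<phi> (at x) v = frechet_derivative \<phi> (at x) (\<Sum>b\<in>Basis. (v \<bullet> b) *\<^sub>R b)"
        by (simp add: euclidean_representation)
      also have "\<dots> = (\<Sum>b\<in>Basis. (v \<bullet> b) * frechet_derivative \<phi> (at x) b)"
        by (simp add: sum scaleR)
      also have "\<dots> = grad \<phi> x \<bullet> v"
        unfolding grad_def inner_sum_left inner_scaleR_left by (simp add: inner_commute mult.commute)
      finally show "frechet_derivative \<phi> (at x) v = grad \<phi> x \<bullet> v" .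
    qed
    with D show ?thesis by simp
  qed
  show "continuous_on UNIV (grad \<phi>)"
    unfolding grad_def using c by (intro continuous_intros) auto
  show "grad \<phi> x = 0" if "x \<notin> closure {x. \<phi> x \<noteq> 0}" for x
  proof -
    have "((\<lambda>_. 0) has_derivative (\<lambda>v. grad \<phi> x \<bullet> v)) (at x)"
      by (rule has_derivative_transform_within_open[OF hd, of "- closure {x. \<phi> x \<noteq> 0}"])
         (use that closure_subset[of "{x. \<phi> x \<noteq> 0}"] in auto)
    then have "(\<lambda>v. grad \<phi> x \<bullet> v) = (\<lambda>_. 0)"
      using has_derivative_unique[OF _ has_derivative_const] by metis
    then have "grad \<phi> x \<bullet> grad \<phi> x = 0" by (rule fun_cong)
    then show ?thesis by simp
  qed
qed

text \<open>Compact support in the open ball leaves a collar at the sphere where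
  \<open>\<phi>\<close> vanishes. A field given only on the unit ball may therefore be continued
  beyond it in any Lipschitz way.\<close>

lemma test_fn_ball_support:
  fixes \<phi> :: "'a::euclidean_space \<Rightarrow> real"
  assumes "test_fn (ball 0 1) \<phi>"
  obtains R where "R < 1" "\<And>x::'a. norm x > R \<Longrightarrow> \<phi> x = 0"
proof -
  let ?K = "closure {x. \<phi> x \<noteq> 0}"
  have K: "compact ?K" "?K \<subseteq> ball 0 1" using assms by (auto simp: test_fn_def)
  show ?thesis
  proof (cases "?K = {}")
    case True
    then show ?thesis using closure_subset[of "{x. \<phi> x \<noteq> 0}"] by (intro that[of 0]) auto
  next
    case False
    then obtain z where z: "z \<in> ?K" "\<And>y. y \<in> ?K \<Longrightarrow> norm y \<le> norm z"
      using continuous_attains_sup[OF K(1) False, of norm] by (auto intro: continuous_on_norm_id)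
    show ?thesis
    proof (rule that[of "norm z"])
      show "norm z < 1" using z(1) K(2) by auto
      fix x :: 'a assume "norm x > norm z"
      then have "x \<notin> ?K" using z(2)[of x] by linarith
      then show "\<phi> x = 0" using subsetD[OF closure_subset, of x "{x. \<phi> x \<noteq> 0}"] by blast
    qed
  qed
qed

text \<open>For \<open>norm x \<le> norm y\<close> the difference is split into the change of
  direction, weighted by \<open>T (norm x)\<close>, and the change of the profile. Directions vary
  with Lipschitz constant \<open>2 / norm x\<close>, which the bound \<open>L * norm x\<close> on
  the weight compensates; this gives \<open>2 * L + L\<close>.\<close>

lemma lipschitz_radial_field:
  fixes x y :: "'a::euclidean_space"
  assumes T: "\<And>r s. 0 \<le> r \<Longrightarrow> 0 \<le> s \<Longrightarrow> \<bar>T r - T s\<bar> \<le> L * \<bar>r - s\<bar>" and T0: "T 0 = (0::real)"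
  shows "norm ((T (norm x) / norm x) *\<^sub>R x - (T (norm y) / norm y) *\<^sub>R y) \<le> 3 * L * norm (x - y)"
proof -
  have L0: "L \<ge> 0" using order_trans[OF abs_ge_zero T[of 0 1]] by simp
  have bd: "\<bar>T r\<bar> \<le> L * r" if "r \<ge> 0" for r using T[OF that order.refl] T0 that by simp
  have main: "norm ((T (norm x) / norm x) *\<^sub>R x - (T (norm y) / norm y) *\<^sub>R y) \<le> 3 * L * norm (x - y)"
    if le: "norm x \<le> norm y" for x y :: 'a
  proof (cases "x = 0")
    case True
    have "0 \<le> L * norm y" using L0 by simp
    then have "\<bar>T (norm y)\<bar> \<le> 3 * (L * norm y)" using bd[of "norm y"] norm_ge_zero[of y] by linarith
    then show ?thesis using True by (cases "y = 0") (auto simp: T0)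
  next
    case False
    then have x: "norm x > 0" and y: "norm y > 0" using le by auto
    have "x /\<^sub>R norm x - y /\<^sub>R norm y = (x - y) /\<^sub>R norm x + (inverse (norm x) - inverse (norm y)) *\<^sub>R y"
      by (simp add: algebra_simps)
    then have "norm (x /\<^sub>R norm x - y /\<^sub>R norm y) \<le> norm (x - y) / norm x + \<bar>inverse (norm x) - inverse (norm y)\<bar> * norm y"
      using norm_triangle_ineq[of "(x - y) /\<^sub>R norm x" "(inverse (norm x) - inverse (norm y)) *\<^sub>R y"] x
      by (simp add: divide_inverse mult.commute)
    also have "\<bar>inverse (norm x) - inverse (norm y)\<bar> * norm y = (norm y - norm x) / norm x"
    proof -
      have "inverse (norm x) - inverse (norm y) = (norm y - norm x) / (norm x * norm y)"
        using x y by (simp add: field_simps)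
      moreover have "\<dots> \<ge> 0" using x y le by simp
      ultimately show ?thesis using x y le by simp
    qed
    also have "\<dots> \<le> norm (x - y) / norm x"
      using x norm_triangle_ineq2[of y x] by (intro divide_right_mono) (auto simp: norm_minus_commute)
    finally have 1: "norm (x /\<^sub>R norm x - y /\<^sub>R norm y) \<le> 2 * norm (x - y) / norm x" by simp
    define e where "e = y /\<^sub>R norm y"
    have e: "norm e = 1" using y by (simp add: e_def)
    have "(T (norm x) / norm x) *\<^sub>R x - (T (norm y) / norm y) *\<^sub>R y =
        T (norm x) *\<^sub>R (x /\<^sub>R norm x - e) + (T (norm x) - T (norm y)) *\<^sub>R e"
      by (simp add: e_def scaleR_diff_right scaleR_diff_left divide_inverse left_diff_distrib)
    also have "norm \<dots> \<le> \<bar>T (norm x)\<bar> * norm (x /\<^sub>R norm x - e) + \<bar>T (norm x) - T (norm y)\<bar>"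
      using norm_triangle_ineq[of "T (norm x) *\<^sub>R (x /\<^sub>R norm x - e)" "(T (norm x) - T (norm y)) *\<^sub>R e"]
      by (simp add: e)
    also have "\<bar>T (norm x)\<bar> * norm (x /\<^sub>R norm x - e) \<le> (L * norm x) * (2 * norm (x - y) / norm x)"
      by (intro mult_mono 1[folded e_def] bd) (use L0 in auto)
    also have "\<dots> = 2 * L * norm (x - y)" using x by simp
    also have "\<bar>T (norm x) - T (norm y)\<bar> \<le> L * norm (x - y)"
      using T[of "norm x" "norm y"] mult_left_mono[OF norm_triangle_ineq3[of x y] L0] by simp
    finally show ?thesis by simp
  qed
  show ?thesis
  proof (cases "norm x \<le> norm y")
    case False
    then have "norm y \<le> norm x" by simp
    from main[OF this] show ?thesis by (simp add: norm_minus_commute)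
  qed (rule main)
qed

text \<open>\<open>radial_div T T'\<close> is the divergence of the field \<open>T(|x|) x/|x|\<close> on the unit ball when \<open>T'\<close> is the derivative of \<open>T\<close>.\<close>

definition radial_field :: "(real \<Rightarrow> real) \<Rightarrow> 'a::euclidean_space \<Rightarrow> 'a" where
  "radial_field T x = (T (norm x) / norm x) *\<^sub>R x"

definition radial_div :: "(real \<Rightarrow> real) \<Rightarrow> (real \<Rightarrow> real) \<Rightarrow> 'a::euclidean_space \<Rightarrow> real" where
  "radial_div T T' x = indicator (ball 0 1 - {0}) x *
     (T' (norm x) + (real DIM('a) - 1) * (T (norm x) / norm x))"

text \<open>Lipschitz continuity is required on the closed interval but differentiability only
  inside, which is all that the transport map will provide. Together with \<open>T 0 = 0\<close> the
  constant \<open>L\<close> bounds both \<open>T'\<close> and \<open>T r / r\<close>, hence the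
  field and its divergence.\<close>

locale radial_profile =
  fixes T T' :: "real \<Rightarrow> real" and L :: real
  assumes T0: "T 0 = 0"
    and T_lip: "\<And>r s. 0 \<le> r \<Longrightarrow> r \<le> 1 \<Longrightarrow> 0 \<le> s \<Longrightarrow> s \<le> 1 \<Longrightarrow> \<bar>T r - T s\<bar> \<le> L * \<bar>r - s\<bar>"
    and T_deriv: "\<And>r. 0 < r \<Longrightarrow> r < 1 \<Longrightarrow> (T has_real_derivative T' r) (at r)"
    and T'_cont: "continuous_on {0<..<1} T'"
begin

lemma L_nonneg: "0 \<le> L"
  using order_trans[OF abs_ge_zero T_lip[of 0 1]] by simp

lemma T_bound: "\<bar>T r\<bar> \<le> L * r" if "0 \<le> r" "r \<le> 1"
  using T_lip[of r 0] that T0 by simp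

lemma T_cont: "continuous_on {0..1} T"
proof (rule continuous_onI)
  fix x e :: real assume "e > 0" "x \<in> {0..1}"
  show "\<exists>d>0. \<forall>x'\<in>{0..1}. dist x' x < d \<longrightarrow> dist (T x') (T x) \<le> e"
  proof (intro exI[of _ "e / (L + 1)"] conjI ballI impI)
    fix x' assume *: "dist x' x < e / (L + 1)" "x' \<in> {0..1}"
    have "\<bar>T x' - T x\<bar> \<le> L * \<bar>x' - x\<bar>" using * \<open>x \<in> _\<close> by (intro T_lip) auto
    also have "\<dots> \<le> (L + 1) * \<bar>x' - x\<bar>" by (intro mult_right_mono) auto
    also have "\<dots> \<le> e" using * L_nonneg by (simp add: dist_real_def field_simps)
    finally show "dist (T x') (T x) \<le> e" by (simp add: dist_real_def)
  qed (use \<open>e > 0\<close> L_nonneg in auto)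
qed

lemma T'_bound: "\<bar>T' r\<bar> \<le> L" if r: "0 < r" "r < 1"
proof (rule tendsto_upperbound)
  show "((\<lambda>s. \<bar>(T s - T r) / (s - r)\<bar>) \<longlongrightarrow> \<bar>T' r\<bar>) (at r)"
    using T_deriv[OF r] by (intro tendsto_intros) (simp add: has_field_derivative_iff)
  have "\<forall>\<^sub>F s in at r. s \<in> {0<..<1} \<and> s \<noteq> r"
    using r by (auto simp: eventually_at_topological intro!: exI[of _ "{0<..<1}"])
  then show "\<forall>\<^sub>F s in at r. \<bar>(T s - T r) / (s - r)\<bar> \<le> L"
  proof eventually_elim
    case (elim s)
    then have "\<bar>T s - T r\<bar> \<le> L * \<bar>s - r\<bar>" using r by (intro T_lip) auto
    then show ?case using elim by (simp add: abs_divide divide_le_eq)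
  qed
qed simp

lemma norm_radial_field: "norm (radial_field T x) \<le> \<bar>T (norm x)\<bar>"
  by (cases "x = 0") (auto simp: radial_field_def)

lemma norm_radial_field_le: "norm (radial_field T x) \<le> L" if "x \<in> ball 0 1"
proof -
  have "\<bar>T (norm x)\<bar> \<le> L * norm x" using that by (intro T_bound) auto
  also have "\<dots> \<le> L * 1" using that L_nonneg by (intro mult_left_mono) auto
  finally show ?thesis using norm_radial_field[of x] by simp
qed

lemma radial_div_bound: "\<bar>radial_div T T' (x::'a::euclidean_space)\<bar> \<le> real DIM('a) * L"
proof (cases "x \<in> ball 0 1 - {0}")
  case True
  have N: "real DIM('a) \<ge> 1" using DIM_positive[where 'a='a] by linarith
  have "\<bar>T (norm x) / norm x\<bar> \<le> L" using T_bound[of "norm x"] True by (simp add: divide_le_eq)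
  then have "(real DIM('a) - 1) * \<bar>T (norm x) / norm x\<bar> \<le> (real DIM('a) - 1) * L"
    using N by (intro mult_left_mono) auto
  then have "\<bar>(real DIM('a) - 1) * (T (norm x) / norm x)\<bar> \<le> (real DIM('a) - 1) * L"
    using N by (simp add: abs_mult)
  moreover have "\<bar>T' (norm x)\<bar> \<le> L" using True by (intro T'_bound) auto
  moreover have "(real DIM('a) - 1) * L = real DIM('a) * L - L" by (simp add: algebra_simps)
  ultimately have "\<bar>T' (norm x) + (real DIM('a) - 1) * (T (norm x) / norm x)\<bar> \<le> real DIM('a) * L"
    by linarith
  then show ?thesis using True by (simp add: radial_div_def)
next
  case False then show ?thesis using L_nonneg by (auto simp: radial_div_def)
qed

lemma continuous_on_T_norm: "continuous_on (ball 0 1) (\<lambda>x::'a::euclidean_space. T (norm x))"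
  by (rule continuous_on_compose2[OF T_cont]) (auto intro!: continuous_intros)

lemma continuous_on_T'_norm: "continuous_on (ball 0 1 - {0}) (\<lambda>x::'a::euclidean_space. T' (norm x))"
  by (rule continuous_on_compose2[OF T'_cont]) (auto intro!: continuous_intros)

lemma radial_field_borel: "(\<lambda>x::'a::euclidean_space. indicator (ball 0 1) x *\<^sub>R radial_field T x) \<in> borel_measurable borel"
proof -
  have "(\<lambda>x::'a. indicator (ball 0 1 - {0}) x *\<^sub>R radial_field T x) \<in> borel_measurable borel"
    unfolding radial_field_def
    by (intro borel_measurable_continuous_on_indicator continuous_intros continuous_on_subset[OF continuous_on_T_norm]) auto
  also have "(\<lambda>x::'a. indicator (ball 0 1 - {0}) x *\<^sub>R radial_field T x) = (\<lambda>x. indicator (ball 0 1) x *\<^sub>R radial_field T x)"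
    by (auto simp: indicator_def radial_field_def fun_eq_iff)
  finally show ?thesis .
qed

lemma radial_div_borel: "(radial_div T T' :: 'a::euclidean_space \<Rightarrow> real) \<in> borel_measurable borel"
  unfolding radial_div_def[abs_def] real_scaleR_def[symmetric]
  by (intro borel_measurable_continuous_on_indicator continuous_intros
       continuous_on_subset[OF continuous_on_T_norm] continuous_on_T'_norm) auto

text \<open>\<open>E\<close> is the divergence of \<open>\<theta> (\<phi> x)\<close> times the
  radial field. Its parts \<open>D b\<close>, one for each coordinate direction, are directional
  derivatives of Lipschitz functions with bounded support, so each integrates to 0; the exceptional
  origin is a null set.\<close>

lemma test_fn_divergence:
  fixes \<phi> :: "'a::euclidean_space \<Rightarrow> real" and \<theta> \<theta>' :: "real \<Rightarrow> real"
  assumes \<phi>: "test_fn (ball 0 1) \<phi>"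
    and \<theta>0: "\<theta> 0 = 0" and \<theta>: "\<And>t. (\<theta> has_real_derivative \<theta>' t) (at t)"
    and \<theta>'c: "continuous_on UNIV \<theta>'" and \<theta>'b: "\<And>t. \<bar>\<theta>' t\<bar> \<le> C"
  defines "E \<equiv> \<lambda>x. indicator (ball 0 1) x * (\<theta>' (\<phi> x) * (grad \<phi> x \<bullet> radial_field T x)) + \<theta> (\<phi> x) * radial_div T T' x"
  shows "integrable lborel E" "integral\<^sup>L lborel E = 0"
proof -
  note D\<phi> = test_fnD[OF \<phi>]
  obtain R where R: "R < 1" "\<And>x::'a. norm x > R \<Longrightarrow> \<phi> x = 0" by (rule test_fn_ball_support[OF \<phi>]) auto
  have C0: "C \<ge> 0" using \<theta>'b[of 0] by linarith
  have c\<theta>: "continuous_on UNIV \<theta>" using \<theta> by (meson DERIV_continuous continuous_at_imp_continuous_on)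
  have c\<phi>: "continuous_on UNIV \<phi>" using D\<phi>(1) by (meson has_derivative_continuous continuous_at_imp_continuous_on)
  define a where "a x = \<theta> (\<phi> x)" for x
  have ca: "continuous_on UNIV a" unfolding a_def
    by (rule continuous_on_compose2[OF c\<theta> c\<phi>]) auto
  have a0: "a x = 0" if "norm x > R" for x using R(2)[OF that] \<theta>0 by (simp add: a_def)
  obtain G where G: "\<And>x. norm (grad \<phi> x) \<le> G"
  proof -
    let ?K = "closure {x. \<phi> x \<noteq> 0}"
    have "compact (grad \<phi> ` ?K)" using \<phi> D\<phi>(2) unfolding test_fn_def
      by (intro compact_continuous_image) (auto intro: continuous_on_subset)
    then obtain b where b: "\<And>x. x \<in> ?K \<Longrightarrow> norm (grad \<phi> x) \<le> b" 
      using compact_imp_bounded[of "grad \<phi> ` ?K"] unfolding bounded_iff by auto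
    have "norm (grad \<phi> x) \<le> max b 0" for x using b[of x] D\<phi>(3)[of x] by (cases "x \<in> ?K") auto
    then show ?thesis by (rule that)
  qed
  have G0: "G \<ge> 0" using order_trans[OF norm_ge_zero G] .
  have alip: "\<bar>a x - a y\<bar> \<le> (C * G) * norm (x - y)" for x y
  proof -
    have 1: "norm (\<phi> x - \<phi> y) \<le> G * norm (x - y)"
    proof (rule differentiable_bound[of UNIV \<phi> "\<lambda>x v. grad \<phi> x \<bullet> v"])
      show "onorm (\<lambda>v. grad \<phi> x \<bullet> v) \<le> G" for x
      proof (rule onorm_le)
        fix v
        have "norm (grad \<phi> x \<bullet> v) \<le> norm (grad \<phi> x) * norm v" using Cauchy_Schwarz_ineq2 by simp
        also have "\<dots> \<le> G * norm v" using G by (intro mult_right_mono) auto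
        finally show "norm (grad \<phi> x \<bullet> v) \<le> G * norm v" .
      qed
    qed (use D\<phi>(1) in auto)
    have 2: "norm (\<theta> s - \<theta> t) \<le> C * norm (s - t)" for s t
      by (rule field_differentiable_bound[of UNIV \<theta> \<theta>']) (use \<theta> \<theta>'b in auto)
    have "\<bar>a x - a y\<bar> \<le> C * norm (\<phi> x - \<phi> y)" using 2 by (simp add: a_def)
    also have "\<dots> \<le> C * (G * norm (x - y))" using 1 C0 by (rule mult_left_mono)
    finally show ?thesis by simp
  qed
  obtain A where A: "\<And>x. \<bar>a x\<bar> \<le> A"
  proof -
    have "compact (a ` cball 0 R)" by (intro compact_continuous_image continuous_on_subset[OF ca]) auto
    then obtain b where "\<forall>y\<in>a ` cball 0 R. norm y \<le> b"
      using compact_imp_bounded[of "a ` cball 0 R"] unfolding bounded_iff by blast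
    then have b: "\<And>x. x \<in> cball 0 R \<Longrightarrow> norm (a x) \<le> b" by blast
    have "\<bar>a x\<bar> \<le> max b 0" for x using b[of x] a0[of x] by (cases "norm x \<le> R") auto
    then show ?thesis by (rule that)
  qed
  have A0: "A \<ge> 0" using order_trans[OF abs_ge_zero A] .
  \<comment> \<open>The profile is frozen at its value at 1 outside the ball, which makes the field
    Lipschitz on the whole space. The product with \<open>a\<close> is unaffected, since
    \<open>a\<close> vanishes for \<open>norm x > R\<close> and \<open>R < 1\<close>.\<close>
  define \<Psi> where "\<Psi> = (radial_field (\<lambda>r. T (min r 1)) :: 'a \<Rightarrow> 'a)"
  have \<Psi>lip: "norm (\<Psi> x - \<Psi> y) \<le> (3 * L) * norm (x - y)" for x y
    unfolding \<Psi>_def radial_field_def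
  proof (rule lipschitz_radial_field[where T="\<lambda>r. T (min r 1)" and L=L])
    fix r s :: real assume rs: "0 \<le> r" "0 \<le> s"
    have "\<bar>T (min r 1) - T (min s 1)\<bar> \<le> L * \<bar>min r 1 - min s 1\<bar>" by (rule T_lip) (use rs in auto)
    also have "\<dots> \<le> L * \<bar>r - s\<bar>" using L_nonneg by (intro mult_left_mono) auto
    finally show "\<bar>T (min r 1) - T (min s 1)\<bar> \<le> L * \<bar>r - s\<bar>" .
  qed (simp add: T0)
  have \<Psi>b: "norm (\<Psi> x) \<le> L" for x
  proof -
    have "norm (\<Psi> x) \<le> \<bar>T (min (norm x) 1)\<bar>" by (cases "x = 0") (auto simp: \<Psi>_def radial_field_def)
    also have "\<dots> \<le> L * min (norm x) 1" by (intro T_bound) auto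
    also have "\<dots> \<le> L * 1" using L_nonneg by (intro mult_left_mono) auto
    finally show ?thesis by simp
  qed
  define h where "h b x = a x * (\<Psi> x \<bullet> b)" for b x
  \<comment> \<open>Product rule for
    \<open>\<theta> (\<phi> x) * (T r / r) * (x \<bullet> b)\<close> with \<open>r = norm x\<close>;
    the derivative of \<open>r\<close> along \<open>b\<close> is
    \<open>(x \<bullet> b) / r\<close>.\<close>
  define D where "D b x = indicator (ball 0 1 - {0}) x *
     (\<theta>' (\<phi> x) * (grad \<phi> x \<bullet> b) * (radial_field T x \<bullet> b) +
      \<theta> (\<phi> x) * (T (norm x) / norm x * (b \<bullet> b) + (T' (norm x) / norm x - T (norm x) / (norm x)^2) * (x \<bullet> b)^2 / norm x))" for b x
  have "integrable lborel (D b) \<and> integral\<^sup>L lborel (D b) = 0" if b: "b \<in> Basis" for b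
  proof -
    have nb: "norm b = 1" using b by simp
    have hlip: "\<bar>h b x - h b y\<bar> \<le> (C * G * L + A * (3 * L)) * norm (x - y)" for x y
    proof -
      have "h b x - h b y = (a x - a y) * (\<Psi> x \<bullet> b) + a y * ((\<Psi> x - \<Psi> y) \<bullet> b)"
        by (simp add: h_def inner_diff_left algebra_simps)
      also have "\<bar>\<dots>\<bar> \<le> \<bar>a x - a y\<bar> * \<bar>\<Psi> x \<bullet> b\<bar> + \<bar>a y\<bar> * \<bar>(\<Psi> x - \<Psi> y) \<bullet> b\<bar>"
        by (metis abs_mult abs_triangle_ineq)
      also have "\<dots> \<le> (C * G * norm (x - y)) * L + A * ((3 * L) * norm (x - y))"
      proof (intro add_mono mult_mono alip A)
        show "\<bar>\<Psi> x \<bullet> b\<bar> \<le> L" using Cauchy_Schwarz_ineq2[of "\<Psi> x" b] \<Psi>b[of x] nb by simp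
        show "\<bar>(\<Psi> x - \<Psi> y) \<bullet> b\<bar> \<le> 3 * L * norm (x - y)" using Cauchy_Schwarz_ineq2[of "\<Psi> x - \<Psi> y" b] \<Psi>lip[of x y] nb by simp
      qed (use C0 G0 A0 in auto)
      finally show ?thesis by (simp add: algebra_simps)
    qed
    have hsupp: "h b x = 0" if "norm x > R" for x using a0[OF that] by (simp add: h_def)
    have Dborel: "D b \<in> borel_measurable borel"
      unfolding D_def[abs_def] real_scaleR_def[symmetric]
      apply (rule borel_measurable_continuous_on_indicator)
      subgoal by simp
      unfolding radial_field_def real_scaleR_def
      by (intro continuous_intros continuous_on_compose2[OF \<theta>'c] continuous_on_compose2[OF c\<theta>]
            continuous_on_subset[OF c\<phi>] continuous_on_subset[OF D\<phi>(2)]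
            continuous_on_subset[OF continuous_on_T_norm] continuous_on_T'_norm) auto
    have der: "((\<lambda>t. h b (x + t *\<^sub>R b)) has_real_derivative D b x) (at 0)" if x0: "x \<noteq> 0" for x
    proof (cases "norm x < 1")
      case True
      have dphi: "((\<lambda>t. \<phi> (x + t *\<^sub>R b)) has_real_derivative (grad \<phi> x \<bullet> b)) (at 0)"
      proof -
        have "((\<lambda>t. \<phi> (x + t *\<^sub>R b)) has_derivative (\<lambda>t. grad \<phi> x \<bullet> (t *\<^sub>R b))) (at 0)"
        proof (rule has_derivative_compose[where f="\<lambda>t. x + t *\<^sub>R b" and g=\<phi>])
          show "((\<lambda>t. x + t *\<^sub>R b) has_derivative (\<lambda>t. t *\<^sub>R b)) (at 0)"
            by (auto intro!: derivative_eq_intros)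
          show "(\<phi> has_derivative (\<lambda>v. grad \<phi> x \<bullet> v)) (at (x + 0 *\<^sub>R b))" using D\<phi>(1) by simp
        qed
        then show ?thesis by (simp add: has_field_derivative_def mult_commute_abs)
      qed
      have dtheta: "((\<lambda>t. \<theta> (\<phi> (x + t *\<^sub>R b))) has_real_derivative (\<theta>' (\<phi> x) * (grad \<phi> x \<bullet> b))) (at 0)"
        using DERIV_chain2[OF _ dphi, of \<theta> "\<theta>' (\<phi> x)"] \<theta> by simp
      have dnorm: "((\<lambda>t. norm (x + t *\<^sub>R b)) has_real_derivative (x \<bullet> b) / norm x) (at 0)"
      proof -
        have "((\<lambda>t. norm (x + t *\<^sub>R b)) has_derivative (\<lambda>t. (t *\<^sub>R b) \<bullet> sgn (x + 0 *\<^sub>R b))) (at 0)"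
        proof (rule has_derivative_compose[where f="\<lambda>t. x + t *\<^sub>R b" and g=norm])
          show "((\<lambda>t. x + t *\<^sub>R b) has_derivative (\<lambda>t. t *\<^sub>R b)) (at 0)"
            by (auto intro!: derivative_eq_intros)
          show "(norm has_derivative (\<lambda>v. v \<bullet> sgn (x + 0 *\<^sub>R b))) (at (x + 0 *\<^sub>R b))" 
            using has_derivative_norm[of x] x0 by (simp add: inner_commute)
        qed
        moreover have "(\<lambda>t. (t *\<^sub>R b) \<bullet> sgn (x + 0 *\<^sub>R b)) = (*) ((x \<bullet> b) / norm x)"
          by (auto simp: sgn_div_norm inner_commute fun_eq_iff divide_inverse)
        ultimately show ?thesis by (simp add: has_field_derivative_def)
      qed
      have dT: "((\<lambda>t. T (norm (x + t *\<^sub>R b))) has_real_derivative (T' (norm x) * ((x \<bullet> b) / norm x))) (at 0)"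
        using DERIV_chain2[OF _ dnorm, of T "T' (norm x)"] T_deriv[of "norm x"] True x0 by simp
      have dlin: "((\<lambda>t. (x + t *\<^sub>R b) \<bullet> b) has_real_derivative (b \<bullet> b)) (at 0)"
        by (auto intro!: derivative_eq_intros simp: inner_add_left)
      have alg: "(m * s - \<tau> * s / n) * s / (n * n) + bb * \<tau> / n
          = \<tau> * bb / n + (m / n - \<tau> / n\<^sup>2) * s\<^sup>2 / n"
        for \<tau> s n m bb :: real
        by (simp add: power2_eq_square diff_divide_distrib left_diff_distrib right_diff_distrib mult_ac)
      have dd: "((\<lambda>t. \<theta> (\<phi> (x + t *\<^sub>R b)) * (T (norm (x + t *\<^sub>R b)) / norm (x + t *\<^sub>R b) * ((x + t *\<^sub>R b) \<bullet> b))) has_real_derivative D b x) (at 0)"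
        by (rule DERIV_cong[OF DERIV_mult[OF dtheta DERIV_mult[OF DERIV_divide[OF dT dnorm] dlin]]])
           (use True x0 in \<open>simp_all add: D_def radial_field_def alg\<close>)
      show ?thesis
      proof (rule DERIV_cong_ev[THEN iffD2, OF refl _ refl dd])
        have "((\<lambda>t. norm (x + t *\<^sub>R b)) \<longlongrightarrow> norm (x + 0 *\<^sub>R b)) (nhds 0)"
          by (intro tendsto_intros filterlim_ident)
        then have "\<forall>\<^sub>F t in nhds 0. norm (x + t *\<^sub>R b) < 1" 
          using True by (auto dest: order_tendstoD(2))
        then show "\<forall>\<^sub>F t in nhds 0. h b (x + t *\<^sub>R b) = \<theta> (\<phi> (x + t *\<^sub>R b)) * (T (norm (x + t *\<^sub>R b)) / norm (x + t *\<^sub>R b) * ((x + t *\<^sub>R b) \<bullet> b))"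
          by eventually_elim (simp add: h_def a_def \<Psi>_def radial_field_def min_def)
      qed
    next
      case False
      then have xR: "norm x > R" using R(1) by linarith
      have "D b x = 0" using False by (simp add: D_def)
      moreover have "((\<lambda>t. h b (x + t *\<^sub>R b)) has_real_derivative 0) (at 0)"
      proof (rule DERIV_cong_ev[THEN iffD2, OF refl _ refl DERIV_const])
        have "((\<lambda>t. norm (x + t *\<^sub>R b)) \<longlongrightarrow> norm (x + 0 *\<^sub>R b)) (nhds 0)"
          by (intro tendsto_intros filterlim_ident)
        then have "\<forall>\<^sub>F t in nhds 0. norm (x + t *\<^sub>R b) > R" 
          using xR by (auto dest: order_tendstoD(1))
        then show "\<forall>\<^sub>F t in nhds 0. h b (x + t *\<^sub>R b) = 0"
          by eventually_elim (rule hsupp)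
      qed
      ultimately show ?thesis by simp
    qed
    have "AE x::'a in lborel. x \<noteq> 0"
      using AE_lborel_singleton by blast
    then have "AE x in lborel. ((\<lambda>t. h b (x + t *\<^sub>R b)) has_real_derivative D b x) (at 0)"
      by eventually_elim (rule der)
    from integral_directional_derivative_eq_0[OF hlip hsupp Dborel this] show ?thesis by simp
  qed
  then have "integrable lborel (\<lambda>x. \<Sum>b\<in>Basis. D b x)" "(\<integral>x. (\<Sum>b\<in>Basis. D b x) \<partial>lborel) = 0"
    by (auto simp: integral_sum)
  moreover have "(\<Sum>b\<in>Basis. D b x) = E x" for x
  proof (cases "x \<in> ball 0 1 - {0}")
    case True
    have alg2: "y + v * \<tau> * N / n + v * (m / n - \<tau> / n\<^sup>2) * n\<^sup>2 / n = y + v * (m + (N - 1) * \<tau> / n)"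
      if "n \<noteq> 0" for y v \<tau> N n m :: real
    proof -
      have "(m / n - \<tau> / n\<^sup>2) * n\<^sup>2 / n = m - \<tau> / n"
        using that by (simp add: power2_eq_square left_diff_distrib diff_divide_distrib)
      moreover have "v * (m / n - \<tau> / n\<^sup>2) * n\<^sup>2 / n = v * ((m / n - \<tau> / n\<^sup>2) * n\<^sup>2 / n)" by simp
      ultimately show ?thesis by (simp add: distrib_left left_diff_distrib right_diff_distrib diff_divide_distrib mult_ac)
    qed
    \<comment> \<open>In the sum over the basis, \<open>b \<bullet> b\<close> contributes the
      dimension and \<open>(x \<bullet> b)^2\<close> contributes \<open>(norm x)^2\<close>; together
      they give the divergence \<open>T' + (N - 1) * T / r\<close>.\<close>
    have s1: "(\<Sum>b\<in>Basis. (grad \<phi> x \<bullet> b) * (radial_field T x \<bullet> b)) = grad \<phi> x \<bullet> radial_field T x"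
      by (rule euclidean_inner[symmetric])
    have s2: "(\<Sum>b\<in>Basis. (x \<bullet> b)^2) = (norm x)^2"
      unfolding power2_norm_eq_inner by (simp only: euclidean_inner[of x x] power2_eq_square)
    have s3: "(\<Sum>b\<in>(Basis::'a set). b \<bullet> b) = real DIM('a)"
      by (simp add: inner_Basis)
    define \<zeta> where "\<zeta> = T (norm x) / norm x"
    define c where "c = (T' (norm x) / norm x - T (norm x) / (norm x)^2) / norm x"
    have "D b x = \<theta>' (\<phi> x) * ((grad \<phi> x \<bullet> b) * (radial_field T x \<bullet> b)) +
        (\<theta> (\<phi> x) * \<zeta>) * (b \<bullet> b) + (\<theta> (\<phi> x) * c) * (x \<bullet> b)^2" for b
      using True by (simp add: D_def \<zeta>_def c_def distrib_left mult.assoc)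
    then have "(\<Sum>b\<in>Basis. D b x) = \<theta>' (\<phi> x) * (\<Sum>b\<in>Basis. (grad \<phi> x \<bullet> b) * (radial_field T x \<bullet> b))
        + (\<theta> (\<phi> x) * \<zeta>) * (\<Sum>b\<in>(Basis::'a set). b \<bullet> b) + (\<theta> (\<phi> x) * c) * (\<Sum>b\<in>Basis. (x \<bullet> b)^2)"
      by (simp only: sum.distrib sum_distrib_left)
    also have "\<dots> = E x" unfolding s1 s2 s3 E_def using True
      by (simp add: radial_div_def \<zeta>_def c_def alg2)
    finally show ?thesis .
  next
    case False
    then show ?thesis by (auto simp: D_def E_def radial_div_def radial_field_def)
  qed
  ultimately show "integrable lborel E" "integral\<^sup>L lborel E = 0" by simp_all
qed

end

section \<open>Passage from test functions to Sobolev functions\<close>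

lemma le_add_powr:
  fixes s \<eta> p :: real
  assumes "p \<ge> 1" "\<eta> > 0" "s \<ge> 0"
  shows "s \<le> \<eta> + \<eta> powr (1 - p) * s powr p"
proof (cases "s \<le> \<eta>")
  case True
  have "0 \<le> \<eta> powr (1 - p) * s powr p" by simp
  then show ?thesis using True by linarith
next
  case False
  then have s: "s > \<eta>" "s > 0" using assms by auto
  have "s = s powr (1 - p) * s powr p" using s by (simp flip: powr_add)
  also have "\<dots> \<le> \<eta> powr (1 - p) * s powr p"
    using s assms by (intro mult_right_mono powr_mono2') auto
  finally show ?thesis using assms by linarith
qed

text \<open>By \<open>le_add_powr\<close> the L1 integral is at most \<open>\<eta>\<close> times the
  measure of \<open>S\<close> plus a constant multiple of the p-th power integral. The second term
  vanishes as \<open>k\<close> grows, and \<open>\<eta>\<close> is arbitrary.\<close>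

lemma lp_int_tendsto_imp_L1:
  fixes f :: "nat \<Rightarrow> 'a::euclidean_space \<Rightarrow> 'b::euclidean_space"
  assumes [measurable]: "\<And>k. f k \<in> borel_measurable lebesgue" "S \<in> sets lebesgue"
    and fin: "emeasure lebesgue S < \<infinity>" and p: "p \<ge> 1"
    and lim: "(\<lambda>k. lp_int p S (f k)) \<longlonglongrightarrow> 0"
  shows "(\<lambda>k. \<integral>\<^sup>+x\<in>S. ennreal (norm (f k x)) \<partial>lebesgue) \<longlonglongrightarrow> 0"
proof -
  let ?I = "\<lambda>k. \<integral>\<^sup>+x\<in>S. ennreal (norm (f k x)) \<partial>lebesgue"
  have bd: "?I k \<le> ennreal \<eta> * emeasure lebesgue S + ennreal (\<eta> powr (1 - p)) * lp_int p S (f k)" if "\<eta> > 0" for \<eta> k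
  proof -
    have "?I k \<le> (\<integral>\<^sup>+x. ennreal \<eta> * indicator S x + ennreal (\<eta> powr (1 - p)) * (ennreal (norm (f k x) powr p) * indicator S x) \<partial>lebesgue)"
      using le_add_powr[OF p that] that
      by (intro nn_integral_mono) (auto simp: indicator_def ennreal_mult[symmetric] ennreal_plus[symmetric] simp del: ennreal_plus intro!: ennreal_leI)
    also have "\<dots> = ennreal \<eta> * emeasure lebesgue S + ennreal (\<eta> powr (1 - p)) * lp_int p S (f k)"
      unfolding lp_int_def by (subst nn_integral_add) (auto simp: nn_integral_cmult)
    finally show ?thesis .
  qed
  have "limsup ?I \<le> ennreal \<eta> * emeasure lebesgue S" if \<eta>: "\<eta> > 0" for \<eta>
  proof -
    have "(\<lambda>k. ennreal \<eta> * emeasure lebesgue S + ennreal (\<eta> powr (1 - p)) * lp_int p S (f k)) \<longlonglongrightarrow> 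
        ennreal \<eta> * emeasure lebesgue S + ennreal (\<eta> powr (1 - p)) * 0"
      by (intro tendsto_intros ennreal_tendsto_cmult lim) auto
    from lim_imp_Limsup[OF _ this] have "limsup (\<lambda>k. ennreal \<eta> * emeasure lebesgue S + ennreal (\<eta> powr (1 - p)) * lp_int p S (f k)) = ennreal \<eta> * emeasure lebesgue S"
      by simp
    moreover have "limsup ?I \<le> limsup (\<lambda>k. ennreal \<eta> * emeasure lebesgue S + ennreal (\<eta> powr (1 - p)) * lp_int p S (f k))"
      using bd[OF \<eta>] by (intro Limsup_mono) auto
    ultimately show ?thesis by simp
  qed
  then have *: "limsup ?I \<le> emeasure lebesgue S * ennreal (inverse (real (Suc n)))" for n
    using mult.commute[of "emeasure lebesgue S"] by simp
  have "(\<lambda>n. emeasure lebesgue S * ennreal (inverse (real (Suc n)))) \<longlonglongrightarrow> emeasure lebesgue S * ennreal 0"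
    using fin by (intro ennreal_tendsto_cmult tendsto_ennrealI LIMSEQ_inverse_real_of_nat) (simp add: less_top)
  from LIMSEQ_le_const[OF this] have "limsup ?I \<le> emeasure lebesgue S * ennreal 0"
    using * by blast
  then have "limsup ?I \<le> 0" by simp
  then show ?thesis by (intro tendsto_0_if_Limsup_eq_0_ennreal) simp
qed

lemma test_fn_borel:
  fixes \<phi> :: "'a::euclidean_space \<Rightarrow> real"
  assumes "test_fn S \<phi>"
  shows "\<phi> \<in> borel_measurable borel" "grad \<phi> \<in> borel_measurable borel"
proof -
  show "\<phi> \<in> borel_measurable borel"
    using has_derivative_continuous[OF test_fnD(1)[OF assms]]
    by (intro borel_measurable_continuous_onI continuous_at_imp_continuous_on ballI)
  show "grad \<phi> \<in> borel_measurable borel"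
    using test_fnD(2)[OF assms] by (rule borel_measurable_continuous_onI)
qed

lemma borel_measurable_lebesgueI: "f \<in> borel_measurable borel \<Longrightarrow> f \<in> borel_measurable lebesgue"
  by (intro measurable_completion) simp

lemma emeasure_lebesgue_ball_finite: "emeasure lebesgue (ball (x::'a::euclidean_space) r) < \<infinity>"
  using lmeasurable_ball[of x r] by (simp add: fmeasurable_def)

lemma W0_approx:
  fixes u :: "'a::euclidean_space \<Rightarrow> real"
  assumes W: "W0 p (ball 0 1) u g" and p: "p \<ge> 1"
  obtains \<phi> where "\<And>k. test_fn (ball 0 1) (\<phi> k)"
    "AE x in lebesgue. x \<in> ball 0 1 \<longrightarrow> (\<lambda>k. \<phi> k x) \<longlonglongrightarrow> u x"
    "(\<lambda>k. \<integral>\<^sup>+x\<in>ball 0 1. ennreal (norm (\<phi> k x - u x)) \<partial>lebesgue) \<longlonglongrightarrow> 0"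
    "(\<lambda>k. \<integral>\<^sup>+x\<in>ball 0 1. ennreal (norm (grad (\<phi> k) x - g x)) \<partial>lebesgue) \<longlonglongrightarrow> 0"
proof -
  from W obtain \<phi> where \<phi>: "\<And>k. test_fn (ball 0 1) (\<phi> k)"
    "(\<lambda>k. lp_int p (ball 0 1) (\<lambda>x. \<phi> k x - u x)) \<longlonglongrightarrow> 0"
    "(\<lambda>k. lp_int p (ball 0 1) (\<lambda>x. grad (\<phi> k) x - g x)) \<longlonglongrightarrow> 0"
    and [measurable]: "u \<in> borel_measurable lebesgue" "g \<in> borel_measurable lebesgue"
    unfolding W0_def by blast
  have [measurable]: "\<phi> k \<in> borel_measurable lebesgue" "grad (\<phi> k) \<in> borel_measurable lebesgue" for k
    using test_fn_borel[OF \<phi>(1)] borel_measurable_lebesgueI by blast+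
  have [measurable]: "ball (0::'a) 1 \<in> sets lebesgue" by simp
  have 1: "(\<lambda>k. \<integral>\<^sup>+x\<in>ball 0 1. ennreal (norm (\<phi> k x - u x)) \<partial>lebesgue) \<longlonglongrightarrow> 0"
    by (rule lp_int_tendsto_imp_L1[OF _ _ emeasure_lebesgue_ball_finite p \<phi>(2)]) measurable
  have 2: "(\<lambda>k. \<integral>\<^sup>+x\<in>ball 0 1. ennreal (norm (grad (\<phi> k) x - g x)) \<partial>lebesgue) \<longlonglongrightarrow> 0"
    by (rule lp_int_tendsto_imp_L1[OF _ _ emeasure_lebesgue_ball_finite p \<phi>(3)]) measurable
  have "\<forall>\<^sub>F k in sequentially. (\<integral>\<^sup>+x\<in>ball 0 1. ennreal (norm (\<phi> k x - u x)) \<partial>lebesgue) < 1"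
    using order_tendstoD(2)[OF 1, of 1] by simp
  \<comment> \<open>Dropping the first \<open>K\<close> indices makes all differences integrable, as
    the extraction of an a.e. convergent subsequence requires.\<close>
  then obtain K where K: "\<And>k. k \<ge> K \<Longrightarrow> (\<integral>\<^sup>+x\<in>ball 0 1. ennreal (norm (\<phi> k x - u x)) \<partial>lebesgue) < 1"
    unfolding eventually_sequentially by blast
  define F where "F k x = indicator (ball 0 1) x * (\<phi> (k + K) x - u x)" for k and x :: 'a
  have Fm [measurable]: "F k \<in> borel_measurable lebesgue" for k unfolding F_def by measurable
  have nnF: "(\<integral>\<^sup>+x. ennreal (norm (F k x)) \<partial>lebesgue) = (\<integral>\<^sup>+x\<in>ball 0 1. ennreal (norm (\<phi> (k + K) x - u x)) \<partial>lebesgue)" for k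
    by (rule nn_integral_cong) (auto simp: F_def indicator_def)
  have Fi: "integrable lebesgue (F k)" for k
  proof (rule integrableI_bounded)
    show "(\<integral>\<^sup>+x. ennreal (norm (F k x)) \<partial>lebesgue) < \<infinity>"
      using less_trans[OF K[of "k + K"], of "\<infinity>"] unfolding nnF by simp
  qed measurable
  have "(\<lambda>k. \<integral>\<^sup>+x. ennreal (norm (F k x)) \<partial>lebesgue) \<longlonglongrightarrow> 0"
    unfolding nnF using LIMSEQ_ignore_initial_segment[OF 1, of K] by simp
  moreover have "(\<integral>\<^sup>+x. ennreal (norm (F k x)) \<partial>lebesgue) = ennreal (\<integral>x. norm (F k x) \<partial>lebesgue)" for k
    using Fi by (intro nn_integral_eq_integral) auto
  ultimately have "(\<lambda>k. ennreal (\<integral>x. norm (F k x) \<partial>lebesgue)) \<longlonglongrightarrow> ennreal 0" by simp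
  then have "(\<lambda>k. \<integral>x. norm (F k x) \<partial>lebesgue) \<longlonglongrightarrow> 0"
    by (subst (asm) tendsto_ennreal_iff) auto
  from tendsto_L1_AE_subseq[OF Fi this] obtain r where r: "strict_mono r" "AE x in lebesgue. (\<lambda>n. F (r n) x) \<longlonglongrightarrow> 0"
    by blast
  define s where "s n = r n + K" for n
  have s: "strict_mono s" using r(1) by (simp add: s_def strict_mono_def)
  show ?thesis
  proof (rule that[of "\<lambda>n. \<phi> (s n)"])
    show "AE x in lebesgue. x \<in> ball 0 1 \<longrightarrow> (\<lambda>k. \<phi> (s k) x) \<longlonglongrightarrow> u x"
      using r(2)
    proof eventually_elim
      case (elim x)
      show ?case
      proof
        assume "x \<in> ball 0 1"
        then have "(\<lambda>n. \<phi> (s n) x - u x) \<longlonglongrightarrow> 0" using elim by (simp add: F_def s_def)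
        then show "(\<lambda>k. \<phi> (s k) x) \<longlonglongrightarrow> u x" by (simp add: LIM_zero_iff)
      qed
    qed
    show "test_fn (ball 0 1) (\<phi> (s k))" for k by (rule \<phi>(1))
    show "(\<lambda>k. \<integral>\<^sup>+x\<in>ball 0 1. ennreal (norm (\<phi> (s k) x - u x)) \<partial>lebesgue) \<longlonglongrightarrow> 0"
      using LIMSEQ_subseq_LIMSEQ[OF 1 s] by (simp only: o_def)
    show "(\<lambda>k. \<integral>\<^sup>+x\<in>ball 0 1. ennreal (norm (grad (\<phi> (s k)) x - g x)) \<partial>lebesgue) \<longlonglongrightarrow> 0"
      using LIMSEQ_subseq_LIMSEQ[OF 2 s] by (simp only: o_def)
  qed
qed

lemma lp_int_finite_imp_integrable:
  fixes f :: "'a::euclidean_space \<Rightarrow> 'b::euclidean_space"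
  assumes [measurable]: "f \<in> borel_measurable lebesgue" "S \<in> sets lebesgue"
    and fin: "emeasure lebesgue S < \<infinity>" and p: "p \<ge> 1"
    and lp: "lp_int p S f < \<infinity>"
  shows "integrable lebesgue (\<lambda>x. indicator S x *\<^sub>R f x)"
proof (rule integrableI_bounded)
  have "(\<integral>\<^sup>+x. ennreal (norm (indicator S x *\<^sub>R f x)) \<partial>lebesgue) \<le> (\<integral>\<^sup>+x. indicator S x + ennreal (norm (f x) powr p) * indicator S x \<partial>lebesgue)"
  proof (rule nn_integral_mono)
    fix x
    have "norm (f x) \<le> 1 + norm (f x) powr p" using le_add_powr[OF p, of 1 "norm (f x)"] by simp
    then have "ennreal (norm (f x)) \<le> ennreal (1 + norm (f x) powr p)" by (rule ennreal_leI)
    then show "ennreal (norm (indicator S x *\<^sub>R f x)) \<le> indicator S x + ennreal (norm (f x) powr p) * indicator S x"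
      by (auto simp: indicator_def)
  qed
  also have "\<dots> = emeasure lebesgue S + lp_int p S f"
    unfolding lp_int_def by (subst nn_integral_add) auto
  also have "\<dots> < \<infinity>" using fin lp by (simp add: ennreal_add_less_top)
  finally show "(\<integral>\<^sup>+x. ennreal (norm (indicator S x *\<^sub>R f x)) \<partial>lebesgue) < \<infinity>" .
qed measurable

text \<open>The integrands for the approximating test functions converge in L1. Their difference to
  the limit splits into three terms: \<open>\<theta>\<close> is Lipschitz, which handles
  \<open>\<phi> k - u\<close>; \<open>\<theta>'\<close> is bounded, which handles the difference of
  the gradients; and the change of \<open>\<theta>'\<close> in front of the fixed function
  \<open>g\<close> is handled by dominated convergence.\<close>

lemma (in radial_profile) W0_divergence:
  fixes u :: "'a::euclidean_space \<Rightarrow> real" and \<theta> \<theta>' :: "real \<Rightarrow> real"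
  assumes W: "W0 p (ball 0 1) u g" and p: "p \<ge> 1"
    and \<theta>0: "\<theta> 0 = 0" and \<theta>: "\<And>t. (\<theta> has_real_derivative \<theta>' t) (at t)"
    and \<theta>'c: "continuous_on UNIV \<theta>'" and \<theta>'b: "\<And>t. \<bar>\<theta>' t\<bar> \<le> C"
  shows "integrable lebesgue (\<lambda>x. \<theta> (u x) * radial_div T T' x)"
    and "integrable lebesgue (\<lambda>x. indicator (ball 0 1) x * (\<theta>' (u x) * (g x \<bullet> radial_field T x)))"
    and "(\<integral>x. \<theta> (u x) * radial_div T T' x \<partial>lebesgue) =
      - (\<integral>x. indicator (ball 0 1) x * (\<theta>' (u x) * (g x \<bullet> radial_field T x)) \<partial>lebesgue)"
proof -
  obtain \<phi> where \<phi>: "\<And>k. test_fn (ball 0 1) (\<phi> k)"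
    "AE x in lebesgue. x \<in> ball 0 1 \<longrightarrow> (\<lambda>k. \<phi> k x) \<longlonglongrightarrow> u x"
    "(\<lambda>k. \<integral>\<^sup>+x\<in>ball 0 1. ennreal (norm (\<phi> k x - u x)) \<partial>lebesgue) \<longlonglongrightarrow> 0"
    "(\<lambda>k. \<integral>\<^sup>+x\<in>ball 0 1. ennreal (norm (grad (\<phi> k) x - g x)) \<partial>lebesgue) \<longlonglongrightarrow> 0"
    using W0_approx[OF W p] by blast
  have um [measurable]: "u \<in> borel_measurable lebesgue" and gm [measurable]: "g \<in> borel_measurable lebesgue"
    and lpu: "lp_int p (ball 0 1) u < \<infinity>" and lpg: "lp_int p (ball 0 1) g < \<infinity>"
    using W unfolding W0_def by auto
  have \<phi>m [measurable]: "\<phi> k \<in> borel_measurable lebesgue" "grad (\<phi> k) \<in> borel_measurable lebesgue" for k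
    using test_fn_borel[OF \<phi>(1)] borel_measurable_lebesgueI by blast+
  have [measurable]: "ball (0::'a) 1 \<in> sets lebesgue" by simp
  have [measurable]: "\<theta> \<in> borel_measurable borel" "\<theta>' \<in> borel_measurable borel"
    using \<theta>'c \<theta> by (auto intro!: borel_measurable_continuous_onI) (meson DERIV_continuous continuous_at_imp_continuous_on)
  define d where "d = (radial_div T T' :: 'a \<Rightarrow> real)"
  define \<Psi> where "\<Psi> x = indicator (ball 0 1) x *\<^sub>R radial_field T x" for x :: 'a
  have dm [measurable]: "d \<in> borel_measurable lebesgue" and \<Psi>m [measurable]: "\<Psi> \<in> borel_measurable lebesgue"
    unfolding d_def \<Psi>_def using radial_div_borel radial_field_borel borel_measurable_lebesgueI by blast+
  have C0: "C \<ge> 0" using \<theta>'b[of 0] by linarith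
  define NL where "NL = real DIM('a) * L"
  have NL0: "NL \<ge> 0" using L_nonneg by (simp add: NL_def)
  have db: "\<bar>d x\<bar> \<le> NL * indicator (ball 0 1) x" for x
    using radial_div_bound[of x] by (auto simp: d_def NL_def indicator_def radial_div_def)
  have \<Psi>b: "norm (\<Psi> x) \<le> L * indicator (ball 0 1) x" for x
    using norm_radial_field_le[of x] L_nonneg by (auto simp: \<Psi>_def indicator_def)
  have lip: "\<bar>\<theta> s - \<theta> t\<bar> \<le> C * \<bar>s - t\<bar>" for s t
    using field_differentiable_bound[of UNIV \<theta> \<theta>' C s t] \<theta> \<theta>'b by simp
  have ui: "integrable lebesgue (\<lambda>x. indicator (ball 0 1) x *\<^sub>R u x)"
    by (rule lp_int_finite_imp_integrable[OF _ _ emeasure_lebesgue_ball_finite p lpu]) auto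
  have gi: "integrable lebesgue (\<lambda>x. indicator (ball 0 1) x *\<^sub>R g x)"
    by (rule lp_int_finite_imp_integrable[OF _ _ emeasure_lebesgue_ball_finite p lpg]) auto
  have A: "integrable lebesgue (\<lambda>x. \<theta> (u x) * d x)"
  proof (rule Bochner_Integration.integrable_bound)
    show "integrable lebesgue (\<lambda>x. (C * NL) * norm (indicator (ball 0 1) x *\<^sub>R u x))"
      using ui by (intro integrable_mult_right integrable_norm)
    show "AE x in lebesgue. norm (\<theta> (u x) * d x) \<le> norm ((C * NL) * norm (indicator (ball 0 1) x *\<^sub>R u x))"
    proof (rule AE_I2)
      fix x :: 'a
      have "\<bar>\<theta> (u x)\<bar> * \<bar>d x\<bar> \<le> (C * \<bar>u x\<bar>) * (NL * indicator (ball 0 1) x)"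
        using lip[of "u x" 0] \<theta>0 C0 by (intro mult_mono db) auto
      then show "norm (\<theta> (u x) * d x) \<le> norm ((C * NL) * norm (indicator (ball 0 1) x *\<^sub>R u x))"
        using C0 NL0 by (simp add: abs_mult mult_ac)
    qed
  qed measurable
  have B: "integrable lebesgue (\<lambda>x. \<theta>' (u x) * (g x \<bullet> \<Psi> x))"
  proof (rule Bochner_Integration.integrable_bound)
    show "integrable lebesgue (\<lambda>x. (C * L) * norm (indicator (ball 0 1) x *\<^sub>R g x))"
      using gi by (intro integrable_mult_right integrable_norm)
    show "AE x in lebesgue. norm (\<theta>' (u x) * (g x \<bullet> \<Psi> x)) \<le> norm ((C * L) * norm (indicator (ball 0 1) x *\<^sub>R g x))"
    proof (rule AE_I2)
      fix x :: 'a
      have "\<bar>g x \<bullet> \<Psi> x\<bar> \<le> norm (g x) * (L * indicator (ball 0 1) x)"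
        by (rule order_trans[OF Cauchy_Schwarz_ineq2]) (intro mult_left_mono \<Psi>b, simp)
      then have "\<bar>\<theta>' (u x)\<bar> * \<bar>g x \<bullet> \<Psi> x\<bar> \<le> C * (norm (g x) * (L * indicator (ball 0 1) x))"
        using C0 by (intro mult_mono \<theta>'b) auto
      then show "norm (\<theta>' (u x) * (g x \<bullet> \<Psi> x)) \<le> norm ((C * L) * norm (indicator (ball 0 1) x *\<^sub>R g x))"
        using C0 L_nonneg by (simp add: abs_mult mult_ac)
    qed
  qed measurable
  define E where "E k x = \<theta>' (\<phi> k x) * (grad (\<phi> k) x \<bullet> \<Psi> x) + \<theta> (\<phi> k x) * d x" for k x
  define E0 where "E0 x = \<theta>' (u x) * (g x \<bullet> \<Psi> x) + \<theta> (u x) * d x" for x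
  have Ek: "integrable lebesgue (E k) \<and> integral\<^sup>L lebesgue (E k) = 0" for k
  proof -
    have *: "E k = (\<lambda>x. indicator (ball 0 1) x * (\<theta>' (\<phi> k x) * (grad (\<phi> k) x \<bullet> radial_field T x)) + \<theta> (\<phi> k x) * radial_div T T' x)"
      by (auto simp: E_def d_def \<Psi>_def indicator_def fun_eq_iff)
    note td = test_fn_divergence[OF \<phi>(1) \<theta>0 \<theta> \<theta>'c \<theta>'b, of k, folded *]
    have "E k \<in> borel_measurable lborel" using td(1) by (rule borel_measurable_integrable)
    then show ?thesis using td by (simp add: integrable_completion integral_completion)
  qed
  have E0i: "integrable lebesgue E0" unfolding E0_def by (rule Bochner_Integration.integrable_add[OF B A])
  have Em [measurable]: "E k \<in> borel_measurable lebesgue" "E0 \<in> borel_measurable lebesgue" for k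
    using Ek E0i by auto
  let ?I1 = "\<lambda>k. \<integral>\<^sup>+x\<in>ball 0 1. ennreal (norm (\<phi> k x - u x)) \<partial>lebesgue"
  let ?I2 = "\<lambda>k. \<integral>\<^sup>+x\<in>ball 0 1. ennreal (norm (grad (\<phi> k) x - g x)) \<partial>lebesgue"
  let ?I3 = "\<lambda>k. \<integral>\<^sup>+x. ennreal (\<bar>\<theta>' (\<phi> k x) - \<theta>' (u x)\<bar> * (L * norm (indicator (ball 0 1) x *\<^sub>R g x))) \<partial>lebesgue"
  \<comment> \<open>As \<open>\<theta>'\<close> is merely continuous, this term is not controlled by
    the size of \<open>\<phi> k - u\<close>. The a.e. convergence is used instead, with majorant
    \<open>2 * C * L * norm (g x)\<close>.\<close>
  have I3: "?I3 \<longlonglongrightarrow> (\<integral>\<^sup>+(x::'a). 0 \<partial>lebesgue)"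
  proof (rule nn_integral_dominated_convergence[where w="\<lambda>x. ennreal ((2 * C * L) * norm (indicator (ball 0 1) x *\<^sub>R g x))"])
    show "AE x in lebesgue. ennreal (\<bar>\<theta>' (\<phi> k x) - \<theta>' (u x)\<bar> * (L * norm (indicator (ball 0 1) x *\<^sub>R g x))) \<le> ennreal ((2 * C * L) * norm (indicator (ball 0 1) x *\<^sub>R g x))" for k
    proof (intro AE_I2 ennreal_leI)
      fix x :: 'a
      have "\<bar>\<theta>' (\<phi> k x) - \<theta>' (u x)\<bar> \<le> 2 * C" using \<theta>'b[of "\<phi> k x"] \<theta>'b[of "u x"] by linarith
      then have "\<bar>\<theta>' (\<phi> k x) - \<theta>' (u x)\<bar> * (L * norm (indicator (ball 0 1) x *\<^sub>R g x)) \<le> 2 * C * (L * norm (indicator (ball 0 1) x *\<^sub>R g x))"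
        by (rule mult_right_mono) (use L_nonneg in auto)
      then show "\<bar>\<theta>' (\<phi> k x) - \<theta>' (u x)\<bar> * (L * norm (indicator (ball 0 1) x *\<^sub>R g x)) \<le> 2 * C * L * norm (indicator (ball 0 1) x *\<^sub>R g x)"
        by (simp add: mult_ac)
    qed
    have "integrable lebesgue (\<lambda>x. (2 * C * L) * norm (indicator (ball 0 1) x *\<^sub>R g x))"
      using gi by (intro integrable_mult_right integrable_norm)
    then show "(\<integral>\<^sup>+x. ennreal ((2 * C * L) * norm (indicator (ball 0 1) x *\<^sub>R g x)) \<partial>lebesgue) < \<infinity>"
      using C0 L_nonneg by (subst nn_integral_eq_integral) (auto simp: less_top[symmetric])
    show "AE x in lebesgue. (\<lambda>k. ennreal (\<bar>\<theta>' (\<phi> k x) - \<theta>' (u x)\<bar> * (L * norm (indicator (ball 0 1) x *\<^sub>R g x)))) \<longlonglongrightarrow> 0"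
      using \<phi>(2)
    proof eventually_elim
      case (elim x)
      show ?case
      proof (cases "x \<in> ball 0 1")
        case True
        then have "(\<lambda>k. \<theta>' (\<phi> k x)) \<longlonglongrightarrow> \<theta>' (u x)"
          using elim by (intro continuous_on_tendsto_compose[OF \<theta>'c]) auto
        then have "(\<lambda>k. \<bar>\<theta>' (\<phi> k x) - \<theta>' (u x)\<bar> * (L * norm (indicator (ball 0 1) x *\<^sub>R g x))) \<longlonglongrightarrow> \<bar>\<theta>' (u x) - \<theta>' (u x)\<bar> * (L * norm (indicator (ball 0 1) x *\<^sub>R g x))"
          by (intro tendsto_intros)
        from tendsto_ennrealI[OF this] show ?thesis by simp
      qed auto
    qed
  qed measurable
  have alg: "(\<integral>\<^sup>+x. a * f1 x + b * f2 x + f3 x \<partial>lebesgue) =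
      a * (\<integral>\<^sup>+x. f1 x \<partial>lebesgue) + b * (\<integral>\<^sup>+x. f2 x \<partial>lebesgue) + (\<integral>\<^sup>+x. f3 x \<partial>lebesgue)"
    if [measurable]: "f1 \<in> borel_measurable lebesgue" "f2 \<in> borel_measurable lebesgue" "f3 \<in> borel_measurable lebesgue"
    for a b and f1 f2 f3 :: "'a \<Rightarrow> ennreal"
    by (simp add: nn_integral_add nn_integral_cmult)
  have m1: "(\<lambda>x. ennreal (norm (\<phi> k x - u x)) * indicator (ball 0 1) x) \<in> borel_measurable lebesgue"
    and m2: "(\<lambda>x. ennreal (norm (grad (\<phi> k) x - g x)) * indicator (ball 0 1) x) \<in> borel_measurable lebesgue"
    and m3: "(\<lambda>x. ennreal (\<bar>\<theta>' (\<phi> k x) - \<theta>' (u x)\<bar> * (L * norm (indicator (ball 0 1) x *\<^sub>R g x)))) \<in> borel_measurable lebesgue" for k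
    by measurable
  have bound: "(\<integral>\<^sup>+x. ennreal (norm (E k x - E0 x)) \<partial>lebesgue) \<le> ennreal (C * NL) * ?I1 k + ennreal (C * L) * ?I2 k + ?I3 k" for k
  proof -
    have "(\<integral>\<^sup>+x. ennreal (norm (E k x - E0 x)) \<partial>lebesgue) \<le>
      (\<integral>\<^sup>+x. ennreal (C * NL) * (ennreal (norm (\<phi> k x - u x)) * indicator (ball 0 1) x) +
             ennreal (C * L) * (ennreal (norm (grad (\<phi> k) x - g x)) * indicator (ball 0 1) x) +
             ennreal (\<bar>\<theta>' (\<phi> k x) - \<theta>' (u x)\<bar> * (L * norm (indicator (ball 0 1) x *\<^sub>R g x))) \<partial>lebesgue)"
    proof (rule nn_integral_mono)
      fix x :: 'a
      show "ennreal (norm (E k x - E0 x)) \<le> ennreal (C * NL) * (ennreal (norm (\<phi> k x - u x)) * indicator (ball 0 1) x) +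
             ennreal (C * L) * (ennreal (norm (grad (\<phi> k) x - g x)) * indicator (ball 0 1) x) +
             ennreal (\<bar>\<theta>' (\<phi> k x) - \<theta>' (u x)\<bar> * (L * norm (indicator (ball 0 1) x *\<^sub>R g x)))"
      proof (cases "x \<in> ball 0 1")
        case False
        then have "E k x = 0" "E0 x = 0" by (auto simp: E_def E0_def d_def \<Psi>_def radial_div_def)
        then show ?thesis by simp
      next
        case True
        have "E k x - E0 x = \<theta>' (\<phi> k x) * ((grad (\<phi> k) x - g x) \<bullet> \<Psi> x) + (\<theta>' (\<phi> k x) - \<theta>' (u x)) * (g x \<bullet> \<Psi> x) + (\<theta> (\<phi> k x) - \<theta> (u x)) * d x"
          by (simp add: E_def E0_def inner_diff_left algebra_simps)
        then have "norm (E k x - E0 x) \<le> \<bar>\<theta>' (\<phi> k x)\<bar> * \<bar>(grad (\<phi> k) x - g x) \<bullet> \<Psi> x\<bar> + \<bar>\<theta>' (\<phi> k x) - \<theta>' (u x)\<bar> * \<bar>g x \<bullet> \<Psi> x\<bar> + \<bar>\<theta> (\<phi> k x) - \<theta> (u x)\<bar> * \<bar>d x\<bar>"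
          by (simp only: abs_mult[symmetric] real_norm_def)
        also have "\<dots> \<le> C * (norm (grad (\<phi> k) x - g x) * L) + \<bar>\<theta>' (\<phi> k x) - \<theta>' (u x)\<bar> * (norm (g x) * L) + (C * \<bar>\<phi> k x - u x\<bar>) * NL"
        proof (intro add_mono mult_mono \<theta>'b lip order.refl)
          have \<Psi>L: "norm (\<Psi> x) \<le> L" using \<Psi>b[of x] True by simp
          show "\<bar>(grad (\<phi> k) x - g x) \<bullet> \<Psi> x\<bar> \<le> norm (grad (\<phi> k) x - g x) * L" "\<bar>g x \<bullet> \<Psi> x\<bar> \<le> norm (g x) * L"
            by (auto intro!: order_trans[OF Cauchy_Schwarz_ineq2] mult_left_mono \<Psi>L)
          show "\<bar>d x\<bar> \<le> NL" using db[of x] True by simp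
        qed (use C0 L_nonneg in auto)
        also have "\<dots> = (C * NL) * norm (\<phi> k x - u x) + (C * L) * norm (grad (\<phi> k) x - g x) + \<bar>\<theta>' (\<phi> k x) - \<theta>' (u x)\<bar> * (L * norm (g x))"
          by simp
        finally have "ennreal (norm (E k x - E0 x)) \<le> ennreal ((C * NL) * norm (\<phi> k x - u x) + (C * L) * norm (grad (\<phi> k) x - g x) + \<bar>\<theta>' (\<phi> k x) - \<theta>' (u x)\<bar> * (L * norm (g x)))"
          by (rule ennreal_leI)
        also have "\<dots> = ennreal ((C * NL) * norm (\<phi> k x - u x)) + ennreal ((C * L) * norm (grad (\<phi> k) x - g x)) + ennreal (\<bar>\<theta>' (\<phi> k x) - \<theta>' (u x)\<bar> * (L * norm (g x)))"
          using C0 L_nonneg NL0 by (simp add: ennreal_plus)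
        also have "\<dots> = ennreal (C * NL) * ennreal (norm (\<phi> k x - u x)) + ennreal (C * L) * ennreal (norm (grad (\<phi> k) x - g x)) + ennreal (\<bar>\<theta>' (\<phi> k x) - \<theta>' (u x)\<bar> * (L * norm (g x)))"
          using C0 L_nonneg NL0 by (simp add: ennreal_mult)
        finally show ?thesis using True by simp
      qed
    qed
    also have "\<dots> = ennreal (C * NL) * ?I1 k + ennreal (C * L) * ?I2 k + ?I3 k"
      by (rule alg[OF m1 m2 m3])
    finally show ?thesis .
  qed
  have "(\<lambda>k. ennreal (C * NL) * ?I1 k + ennreal (C * L) * ?I2 k + ?I3 k) \<longlonglongrightarrow> ennreal (C * NL) * 0 + ennreal (C * L) * 0 + 0"
    using I3 by (intro tendsto_add ennreal_tendsto_cmult \<phi>) auto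
  then have lim0: "(\<lambda>k. ennreal (C * NL) * ?I1 k + ennreal (C * L) * ?I2 k + ?I3 k) \<longlonglongrightarrow> 0"
    by (simp only: mult_zero_right add_0)
  have lim1: "(\<lambda>k. \<integral>\<^sup>+x. ennreal (norm (E k x - E0 x)) \<partial>lebesgue) \<longlonglongrightarrow> 0"
    by (rule tendsto_sandwich[OF always_eventually always_eventually tendsto_const lim0]) (intro allI zero_le bound)+
  have "(\<lambda>k. integral\<^sup>L lebesgue (E k)) \<longlonglongrightarrow> integral\<^sup>L lebesgue E0"
    by (rule tendsto_L1_int[OF _ E0i lim1]) (use Ek in blast)
  then have "integral\<^sup>L lebesgue E0 = 0" using Ek LIMSEQ_unique[OF _ tendsto_const] by auto
  then have main: "(\<integral>x. \<theta>' (u x) * (g x \<bullet> \<Psi> x) \<partial>lebesgue) + (\<integral>x. \<theta> (u x) * d x \<partial>lebesgue) = 0"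
    unfolding E0_def using A B by simp
  have eq: "(\<lambda>x. \<theta>' (u x) * (g x \<bullet> \<Psi> x)) = (\<lambda>x. indicator (ball 0 1) x * (\<theta>' (u x) * (g x \<bullet> radial_field T x)))"
    by (auto simp: \<Psi>_def indicator_def fun_eq_iff)
  show "integrable lebesgue (\<lambda>x. \<theta> (u x) * radial_div T T' x)"
    using A by (simp add: d_def)
  show "integrable lebesgue (\<lambda>x. indicator (ball 0 1) x * (\<theta>' (u x) * (g x \<bullet> radial_field T x)))"
    using B by (simp add: eq)
  show "(\<integral>x. \<theta> (u x) * radial_div T T' x \<partial>lebesgue) =
      - (\<integral>x. indicator (ball 0 1) x * (\<theta>' (u x) * (g x \<bullet> radial_field T x)) \<partial>lebesgue)"
    using main by (simp add: d_def eq)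
qed

subsection \<open>The bubble measure and its transport\<close>

text \<open>\<open>pp\<close> is the conjugate exponent of \<open>p\<close>, \<open>ps\<close> the critical Sobolev exponent, \<open>q\<close> the outer exponent of \<open>Fp\<close>.
\<open>G\<close> is the mass that the bubble density \<open>(1 + |x| powr pp) powr (- N)\<close> gives to the ball of radius \<open>y\<close>, with radial derivative \<open>k\<close> and total
mass \<open>M\<close>. It is defined after one integration by parts, since then the Beta integrand in \<open>J\<close> is continuous on all of
\<open>[0, 1]\<close>. \<open>H\<close> is the moment of order \<open>pp\<close> of the same density.\<close>

locale bliss =
  fixes N :: nat and p B :: real
  assumes N2: "2 \<le> N" and p1: "1 < p" and pN: "p < real N" and B0: "0 < B"
begin

definition pp where "pp = p / (p - 1)"
definition q where "q = real N * (p - 1) / (real N - p)"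
text \<open>The power of \<open>|u|\<close> that enters the divergence identity. It equals
  \<open>ps * (N - 1) / N\<close>, so this power is the density to the exponent
  \<open>1 - 1 / N\<close>; and the chain rule leaves the exponent \<open>\<beta> - 1 = q\<close>,
  which Young's inequality turns into \<open>q * pp = ps\<close>.\<close>

definition \<beta> where "\<beta> = q + 1"
definition ps where "ps = real N * p / (real N - p)"

lemma pp1: "pp > 1" using p1 by (simp add: pp_def)
lemma q0: "q > 0" using p1 pN by (simp add: q_def)
lemma \<beta>1: "\<beta> > 1" using q0 by (simp add: \<beta>_def)
lemma ps0: "ps > 0" using p1 pN by (simp add: ps_def)
lemma inv_pp: "1 / pp = 1 - 1 / p" using p1 by (simp add: pp_def field_simps)
lemma q_pp: "q * pp = ps" using p1 pN by (simp add: q_def pp_def ps_def)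
lemma ps_beta: "ps * ((real N - 1) / real N) = \<beta>" 
  using p1 pN N2 by (simp add: ps_def \<beta>_def q_def field_simps)
lemma q_identity: "q * ((real N - 1) * pp / real N - 1) = 1"
  using p1 pN N2 by (simp add: q_def pp_def divide_simps) (simp add: algebra_simps)
lemma pp_x: "pp * (real N - real N / p) = real N"
  using p1 by (simp add: pp_def field_simps)
lemma pp_gt: "real N < (real N - 1) * pp"
proof -
  have "(real N - 1) * pp / real N - 1 > 0"
    using q_identity q0 by (metis zero_less_mult_pos zero_less_one)
  then show ?thesis using N2 by (simp add: field_simps)
qed
lemma inv_ps: "(real N - 1) / real N - 1 / pp = 1 / ps"
  unfolding inv_pp using p1 pN N2 by (simp add: ps_def field_simps)

definition k where "k r = B * N * r ^ (N - 1) * (1 + r powr pp) powr (- real N)"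
definition J where "J z = integral {0..z} (\<lambda>t. t powr (real N - real N / p) * (1 - t) powr (real N / p - 1))"
definition G where "G y = B * y ^ N * (1 + y powr pp) powr (- real N) + B * N * J (y powr pp / (1 + y powr pp))"
text \<open>The boundary term of the integration by parts that relates the moment to the mass:
  \<open>y powr pp * k y\<close> is the derivative of \<open>q * (G y - \<rho> y)\<close>.\<close>

definition \<rho> where "\<rho> y = B * y ^ N * (1 + y powr pp) powr (- (real N - 1))"
definition H where "H y = q * G y - q * \<rho> y"
definition M where "M = B * N * Beta (real N - real N / p + 1) (real N / p)"

lemma x_bounds: "real N / p > 1" "real N - real N / p > 0"
  using p1 pN by (auto simp: field_simps)

lemma J_cont_integrand: "continuous_on {0..1} (\<lambda>t::real. t powr (real N - real N / p) * (1 - t) powr (real N / p - 1))"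
  by (intro continuous_intros continuous_on_powr') (use x_bounds in auto)

lemma J_deriv: "(J has_real_derivative t powr (real N - real N / p) * (1 - t) powr (real N / p - 1)) (at t)"
  if "0 < t" "t < 1"
proof -
  have "(J has_real_derivative t powr (real N - real N / p) * (1 - t) powr (real N / p - 1)) (at t within {0..1})"
    unfolding J_def by (rule integral_has_real_derivative[OF J_cont_integrand]) (use that in auto)
  moreover have "at t within {0..1} = at t" using that by (intro at_within_interior) simp
  ultimately show ?thesis by simp
qed

lemma J_cont: "continuous_on {0..1} J"
  unfolding J_def by (intro indefinite_integral_continuous_1 integrable_continuous_real J_cont_integrand)

lemma J_1: "J 1 = Beta (real N - real N / p + 1) (real N / p)"
  unfolding J_def using has_integral_Beta_real[of "real N - real N / p + 1" "real N / p"] x_bounds p1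
  by (auto intro!: integral_unique)

lemma one_plus_powr_pos: "0 < 1 + (y::real) powr a" and one_plus_powr_neq: "1 + (y::real) powr a \<noteq> 0"
proof -
  show "0 < 1 + y powr a" by (simp add: add_pos_nonneg)
  then show "1 + y powr a \<noteq> 0" by linarith
qed

lemma k_pos: "k r > 0" if "r > 0"
proof -
  have "0 < (1 + r powr pp) powr (- real N)" using one_plus_powr_neq by simp
  moreover have "0 < B * N * r ^ (N - 1)" using that B0 N2 by simp
  ultimately show ?thesis unfolding k_def by (rule mult_pos_pos[rotated])
qed

lemma power_eq_powr: "y ^ N = y powr real N" "y ^ (N - 1) = y powr (real N - 1)" if "y > 0"
  using that N2 by (simp_all add: powr_realpow[symmetric] of_nat_diff)

lemma dpowr: "((\<lambda>y. y powr pp) has_real_derivative pp * y powr (pp - 1)) (at y)" if "y > 0"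
  using that by (auto intro!: derivative_eq_intros)

lemma d1powr: "((\<lambda>y. (1 + y powr pp) powr a) has_real_derivative a * (1 + y powr pp) powr (a - 1) * (pp * y powr (pp - 1))) (at y)" if "y > 0"
proof -
  have "((\<lambda>y. 1 + y powr pp) has_real_derivative pp * y powr (pp - 1)) (at y)"
    using DERIV_add[OF DERIV_const dpowr[OF that]] by simp
  from DERIV_chain2[OF has_real_derivative_powr[OF one_plus_powr_pos] this] show ?thesis .
qed

lemma y_powr_mult: "y ^ (N - 1) * y = y ^ N" for y :: real
  using N2 by (metis One_nat_def Suc_pred le_zero_eq not_gr0 numeral_2_eq_2 old.nat.distinct(1) power_Suc2)

lemma G_deriv: "(G has_real_derivative k y) (at y)" if y: "y > 0"
proof -
  define u where "u = y powr pp"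
  define v where "v = pp * y powr (pp - 1)"
  have u0: "u > 0" using y by (simp add: u_def)
  have uv: "v * y = pp * u" using y by (simp add: u_def v_def powr_diff)
  have d1: "((\<lambda>y. B * y ^ N * (1 + y powr pp) powr (- real N)) has_real_derivative
      (B * (N * y ^ (N - 1)) * (1 + u) powr (- real N) + (- real N * (1 + u) powr (- real N - 1) * v) * (B * y ^ N))) (at y)"
    unfolding u_def v_def
    by (intro DERIV_mult d1powr y) (auto intro!: derivative_eq_intros)
  have dz: "((\<lambda>y. y powr pp / (1 + y powr pp)) has_real_derivative (v / (1 + u)^2)) (at y)"
    by (rule DERIV_cong[OF DERIV_divide[OF dpowr[OF y] DERIV_add[OF DERIV_const dpowr[OF y]]]])
       (simp_all add: one_plus_powr_neq u_def v_def power2_eq_square algebra_simps)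
  have z: "0 < u / (1 + u)" "u / (1 + u) < 1" using u0 by auto
  have dJ: "((\<lambda>y. B * N * J (y powr pp / (1 + y powr pp))) has_real_derivative
     B * N * (((u / (1 + u)) powr (real N - real N / p) * (1 - u / (1 + u)) powr (real N / p - 1)) * (v / (1 + u)^2))) (at y)"
    by (intro DERIV_cmult DERIV_chain2[OF _ dz]) (use J_deriv[OF z] in \<open>simp add: u_def\<close>)
  \<comment> \<open>The derivative of the Beta part cancels the term in which the derivative falls
    on \<open>(1 + y powr pp) powr (- N)\<close>, so that only \<open>k y\<close> survives.\<close>
  have e1: "(u / (1 + u)) powr (real N - real N / p) * (1 - u / (1 + u)) powr (real N / p - 1) * (v / (1 + u)^2)
     = y ^ N * (1 + u) powr (- real N - 1) * v"
  proof -
    have "1 - u / (1 + u) = 1 / (1 + u)" using u0 by (simp add: field_simps)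
    then have "(u / (1 + u)) powr (real N - real N / p) * (1 - u / (1 + u)) powr (real N / p - 1) * (v / (1 + u)^2)
      = u powr (real N - real N / p) * ((1 + u) powr (- (real N - real N / p)) * (1 + u) powr (- (real N / p - 1)) * (1 + u) powr (-2)) * v"
      using u0 by (simp add: powr_divide powr_minus divide_simps)
    also have "(1 + u) powr (- (real N - real N / p)) * (1 + u) powr (- (real N / p - 1)) * (1 + u) powr (-2) = (1 + u) powr (- real N - 1)"
      unfolding powr_add[symmetric] by (rule arg_cong[where f="\<lambda>e. (1 + u) powr e"]) simp
    also have "u powr (real N - real N / p) = y ^ N"
      unfolding u_def powr_powr pp_x using y power_eq_powr(1) by simp
    finally show ?thesis .
  qed
  show ?thesis
    unfolding G_def[abs_def] using DERIV_add[OF d1 dJ] unfolding e1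
    by (rule DERIV_cong) (simp add: k_def u_def algebra_simps)
qed

lemma \<rho>_deriv: "(\<rho> has_real_derivative k y - y powr pp * k y * ((real N - 1) * pp / real N - 1)) (at y)" if y: "y > 0"
proof -
  define u where "u = y powr pp"
  define v where "v = pp * y powr (pp - 1)"
  define c where "c = (1 + u) powr (- real N)"
  have u0: "u > 0" using y by (simp add: u_def)
  have uv: "y ^ N * v = y ^ (N - 1) * (pp * u)"
    using y by (simp add: u_def v_def powr_diff y_powr_mult[symmetric])
  have d1: "((\<lambda>y. B * y ^ N * (1 + y powr pp) powr (- (real N - 1))) has_real_derivative
      (B * (N * y ^ (N - 1)) * (1 + u) powr (- (real N - 1)) + (- (real N - 1) * (1 + u) powr (- (real N - 1) - 1) * v) * (B * y ^ N))) (at y)"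
    unfolding u_def v_def
    by (intro DERIV_mult d1powr y) (auto intro!: derivative_eq_intros)
  have e1: "(1 + u) powr (- (real N - 1)) = (1 + u) * c"
    using u0 by (simp add: c_def powr_diff powr_minus field_simps)
  have e2: "(1 + u) powr (- (real N - 1) - 1) = c" by (simp add: c_def)
  have "B * (N * y ^ (N - 1)) * ((1 + u) * c) + (- (real N - 1) * c * v) * (B * y ^ N)
     = B * N * y ^ (N - 1) * c * (1 + u) - (real N - 1) * c * B * (y ^ N * v)"
    by (simp add: algebra_simps)
  also have "\<dots> = B * N * y ^ (N - 1) * c - u * (B * N * y ^ (N - 1) * c) * ((real N - 1) * pp / real N - 1)"
    unfolding uv using N2 by (simp add: field_simps)
  finally show ?thesis
    unfolding \<rho>_def[abs_def] using d1 unfolding e1 e2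
    by (simp add: k_def u_def[symmetric] c_def[symmetric] mult.assoc)
qed

text \<open>The factor \<open>q\<close> in \<open>H\<close> is chosen for this: by
  \<open>q_identity\<close> the moment density appears with coefficient 1. As \<open>\<rho>\<close>
  vanishes at infinity, the moment of the whole bubble is \<open>q * M\<close>.\<close>

lemma H_deriv: "(H has_real_derivative y powr pp * k y) (at y)" if y: "y > 0"
proof -
  have "(H has_real_derivative q * k y - q * (k y - y powr pp * k y * ((real N - 1) * pp / real N - 1))) (at y)"
    unfolding H_def[abs_def] by (intro DERIV_diff DERIV_cmult G_deriv \<rho>_deriv y)
  moreover have "q * k y - q * (k y - y powr pp * k y * ((real N - 1) * pp / real N - 1))
     = y powr pp * k y * (q * ((real N - 1) * pp / real N - 1))" by (simp add: algebra_simps)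
  ultimately show ?thesis using q_identity by simp
qed

lemma powr_pp_cont: "continuous_on {0..} (\<lambda>y. y powr pp)"
  by (rule continuous_on_powr'[OF continuous_on_id continuous_on_const]) (use pp1 in auto)

lemma one_plus_powr_cont: "continuous_on {0..} (\<lambda>y. (1 + y powr pp) powr a)"
  by (rule continuous_on_powr[OF continuous_on_add[OF continuous_on_const powr_pp_cont] continuous_on_const])
     (simp add: one_plus_powr_neq)

lemma z_cont: "continuous_on {0..} (\<lambda>y. y powr pp / (1 + y powr pp))"
  by (intro continuous_on_divide continuous_on_add continuous_on_const powr_pp_cont) (simp add: one_plus_powr_neq)

lemma z_bounds: "0 \<le> y powr pp / (1 + y powr pp)" "y powr pp / (1 + y powr pp) \<le> 1"
  using one_plus_powr_pos[of y pp] by (auto simp: divide_le_eq less_imp_le)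

lemma G_cont: "continuous_on {0..} G"
proof -
  have "continuous_on {0..} (\<lambda>y. J (y powr pp / (1 + y powr pp)))"
    by (rule continuous_on_compose2[OF J_cont z_cont]) (use z_bounds in auto)
  then show ?thesis unfolding G_def[abs_def]
    by (intro continuous_on_add continuous_on_mult continuous_on_const continuous_on_power continuous_on_id one_plus_powr_cont)
qed

lemma \<rho>_cont: "continuous_on {0..} \<rho>"
  unfolding \<rho>_def[abs_def] by (intro continuous_on_mult continuous_on_const continuous_on_power continuous_on_id one_plus_powr_cont)

lemma H_cont: "continuous_on {0..} H"
  unfolding H_def[abs_def] by (intro continuous_intros G_cont \<rho>_cont)

lemma G_0: "G 0 = 0" and \<rho>_0: "\<rho> 0 = 0" and H_0: "H 0 = 0"
  using N2 pp1 by (simp_all add: G_def \<rho>_def H_def J_def power_0_left)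

lemma \<rho>_nonneg: "y \<ge> 0 \<Longrightarrow> \<rho> y \<ge> 0" using B0 by (simp add: \<rho>_def)

lemma G_strict_mono: "G a < G b" if "0 \<le> a" "a < b"
proof (rule DERIV_pos_imp_increasing_open[OF that(2)])
  fix x assume "a < x" "x < b"
  then have "x > 0" using that by simp
  then show "\<exists>y. (G has_real_derivative y) (at x) \<and> 0 < y" using G_deriv k_pos by blast
next
  show "continuous_on {a..b} G" by (rule continuous_on_subset[OF G_cont]) (use that in auto)
qed

lemma H_pos: "H b > 0" if "0 < b"
proof -
  have "H 0 < H b"
  proof (rule DERIV_pos_imp_increasing_open[OF that])
    fix x :: real assume x: "0 < x" "x < b"
    have "0 < x powr pp * k x" using x k_pos by simp
    then show "\<exists>y. (H has_real_derivative y) (at x) \<and> 0 < y" using H_deriv[OF x(1)] by blast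
  next
    show "continuous_on {0..b} H" by (rule continuous_on_subset[OF H_cont]) auto
  qed
  then show ?thesis by (simp add: H_0)
qed

text \<open>The bubble density is at most 1, so its mass is at most the volume. This later bounds
  the transport map from below near the origin.\<close>

lemma G_le: "G y \<le> B * y ^ N" if "0 \<le> y"
proof (cases "y = 0")
  case True then show ?thesis using N2 by (simp add: G_0 power_0_left)
next
  case False
  have "B * 0 ^ N - G 0 \<le> B * y ^ N - G y"
  proof (rule DERIV_nonneg_imp_increasing_open[where f="\<lambda>y. B * y ^ N - G y" and a=0 and b=y])
    fix x assume x: "0 < x" "x < y"
    show "\<exists>z. ((\<lambda>y. B * y ^ N - G y) has_real_derivative z) (at x) \<and> 0 \<le> z"
    proof (intro exI conjI)
      show "((\<lambda>y. B * y ^ N - G y) has_real_derivative B * (N * x ^ (N - 1)) - k x) (at x)"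
        by (rule DERIV_diff) (auto intro!: derivative_eq_intros G_deriv x)
      have "(1 + x powr pp) powr (- real N) \<le> 1" using powr_mono[of "- real N" 0 "1 + x powr pp"] by (simp add: one_plus_powr_neq)
      then have "B * N * x ^ (N - 1) * (1 + x powr pp) powr (- real N) \<le> B * N * x ^ (N - 1) * 1"
        using x B0 by (intro mult_left_mono) auto
      then show "0 \<le> B * (N * x ^ (N - 1)) - k x" by (simp add: k_def mult.assoc)
    qed
  qed (use that in \<open>auto intro!: continuous_intros continuous_on_subset[OF G_cont]\<close>)
  then show ?thesis using N2 by (simp add: G_0 power_0_left)
qed

text \<open>The term decays at least like \<open>y\<close> to the power
  \<open>N - (N - 1) * pp\<close>, which is negative by \<open>pp_gt\<close>.\<close>

lemma \<rho>_lim: "(\<rho> \<longlongrightarrow> 0) at_top"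
proof (rule tendsto_sandwich[OF _ _ tendsto_const])
  let ?e = "real N - (real N - 1) * pp"
  have "((\<lambda>y. B * y powr ?e) \<longlongrightarrow> B * 0) at_top"
    using pp_gt by (intro tendsto_intros tendsto_neg_powr filterlim_ident) simp
  then show "((\<lambda>y. B * y powr ?e) \<longlongrightarrow> 0) at_top" by simp
  show "\<forall>\<^sub>F y in at_top. \<rho> y \<le> B * y powr ?e"
    using eventually_gt_at_top[of 0]
  proof eventually_elim
    case (elim y)
    have "(1 + y powr pp) powr (- (real N - 1)) \<le> (y powr pp) powr (- (real N - 1))"
      using elim N2 by (intro powr_mono2') auto
    also have "\<dots> = y powr (- (real N - 1) * pp)" by (simp add: powr_powr mult.commute)
    finally have "y powr N * (1 + y powr pp) powr (- (real N - 1)) \<le> y powr N * y powr (- (real N - 1) * pp)"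
      by (rule mult_left_mono) simp
    also have "\<dots> = y powr ?e" by (subst powr_add[symmetric]) (simp add: algebra_simps)
    finally show ?case using elim B0 power_eq_powr(1)[of y] by (simp add: \<rho>_def mult.assoc)
  qed
  show "\<forall>\<^sub>F y in at_top. 0 \<le> \<rho> y"
    using eventually_gt_at_top[of 0] by eventually_elim (simp add: \<rho>_nonneg)
qed

lemma G_lim: "(G \<longlongrightarrow> M) at_top"
proof -
  have yt: "filterlim (\<lambda>y::real. y powr pp) at_top at_top"
  proof (rule filterlim_at_top_mono[OF filterlim_ident])
    show "\<forall>\<^sub>F y::real in at_top. y \<le> y powr pp"
      using eventually_ge_at_top[of 1]
    proof eventually_elim
      case (elim y)
      then show ?case using powr_mono[of 1 pp y] pp1 by simp
    qed
  qed
  have 1: "((\<lambda>y. B * y ^ N * (1 + y powr pp) powr (- real N)) \<longlongrightarrow> 0) at_top"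
  proof (rule tendsto_sandwich[OF _ _ tendsto_const \<rho>_lim])
    show "\<forall>\<^sub>F y in at_top. B * y ^ N * (1 + y powr pp) powr (- real N) \<le> \<rho> y"
      using eventually_gt_at_top[of 0]
    proof eventually_elim
      case (elim y)
      have "(1 + y powr pp) powr (- real N) \<le> (1 + y powr pp) powr (- (real N - 1))"
        by (intro powr_mono) auto
      then show ?case unfolding \<rho>_def using elim B0 by (intro mult_left_mono) auto
    qed
    show "\<forall>\<^sub>F y in at_top. 0 \<le> B * y ^ N * (1 + y powr pp) powr (- real N)"
      using eventually_gt_at_top[of 0] by eventually_elim (use B0 in simp)
  qed
  have "((\<lambda>y::real. 1 - inverse (1 + y)) \<longlongrightarrow> 1 - 0) at_top"
    by (intro tendsto_intros tendsto_inverse_0_at_top filterlim_tendsto_add_at_top[OF tendsto_const] filterlim_ident)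
  from filterlim_compose[OF this yt] have "((\<lambda>y. 1 - inverse (1 + y powr pp)) \<longlongrightarrow> 1) at_top" by simp
  moreover have "1 - inverse (1 + y powr pp) = y powr pp / (1 + y powr pp)" for y
    using one_plus_powr_neq[of y pp] by (simp add: field_simps)
  ultimately have z: "((\<lambda>y. y powr pp / (1 + y powr pp)) \<longlongrightarrow> 1) at_top" by simp
  have "((\<lambda>y. J (y powr pp / (1 + y powr pp))) \<longlongrightarrow> J 1) at_top"
    by (rule continuous_on_tendsto_compose[OF J_cont z])
       (use z_bounds in \<open>auto intro!: always_eventually\<close>)
  then have "((\<lambda>y. B * y ^ N * (1 + y powr pp) powr (- real N) + B * N * J (y powr pp / (1 + y powr pp))) \<longlongrightarrow> 0 + B * N * J 1) at_top"
    by (intro tendsto_add 1 tendsto_mult tendsto_const)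
  then show ?thesis by (simp add: G_def[abs_def] M_def J_1)
qed

lemma M_eq: "M = B * (Gamma (real N / p) * Gamma (real N + 1 - real N / p) / Gamma (real N))"
proof -
  have "Gamma (real N + 1) = real N * Gamma (real N)" using N2 by (intro Gamma_plus1) auto
  then show ?thesis using N2 by (simp add: M_def Beta_def field_simps)
qed

lemma G_less_M: "G y < M" if "y \<ge> 0"
proof -
  have "G (y + 1) \<le> M"
  proof (rule tendsto_lowerbound[OF G_lim])
    show "\<forall>\<^sub>F x in at_top. G (y + 1) \<le> G x"
      using eventually_gt_at_top[of "y + 1"]
    proof eventually_elim
      case (elim x)
      show ?case by (rule less_imp_le[OF G_strict_mono]) (use that elim in auto)
    qed
  qed simp
  then show ?thesis using G_strict_mono[of y "y + 1"] that by simp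
qed

lemma M_pos: "M > 0" using G_less_M[of 0] by (simp add: G_0)

end

text \<open>To be applied to the eigenvalues of the derivative of a radial map:
  \<open>a = T' r\<close> is simple and \<open>b = T r / r\<close> has multiplicity
  \<open>N - 1\<close>. The left side is then \<open>N\<close> times the N-th root of the
  determinant, and the right side is the divergence.\<close>

lemma (in bliss) weighted_AM_GM:
  assumes "a > 0" "b > 0"
  shows "N * (a * b ^ (N - 1)) powr (1 / N) \<le> a + (real N - 1) * b"
proof -
  have "a powr (1 / N) * b powr ((real N - 1) / N) \<le> 1 / N * a + (real N - 1) / N * b"
    by (rule Youngs_inequality_0) (use N2 assms in \<open>auto simp: field_simps\<close>)
  moreover have "(a * b ^ (N - 1)) powr (1 / N) = a powr (1 / N) * b powr ((real N - 1) / N)"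
    using assms power_eq_powr(2)[of b] by (simp add: powr_mult powr_powr)
  ultimately have "N * (a * b ^ (N - 1)) powr (1 / N) \<le> N * (1 / N * a + (real N - 1) / N * b)"
    by (intro mult_left_mono) auto
  also have "\<dots> = a + (real N - 1) * b" using N2 by (simp add: distrib_left)
  finally show ?thesis .
qed

text \<open>The map \<open>T\<close> (the inverse of \<open>G\<close> after the mass function of \<open>f\<close>) transports the radial density \<open>f\<close> to the bubble density; the inequality for \<open>T'\<close> is the
arithmetic-geometric mean bound of the determinant of the radial map by its divergence.\<close>

lemma (in bliss) transport_map:
  fixes f :: "real \<Rightarrow> real"
  assumes fc: "continuous_on {0..1} f" and f_lo: "\<And>r. 0 \<le> r \<Longrightarrow> r \<le> 1 \<Longrightarrow> \<eta> \<le> f r"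
    and f_hi: "\<And>r. 0 \<le> r \<Longrightarrow> r \<le> 1 \<Longrightarrow> f r \<le> C" and \<eta>: "\<eta> > 0"
    and mass: "integral {0..1} (\<lambda>r. B * N * f r * r ^ (N - 1)) = G R" and R0: "R > 0"
  obtains T T' L where "radial_profile T T' L"
    "\<And>r. 0 \<le> r \<Longrightarrow> r \<le> 1 \<Longrightarrow> 0 \<le> T r" "\<And>r. 0 \<le> r \<Longrightarrow> r \<le> 1 \<Longrightarrow> T r \<le> R"
    "\<And>r. 0 < r \<Longrightarrow> r < 1 \<Longrightarrow> N * f r powr (1 / N) * (1 + T r powr pp) \<le> T' r + (real N - 1) * (T r / r)"
    "((\<lambda>r. B * N * f r * r ^ (N - 1) * T r powr pp) has_integral H R) {0..1}"
proof -
  define \<Phi> where "\<Phi> r = B * N * f r * r ^ (N - 1)" for r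
  define F where "F r = integral {0..r} \<Phi>" for r
  have \<Phi>c: "continuous_on {0..1} \<Phi>" unfolding \<Phi>_def by (intro continuous_intros fc)
  have \<Phi>pos: "\<Phi> r > 0" if "0 < r" "r \<le> 1" for r
    using f_lo[of r] that \<eta> B0 N2 by (simp add: \<Phi>_def)
  have Fc: "continuous_on {0..1} F"
    unfolding F_def by (intro indefinite_integral_continuous_1 integrable_continuous_real \<Phi>c)
  have Fd: "(F has_real_derivative \<Phi> r) (at r)" if r: "0 < r" "r < 1" for r
  proof -
    have "(F has_real_derivative \<Phi> r) (at r within {0..1})"
      unfolding F_def by (rule integral_has_real_derivative[OF \<Phi>c]) (use r in auto)
    moreover have "at r within {0..1} = at r" using r by (intro at_within_interior) simp
    ultimately show ?thesis by simp
  qed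
  have F0: "F 0 = 0" by (simp add: F_def)
  have F1: "F 1 = G R" using mass by (simp add: F_def \<Phi>_def[abs_def])
  have Fmono: "F a < F b" if "0 \<le> a" "a < b" "b \<le> 1" for a b
  proof (rule DERIV_pos_imp_increasing_open[OF that(2)])
    fix x assume "a < x" "x < b"
    then show "\<exists>y. (F has_real_derivative y) (at x) \<and> 0 < y" using Fd[of x] \<Phi>pos[of x] that by auto
  next
    show "continuous_on {a..b} F" by (rule continuous_on_subset[OF Fc]) (use that in auto)
  qed
  \<comment> \<open>Near the origin \<open>f\<close> has at least \<open>\<eta>\<close> times the
    mass of the volume. With \<open>G_le\<close> this forces \<open>T\<close> to grow at least
    linearly, which keeps \<open>T'\<close> bounded at 0.\<close>
  have Flow: "\<eta> * (B * r ^ N) \<le> F r" if r: "0 \<le> r" "r \<le> 1" for r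
  proof -
    have "F 0 - \<eta> * (B * 0 ^ N) \<le> F r - \<eta> * (B * r ^ N)"
    proof (rule DERIV_nonneg_imp_increasing_open[where f="\<lambda>r. F r - \<eta> * (B * r ^ N)" and a=0 and b=r])
      fix x assume x: "0 < x" "x < r"
      show "\<exists>y. ((\<lambda>r. F r - \<eta> * (B * r ^ N)) has_real_derivative y) (at x) \<and> 0 \<le> y"
      proof (intro exI conjI)
        show "((\<lambda>r. F r - \<eta> * (B * r ^ N)) has_real_derivative \<Phi> x - \<eta> * (B * (N * x ^ (N - 1)))) (at x)"
          by (rule DERIV_diff) (use x r in \<open>auto intro!: derivative_eq_intros Fd\<close>)
        have "\<eta> * (B * (N * x ^ (N - 1))) \<le> f x * (B * (N * x ^ (N - 1)))"
          using f_lo[of x] x r B0 by (intro mult_right_mono) auto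
        then show "0 \<le> \<Phi> x - \<eta> * (B * (N * x ^ (N - 1)))" by (simp add: \<Phi>_def mult_ac)
      qed
    next
      show "continuous_on {0..r} (\<lambda>r. F r - \<eta> * (B * r ^ N))"
        by (intro continuous_intros continuous_on_subset[OF Fc]) (use r in auto)
    qed (use r in auto)
    then show ?thesis using N2 by (simp add: F0 power_0_left)
  qed
  \<comment> \<open>Inverting \<open>G\<close> on an interval slightly larger than
    \<open>[0, R]\<close> keeps every value \<open>F r\<close> with \<open>r > 0\<close> in the
    interior of the domain of the inverse.\<close>
  define Y where "Y = R + 1"
  have Y: "0 < Y" "R < Y" using R0 by (auto simp: Y_def)
  define Gi where "Gi = inv_into {0..Y} G"
  have Ginj: "inj_on G {0..Y}"
    by (rule linorder_inj_onI) (use G_strict_mono in fastforce)+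
  have GYc: "continuous_on {0..Y} G" by (rule continuous_on_subset[OF G_cont]) auto
  have Gimg: "v \<in> G ` {0..Y}" if v: "0 \<le> v" "v \<le> G Y" for v
  proof -
    obtain y where "0 \<le> y" "y \<le> Y" "G y = v"
      using IVT'[of G 0 v Y] v Y GYc G_0 by auto
    then show ?thesis by auto
  qed
  have Gi: "0 \<le> Gi v" "Gi v \<le> Y" "G (Gi v) = v" if v: "0 \<le> v" "v \<le> G Y" for v
    using inv_into_into[OF Gimg[OF v]] f_inv_into_f[OF Gimg[OF v]] by (auto simp: Gi_def)
  have GiG: "Gi (G y) = y" if "0 \<le> y" "y \<le> Y" for y
    unfolding Gi_def by (rule inv_into_f_f[OF Ginj]) (use that in auto)
  have Gic: "continuous_on {0..G Y} Gi"
  proof (rule continuous_on_subset)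
    show "continuous_on (G ` {0..Y}) Gi"
      by (rule continuous_on_inv[OF GYc]) (use GiG in auto)
  qed (use Gimg in auto)
  have GRY: "G R < G Y" using G_strict_mono[of R Y] R0 Y by simp
  have Fle: "0 \<le> F r \<and> F r \<le> G R" if r: "0 \<le> r" "r \<le> 1" for r
    using Fmono[of 0 r] Fmono[of r 1] r F0 F1 by (cases "r = 0"; cases "r = 1") auto
  define T where "T r = Gi (F r)" for r
  define T' where "T' r = inverse (k (T r)) * \<Phi> r" for r
  have T_ge: "0 \<le> T r" and GT: "G (T r) = F r" and TY: "T r \<le> Y" if r: "0 \<le> r" "r \<le> 1" for r
    using Gi[of "F r"] Fle[OF r] GRY by (auto simp: T_def)
  have T_le: "T r \<le> R" if r: "0 \<le> r" "r \<le> 1" for r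
    using G_strict_mono[of R "T r"] GT[OF r] Fle[OF r] R0 by (cases "R < T r") auto
  have T0: "T 0 = 0" using GiG[of 0] Y by (simp add: T_def F0 G_0)
  have T1: "T 1 = R" using GiG[of R] Y R0 by (simp add: T_def F1)
  have Tc: "continuous_on {0..1} T"
    unfolding T_def by (rule continuous_on_compose2[OF Gic Fc]) (use Fle GRY in force)
  \<comment> \<open>Since \<open>e \<le> 1\<close>, one has
    \<open>e ^ N \<le> e \<le> \<eta>\<close>; this avoids an N-th root of
    \<open>\<eta>\<close>.\<close>
  define e where "e = min 1 \<eta>"
  have e: "0 < e" "e \<le> 1" "e \<le> \<eta>" using \<eta> by (auto simp: e_def)
  have T_low: "e * r \<le> T r" if r: "0 \<le> r" "r \<le> 1" for r
  proof -
    have "e ^ N \<le> e ^ 1" using e N2 by (intro power_decreasing) auto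
    then have "e ^ N \<le> \<eta>" using e by simp
    then have "e ^ N * (B * r ^ N) \<le> \<eta> * (B * r ^ N)" using B0 r by (intro mult_right_mono) auto
    also have "\<dots> \<le> F r" by (rule Flow[OF r])
    also have "\<dots> \<le> B * T r ^ N" using G_le[OF T_ge[OF r]] GT[OF r] by simp
    finally have "(e * r) ^ N \<le> T r ^ N" using B0 by (simp add: power_mult_distrib)
    then show ?thesis using N2 T_ge[OF r] power_mono_iff[of "e * r" "T r" N] e r by simp
  qed
  have Tpos: "0 < T r" if "0 < r" "r \<le> 1" for r
    using T_low[of r] e that by (smt (verit) mult_pos_pos)
  have Td: "(T has_real_derivative T' r) (at r)" if r: "0 < r" "r < 1" for r
  proof -
    have Fr: "0 < F r" "F r < G Y" using Fmono[of 0 r] Fle[of r] GRY r F0 by auto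
    have "isCont Gi (F r)"
    proof -
      have "continuous_on {0<..<G Y} Gi" by (rule continuous_on_subset[OF Gic]) auto
      then show ?thesis using Fr continuous_on_eq_continuous_at[of "{0<..<G Y}" Gi] by auto
    qed
    then have "(Gi has_real_derivative inverse (k (T r))) (at (F r))"
      using G_deriv[OF Tpos[of r]] k_pos[OF Tpos[of r]] Fr Gi r
      by (intro DERIV_inverse_function[where f=G and a=0 and b="G Y"]) (auto simp: T_def)
    from DERIV_chain2[OF this Fd[OF r]] show ?thesis by (simp add: T_def[abs_def] T'_def)
  qed
  have T'pos: "0 < T' r" if r: "0 < r" "r < 1" for r
    using k_pos[OF Tpos[of r]] \<Phi>pos[of r] r by (simp add: T'_def)
  define \<kappa> where "\<kappa> = (1 + R powr pp) powr (- real N)"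
  have \<kappa>0: "\<kappa> > 0" using one_plus_powr_neq by (simp add: \<kappa>_def)
  \<comment> \<open>In \<open>T' r = \<Phi> r / k (T r)\<close> the factor
    \<open>r ^ (N - 1)\<close> of \<open>\<Phi>\<close> is compensated by
    \<open>T r ^ (N - 1) \<ge> (e * r) ^ (N - 1)\<close> in \<open>k\<close>, and the remaining
    weight in \<open>k\<close> is smallest at radius \<open>R\<close>, where it equals
    \<open>\<kappa>\<close>.\<close>
  define L where "L = C / (e ^ (N - 1) * \<kappa>)"
  have T'L: "T' r \<le> L" if r: "0 < r" "r < 1" for r
  proof -
    have Cpos: "C > 0" using f_lo[of r] f_hi[of r] \<eta> r by linarith
    have 1: "\<kappa> \<le> (1 + T r powr pp) powr (- real N)"
      unfolding \<kappa>_def using T_le[of r] T_ge[of r] r pp1 one_plus_powr_pos[of "T r" pp]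
      by (intro powr_mono2') (auto intro!: powr_mono2)
    have "(e * r) ^ (N - 1) \<le> T r ^ (N - 1)" using T_low[of r] e r by (intro power_mono) auto
    then have "B * N * (e * r) ^ (N - 1) * \<kappa> \<le> k (T r)"
      unfolding k_def using 1 B0 \<kappa>0 Tpos[of r] r e by (intro mult_mono) auto
    moreover have p: "B * N * (e * r) ^ (N - 1) * \<kappa> > 0" using B0 N2 e r \<kappa>0 by simp
    ultimately have "T' r \<le> inverse (B * N * (e * r) ^ (N - 1) * \<kappa>) * \<Phi> r"
      unfolding T'_def using \<Phi>pos[of r] r by (intro mult_right_mono le_imp_inverse_le) auto
    also have "\<dots> \<le> inverse (B * N * (e * r) ^ (N - 1) * \<kappa>) * (B * N * C * r ^ (N - 1))"
      unfolding \<Phi>_def using f_hi[of r] r p B0 e \<kappa>0 by (intro mult_left_mono mult_right_mono) auto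
    also have "\<dots> = L" using B0 N2 e r \<kappa>0 by (simp add: L_def power_mult_distrib field_simps)
    finally show ?thesis .
  qed
  have Tinc: "0 \<le> T b - T a \<and> T b - T a \<le> L * (b - a)" if ab: "0 \<le> a" "a \<le> b" "b \<le> 1" for a b
  proof -
    have sub: "continuous_on {a..b} T" by (rule continuous_on_subset[OF Tc]) (use ab in auto)
    have "T a \<le> T b"
    proof (rule DERIV_nonneg_imp_increasing_open[OF ab(2) _ sub])
      fix x assume "a < x" "x < b"
      then show "\<exists>y. (T has_real_derivative y) (at x) \<and> 0 \<le> y"
        using Td[of x] T'pos[of x] ab by (auto intro: less_imp_le)
    qed
    moreover have "L * a - T a \<le> L * b - T b"
    proof (rule DERIV_nonneg_imp_increasing_open[where f="\<lambda>x. L * x - T x", OF ab(2)])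
      fix x assume x: "a < x" "x < b"
      show "\<exists>y. ((\<lambda>x. L * x - T x) has_real_derivative y) (at x) \<and> 0 \<le> y"
      proof (intro exI conjI)
        show "((\<lambda>x. L * x - T x) has_real_derivative L * 1 - T' x) (at x)"
          by (intro DERIV_diff DERIV_cmult DERIV_ident Td) (use x ab in auto)
        show "0 \<le> L * 1 - T' x" using T'L[of x] x ab by simp
      qed
    qed (intro continuous_intros sub)
    ultimately show ?thesis by (simp add: algebra_simps)
  qed
  have prof: "radial_profile T T' L"
  proof
    show "T 0 = 0" by (rule T0)
    show "\<bar>T r - T s\<bar> \<le> L * \<bar>r - s\<bar>" if "0 \<le> r" "r \<le> 1" "0 \<le> s" "s \<le> 1" for r s
      using Tinc[of r s] Tinc[of s r] that by (cases "r \<le> s") auto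
    show "(T has_real_derivative T' r) (at r)" if "0 < r" "r < 1" for r by (rule Td[OF that])
    have Tc': "continuous_on {0<..<1} T" by (rule continuous_on_subset[OF Tc]) auto
    have kc: "continuous_on {0<..} k"
      unfolding k_def[abs_def]
      by (intro continuous_on_mult continuous_on_const continuous_on_power continuous_on_id continuous_on_subset[OF one_plus_powr_cont]) auto
    show "continuous_on {0<..<1} T'"
      unfolding T'_def
    proof (intro continuous_on_mult continuous_on_inverse)
      show "continuous_on {0<..<1} (\<lambda>x. k (T x))"
        by (rule continuous_on_compose2[OF kc Tc']) (use Tpos in auto)
      show "continuous_on {0<..<1} \<Phi>" by (rule continuous_on_subset[OF \<Phi>c]) auto
      show "\<forall>x\<in>{0<..<1}. k (T x) \<noteq> 0" using k_pos Tpos by (metis greaterThanLessThan_iff less_imp_le less_irrefl)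
    qed
  qed
  have amgm: "N * f r powr (1 / N) * (1 + T r powr pp) \<le> T' r + (real N - 1) * (T r / r)" if r: "0 < r" "r < 1" for r
  proof -
    have t: "T r > 0" using Tpos r by auto
    have fpos: "f r > 0" using f_lo[of r] \<eta> r by linarith
    have p1': "(1 + T r powr pp) powr (- real N) = inverse ((1 + T r powr pp) ^ N)"
      using one_plus_powr_pos by (simp add: powr_minus powr_realpow)
    \<comment> \<open>The Jacobian equation of the transport. Its right side is the source density
      divided by the bubble density at the image point, and the N-th root of the latter is
      \<open>1 / (1 + T r powr pp)\<close>.\<close>
    have "T' r * (T r / r) ^ (N - 1) = f r * (1 + T r powr pp) ^ N"
      unfolding T'_def k_def \<Phi>_def p1' using B0 N2 t r by (simp add: power_divide field_simps)
    then have "(T' r * (T r / r) ^ (N - 1)) powr (1 / N) = f r powr (1 / N) * ((1 + T r powr pp) ^ N) powr (1 / N)"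
      using fpos one_plus_powr_pos[of "T r" pp] by (simp add: powr_mult)
    also have "((1 + T r powr pp) ^ N) powr (1 / N) = 1 + T r powr pp"
      using N2 one_plus_powr_pos[of "T r" pp] by (simp add: powr_realpow[symmetric] powr_powr)
    finally show ?thesis using weighted_AM_GM[OF T'pos[OF r], of "T r / r"] t r by (simp add: mult.assoc)
  qed
  have hi: "((\<lambda>r. \<Phi> r * T r powr pp) has_integral H R) {0..1}"
  proof -
    \<comment> \<open>Change of variables by the antiderivative \<open>H (T r)\<close>. The radius 0
      is excluded afterwards because \<open>k\<close> vanishes there and cannot be cancelled against
      its inverse in \<open>T'\<close>.\<close>
    have "((\<lambda>r. T' r * (T r powr pp * k (T r))) has_integral H (T 1) - H (T 0)) {0..1}"
    proof (rule fundamental_theorem_of_calculus_interior)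
      show "continuous_on {0..1} (\<lambda>r. H (T r))"
        by (rule continuous_on_compose2[OF H_cont Tc]) (use T_ge in auto)
      fix r :: real assume r: "r \<in> {0<..<1}"
      have "((\<lambda>r. H (T r)) has_real_derivative (T r powr pp * k (T r)) * T' r) (at r)"
        by (rule DERIV_chain2[OF H_deriv Td]) (use r Tpos in auto)
      then show "((\<lambda>r. H (T r)) has_vector_derivative T' r * (T r powr pp * k (T r))) (at r)"
        by (simp add: has_real_derivative_iff_has_vector_derivative mult.commute)
    qed simp
    then have "((\<lambda>r. T' r * (T r powr pp * k (T r))) has_integral H R) {0..1}" by (simp add: T0 T1 H_0)
    then show ?thesis
    proof (rule has_integral_spike_finite[of "{0}", rotated 2])
      fix r :: real assume r: "r \<in> {0..1} - {0}"
      then have "k (T r) > 0" using k_pos[OF Tpos[of r]] by simp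
      then show "\<Phi> r * T r powr pp = T' r * (T r powr pp * k (T r))" by (simp add: T'_def)
    qed simp
  qed
  show ?thesis
    by (rule that[OF prof T_ge T_le amgm hi[unfolded \<Phi>_def]])
qed

subsection \<open>Bliss' inequality\<close>

text \<open>\<open>wfun \<mu> t\<close> increases to \<open>|t|\<close> as \<open>\<mu>\<close> decreases to 0. It is bounded, so that the chain rule for \<open>wfun \<mu> u powr b\<close> only
involves bounded functions of \<open>u\<close>.\<close>

definition wfun :: "real \<Rightarrow> real \<Rightarrow> real" where "wfun \<mu> t = \<bar>t\<bar> / (1 + \<mu> * \<bar>t\<bar>)"

text \<open>The difference of the two powers is the sign of \<open>t\<close> times
  \<open>wfun \<mu> t powr (b - 1)\<close>. Written with positive and negative parts, it is
  continuous across 0 without a case distinction.\<close>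

definition wfun_powr_deriv :: "real \<Rightarrow> real \<Rightarrow> real \<Rightarrow> real" where
  "wfun_powr_deriv \<mu> b t = b * ((max 0 t / (1 + \<mu> * \<bar>t\<bar>)) powr (b - 1) - (max 0 (- t) / (1 + \<mu> * \<bar>t\<bar>)) powr (b - 1)) / (1 + \<mu> * \<bar>t\<bar>)^2"

context
  fixes \<mu> :: real
  assumes \<mu>: "\<mu> > 0"
begin

lemma wfun_den: "1 + \<mu> * \<bar>t\<bar> \<ge> 1" using \<mu> by simp

lemma wfun_den_pos: "1 + \<mu> * \<bar>t\<bar> > 0" using wfun_den[of t] by linarith

lemma wfun_nonneg: "0 \<le> wfun \<mu> t" using wfun_den_pos[of t] by (simp add: wfun_def)

lemma wfun_le: "wfun \<mu> t \<le> \<bar>t\<bar>"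
  using wfun_den[of t] wfun_den_pos[of t] by (simp add: wfun_def divide_le_eq mult_le_cancel_left1)

lemma wfun_bound: "wfun \<mu> t \<le> 1 / \<mu>"
  using wfun_den_pos[of t] \<mu> by (simp add: wfun_def field_simps)

lemma wfun_continuous: "continuous_on UNIV (wfun \<mu>)"
  unfolding wfun_def using wfun_den_pos by (intro continuous_intros) (metis less_irrefl)

context
  fixes b :: real
  assumes b1: "b > 1"
begin

lemma abs_wfun_powr_deriv: "\<bar>wfun_powr_deriv \<mu> b t\<bar> \<le> b * wfun \<mu> t powr (b - 1)"
proof -
  have "\<bar>(max 0 t / (1 + \<mu> * \<bar>t\<bar>)) powr (b - 1) - (max 0 (- t) / (1 + \<mu> * \<bar>t\<bar>)) powr (b - 1)\<bar> = wfun \<mu> t powr (b - 1)"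
    by (cases "t \<ge> 0") (auto simp: wfun_def max_def)
  then have "\<bar>wfun_powr_deriv \<mu> b t\<bar> = b * wfun \<mu> t powr (b - 1) / (1 + \<mu> * \<bar>t\<bar>)^2"
    using b1 by (simp add: wfun_powr_deriv_def abs_mult)
  also have "\<dots> \<le> b * wfun \<mu> t powr (b - 1)"
  proof -
    have "(1 + \<mu> * \<bar>t\<bar>)^2 \<ge> 1" using wfun_den[of t] by (rule one_le_power)
    then have "X / (1 + \<mu> * \<bar>t\<bar>)^2 \<le> X / 1" if "X \<ge> 0" for X by (intro divide_left_mono) (use that in auto)
    then show ?thesis using b1 by simp
  qed
  finally show ?thesis .
qed

lemma wfun_powr_deriv_bound: "\<bar>wfun_powr_deriv \<mu> b t\<bar> \<le> b * (1 / \<mu>) powr (b - 1)"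
  by (rule order_trans[OF abs_wfun_powr_deriv])
     (use b1 wfun_bound wfun_nonneg in \<open>auto intro!: mult_left_mono powr_mono2\<close>)

lemma wfun_powr_deriv_continuous: "continuous_on UNIV (wfun_powr_deriv \<mu> b)"
proof -
  have n: "1 + \<mu> * \<bar>t\<bar> \<noteq> 0" for t using wfun_den_pos[of t] by linarith
  have 1: "continuous_on UNIV (\<lambda>t::real. (max 0 t / (1 + \<mu> * \<bar>t\<bar>)) powr (b - 1))"
    using b1 wfun_den_pos by (intro continuous_on_powr' continuous_intros) (auto simp: n less_imp_le)
  have 2: "continuous_on UNIV (\<lambda>t::real. (max 0 (-t) / (1 + \<mu> * \<bar>t\<bar>)) powr (b - 1))"
    using b1 wfun_den_pos by (intro continuous_on_powr' continuous_intros) (auto simp: n less_imp_le)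
  show ?thesis unfolding wfun_powr_deriv_def[abs_def]
    by (intro continuous_intros 1 2) (simp add: n)
qed

lemma wfun_powr_has_deriv: "((\<lambda>t. wfun \<mu> t powr b) has_real_derivative wfun_powr_deriv \<mu> b t) (at t)"
proof -
  have pos: "((\<lambda>t. wfun \<mu> t powr b) has_real_derivative wfun_powr_deriv \<mu> b t) (at t)" if t: "t > 0" for t
  proof -
    have d: "1 + \<mu> * t > 0" using \<mu> t by (simp add: add_pos_pos)
    have dq: "((\<lambda>t. t / (1 + \<mu> * t)) has_real_derivative 1 / (1 + \<mu> * t)^2) (at t)"
      by (rule DERIV_cong[OF DERIV_divide[OF DERIV_ident DERIV_add[OF DERIV_const DERIV_cmult[OF DERIV_ident]]]])
         (use d in \<open>auto simp: power2_eq_square algebra_simps\<close>)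
    have "((\<lambda>t. (t / (1 + \<mu> * t)) powr b) has_real_derivative (b * (t / (1 + \<mu> * t)) powr (b - 1)) * (1 / (1 + \<mu> * t)^2)) (at t)"
      by (rule DERIV_chain2[OF has_real_derivative_powr dq]) (use t d in auto)
    moreover have "(b * (t / (1 + \<mu> * t)) powr (b - 1)) * (1 / (1 + \<mu> * t)^2) = wfun_powr_deriv \<mu> b t"
      using t b1 by (simp add: wfun_powr_deriv_def)
    ultimately have "((\<lambda>t. (t / (1 + \<mu> * t)) powr b) has_real_derivative wfun_powr_deriv \<mu> b t) (at t)" by simp
    then show ?thesis
      by (rule has_field_derivative_transform_within_open[where S="{0<..}"]) (use t in \<open>auto simp: wfun_def\<close>)
  qed
  consider "t > 0" | "t < 0" | "t = 0" by linarith
  then show ?thesis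
  proof cases
    case 2
    have "((\<lambda>t. wfun \<mu> (- t) powr b) has_real_derivative wfun_powr_deriv \<mu> b (- t) * (-1)) (at t)"
      by (rule DERIV_chain2[OF pos]) (use 2 in \<open>auto intro!: derivative_eq_intros\<close>)
    moreover have "wfun \<mu> (- t) = wfun \<mu> t" for t by (simp add: wfun_def)
    moreover have "wfun_powr_deriv \<mu> b (- t) * (-1) = wfun_powr_deriv \<mu> b t"
      by (simp add: wfun_powr_deriv_def minus_divide_left algebra_simps)
    ultimately show ?thesis by simp
  next
    case 3
    have z: "wfun_powr_deriv \<mu> b 0 = 0" by (simp add: wfun_powr_deriv_def)
    have "((\<lambda>h::real. \<bar>h\<bar> powr (b - 1)) \<longlongrightarrow> \<bar>0\<bar> powr (b - 1)) (at 0)"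
      by (intro tendsto_powr' tendsto_intros) (use b1 in \<open>auto intro!: always_eventually\<close>)
    then have lim: "((\<lambda>h::real. \<bar>h\<bar> powr (b - 1)) \<longlongrightarrow> 0) (at 0)" using b1 by simp
    \<comment> \<open>At 0 the difference quotient is at most
      \<open>\<bar>h\<bar> powr (b - 1)\<close>, which tends to 0 because
      \<open>b > 1\<close>.\<close>
    have "((\<lambda>h. (wfun \<mu> h powr b - wfun \<mu> 0 powr b) / h) \<longlongrightarrow> 0) (at 0)"
    proof (rule Lim_null_comparison[OF _ lim])
      show "\<forall>\<^sub>F h in at 0. norm ((wfun \<mu> h powr b - wfun \<mu> 0 powr b) / h) \<le> \<bar>h\<bar> powr (b - 1)"
        unfolding eventually_at_filter
      proof (intro always_eventually allI impI)
        fix h :: real assume h: "h \<noteq> 0"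
        have "wfun \<mu> h powr b \<le> \<bar>h\<bar> powr b" using wfun_le wfun_nonneg b1 by (intro powr_mono2) auto
        then have "wfun \<mu> h powr b / \<bar>h\<bar> \<le> \<bar>h\<bar> powr b / \<bar>h\<bar>" by (rule divide_right_mono) simp
        also have "\<dots> = \<bar>h\<bar> powr (b - 1)" using h by (simp add: powr_diff)
        finally show "norm ((wfun \<mu> h powr b - wfun \<mu> 0 powr b) / h) \<le> \<bar>h\<bar> powr (b - 1)"
          by (simp add: wfun_def)
      qed
    qed
    then show ?thesis using 3 z by (simp add: has_field_derivative_iff)
  qed (rule pos)
qed

end
end

text \<open>By \<open>distr_norm_lborel\<close> the law of the norm has a density, so exceptional
  radii of measure zero give an exceptional set of points of measure zero.\<close>

lemma AE_norm_notin_negligible: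
  fixes Z :: "real set"
  assumes "negligible Z"
  shows "AE x::'a::euclidean_space in lebesgue. norm x \<notin> Z"
proof -
  have "Z \<in> null_sets (completion lborel)" using assms by (simp add: negligible_iff_null_sets)
  then obtain Z' where Z': "Z' \<in> null_sets lborel" "Z \<subseteq> Z'"
    unfolding null_sets_completion_iff2 by auto
  have "AE r in lborel. r \<notin> Z'" by (rule AE_not_in[OF Z'(1)])
  then have "AE r in density lborel (\<lambda>r. ennreal (real DIM('a) * measure lebesgue (ball (0::'a) 1) * r^(DIM('a) - 1)) * indicator {0..} r). r \<notin> Z'"
    by (subst AE_density) (simp, elim eventually_mono, simp)
  then have "AE r in distr lborel borel (norm :: 'a \<Rightarrow> real). r \<notin> Z'"
    by (simp only: distr_norm_lborel)
  then have "AE x::'a in lborel. norm x \<notin> Z'"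
    using Z'(1) by (subst (asm) AE_distr_iff) (auto simp: null_sets_def)
  then have "AE x::'a in lebesgue. norm x \<notin> Z'" by (rule AE_completion)
  then show ?thesis by (rule AE_mp) (use Z'(2) in auto)
qed

lemma borel_measurable_radial:
  assumes "continuous_on {0..1} h"
  shows "(\<lambda>x::'a::euclidean_space. indicator (ball 0 1) x * (h (norm x) :: real)) \<in> borel_measurable borel"
proof -
  have "continuous_on (ball 0 1) (\<lambda>x::'a. h (norm x))"
    by (rule continuous_on_compose2[OF assms]) (auto intro!: continuous_intros)
  then show ?thesis
    using borel_measurable_continuous_on_indicator[of "ball 0 1" "\<lambda>x::'a. h (norm x)"] by simp
qed

lemma nn_integral_radial_continuous:
  fixes h :: "real \<Rightarrow> real"
  assumes hc: "continuous_on {0..1} h" and h0: "\<And>r. 0 \<le> r \<Longrightarrow> r \<le> 1 \<Longrightarrow> 0 \<le> h r"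
    and hi: "((\<lambda>r. measure lebesgue (ball (0::'a::euclidean_space) 1) * real DIM('a) * h r * r^(DIM('a) - 1)) has_integral I) {0..1}"
  shows "(\<integral>\<^sup>+x. ennreal (indicator (ball (0::'a) 1) x * h (norm x)) \<partial>lebesgue) = ennreal I"
proof -
  let ?c = "real DIM('a) * measure lebesgue (ball (0::'a) 1)"
  let ?F = "\<lambda>r. indicator {0..<1} r * (measure lebesgue (ball (0::'a) 1) * real DIM('a) * h r * r^(DIM('a) - 1))"
  have hb: "(\<lambda>r. indicator {0..<1} r * h r) \<in> borel_measurable borel"
  proof -
    have "continuous_on {0..<1} h" by (rule continuous_on_subset[OF hc]) auto
    then show ?thesis using borel_measurable_continuous_on_indicator[of "{0..<1}" h] by simp
  qed
  have Fb: "?F \<in> borel_measurable borel"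
  proof -
    have "(\<lambda>r. (indicator {0..<1} r * h r) * (measure lebesgue (ball (0::'a) 1) * real DIM('a) * r^(DIM('a) - 1))) \<in> borel_measurable borel"
      using hb by measurable
    also have "(\<lambda>r. (indicator {0..<1} r * h r) * (measure lebesgue (ball (0::'a) 1) * real DIM('a) * r^(DIM('a) - 1))) = ?F"
      by (simp add: fun_eq_iff mult_ac)
    finally show ?thesis .
  qed
  have F0: "0 \<le> ?F r" for r using h0[of r] by (auto simp: indicator_def)
  have "(\<integral>\<^sup>+x. ennreal (indicator (ball (0::'a) 1) x * h (norm x)) \<partial>lebesgue)
      = (\<integral>\<^sup>+x. ennreal (indicator {0..<1} (norm x) * h (norm x)) \<partial>(lborel :: 'a measure))"
    using borel_measurable_radial[OF hc, where 'a='a]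
    by (subst nn_integral_completion) (auto intro!: nn_integral_cong simp: indicator_def)
  also have "\<dots> = (\<integral>\<^sup>+r\<in>{0..}. ennreal (indicator {0..<1} r * h r) * ennreal (?c * r^(DIM('a) - 1)) \<partial>lborel)"
    using hb by (intro nn_integral_radial[where h="\<lambda>r. ennreal (indicator {0..<1} r * h r)"]) simp
  also have "\<dots> = (\<integral>\<^sup>+r. ennreal (?F r) \<partial>lborel)"
    using h0 by (intro nn_integral_cong) (auto simp: indicator_def ennreal_mult[symmetric] mult_ac)
  also have "\<dots> = ennreal I"
  proof (rule nn_integral_has_integral_lborel[OF Fb F0])
    have "(?F has_integral I) {0..1}"
      by (rule has_integral_spike_finite[OF _ _ hi, of "{1}"]) (auto simp: indicator_def)
    then have "((\<lambda>x. if x \<in> {0..1} then ?F x else 0) has_integral I) UNIV"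
      by (simp only: has_integral_restrict_UNIV)
    moreover have "(\<lambda>x. if x \<in> {0..1} then ?F x else 0) = ?F" by (auto simp: indicator_def fun_eq_iff)
    ultimately show "(?F has_integral I) UNIV" by simp
  qed
  finally show ?thesis .
qed

lemma integral_radial_continuous:
  fixes h :: "real \<Rightarrow> real"
  assumes hc: "continuous_on {0..1} h" and h0: "\<And>r. 0 \<le> r \<Longrightarrow> r \<le> 1 \<Longrightarrow> 0 \<le> h r"
    and hi: "((\<lambda>r. measure lebesgue (ball (0::'a::euclidean_space) 1) * real DIM('a) * h r * r^(DIM('a) - 1)) has_integral I) {0..1}"
  shows "has_bochner_integral lebesgue (\<lambda>x::'a. indicator (ball 0 1) x * h (norm x)) I"
proof (rule has_bochner_integral_nn_integral)
  show "(\<lambda>x::'a. indicator (ball 0 1) x * h (norm x)) \<in> borel_measurable lebesgue"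
    by (rule borel_measurable_lebesgueI[OF borel_measurable_radial[OF hc]])
  show "AE x::'a in lebesgue. 0 \<le> indicator (ball 0 1) x * h (norm x)"
    using h0 by (intro AE_I2) (auto simp: indicator_def)
  show "0 \<le> I"
    by (rule has_integral_nonneg[OF hi]) (use h0 in auto)
  show "(\<integral>\<^sup>+x. ennreal (indicator (ball (0::'a) 1) x * h (norm x)) \<partial>lebesgue) = ennreal I"
    by (rule nn_integral_radial_continuous[OF assms])
qed

lemma integrable_ball_bounded:
  fixes h :: "'a::euclidean_space \<Rightarrow> real"
  assumes [measurable]: "h \<in> borel_measurable lebesgue" and b: "\<And>x. x \<in> ball 0 1 \<Longrightarrow> \<bar>h x\<bar> \<le> c"
  shows "integrable lebesgue (\<lambda>x. indicator (ball 0 1) x * h x)"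
proof (rule Bochner_Integration.integrable_bound)
  have [measurable]: "ball (0::'a) 1 \<in> sets lebesgue" by simp
  show "integrable lebesgue (\<lambda>x::'a. c * indicator (ball 0 1) x)"
    using emeasure_lebesgue_ball_finite[of "0::'a" 1] by (intro integrable_mult_right) (simp add: integrable_indicator_iff less_top)
  show "(\<lambda>x. indicator (ball 0 1) x * h x) \<in> borel_measurable lebesgue" by measurable
  show "AE x in lebesgue. norm (indicator (ball 0 1) x * h x) \<le> norm (c * indicator (ball (0::'a) 1) x)"
    using b by (intro AE_I2) (fastforce simp: indicator_def)
qed

lemma powr_Young:
  fixes a b p p' l :: real
  assumes "p > 1" "p' > 1" "1 / p + 1 / p' = 1" "a \<ge> 0" "b \<ge> 0" "l > 0"
  shows "a * b \<le> l powr p / p * a powr p + l powr (- p') / p' * b powr p'"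
proof -
  have "(l * a) * (b / l) \<le> (l * a) powr p / p + (b / l) powr p' / p'"
    by (rule Youngs_inequality) (use assms in auto)
  moreover have "(l * a) * (b / l) = a * b" using assms by simp
  moreover have "(l * a) powr p = l powr p * a powr p" using assms by (simp add: powr_mult)
  moreover have "(b / l) powr p' = l powr (- p') * b powr p'"
  proof -
    have "(b / l) powr p' = b powr p' / l powr p'" using assms by (simp add: powr_divide)
    then show ?thesis by (simp add: powr_minus divide_inverse)
  qed
  ultimately show ?thesis by simp
qed

text \<open>The divergence identity for the transport field of \<open>fh\<close>, with \<open>fh\<close> a continuous approximation of the normalized density \<open>f\<close>.
The two integrals of differences are the approximation errors; \<open>\<sigma>\<close> is the free scaling in Young's inequality.\<close>

lemma (in bliss) transport_inequality:
  fixes u :: "'a::euclidean_space \<Rightarrow> real" and fh :: "real \<Rightarrow> real"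
  assumes N: "N = DIM('a)" and B: "B = measure lebesgue (ball (0::'a) 1)"
    and W: "W0 p (ball 0 1) u g" and lp: "lp_int p (ball 0 1) g \<le> 1"
    and \<mu>: "\<mu> > 0" and \<sigma>: "\<sigma> > 0" and \<kappa>: "\<kappa> > 0"
    and fc: "continuous_on {0..1} fh" and f_lo: "\<And>r. 0 \<le> r \<Longrightarrow> r \<le> 1 \<Longrightarrow> \<eta> \<le> fh r"
    and f_hi: "\<And>r. 0 \<le> r \<Longrightarrow> r \<le> 1 \<Longrightarrow> fh r \<le> C" and \<eta>: "\<eta> > 0"
    and mass: "((\<lambda>r. B * N * fh r * r ^ (N - 1)) has_integral G R) {0..1}" and R0: "R > 0"
  defines "f \<equiv> \<lambda>x. \<kappa> * wfun \<mu> (u x) powr ps" and "a \<equiv> (real N - 1) / real N"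
  shows "N * \<kappa> powr (- a) * (G R + H R - (1 + R powr pp) *
            (\<integral>x. indicator (ball 0 1) x * (\<bar>f x powr a - fh (norm x) powr a\<bar> * fh (norm x) powr (1 / N)) \<partial>lebesgue))
     \<le> \<beta> * (\<sigma> powr p / p + \<sigma> powr (- pp) / pp * (inverse \<kappa> * (H R + R powr pp *
            (\<integral>x. indicator (ball 0 1) x * \<bar>f x - fh (norm x)\<bar> \<partial>lebesgue))))"
proof -
  obtain T T' L where prof: "radial_profile T T' L"
    and T_ge: "\<And>r. 0 \<le> r \<Longrightarrow> r \<le> 1 \<Longrightarrow> 0 \<le> T r" and T_le: "\<And>r. 0 \<le> r \<Longrightarrow> r \<le> 1 \<Longrightarrow> T r \<le> R"
    and amgm: "\<And>r. 0 < r \<Longrightarrow> r < 1 \<Longrightarrow> N * fh r powr (1 / N) * (1 + T r powr pp) \<le> T' r + (real N - 1) * (T r / r)"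
    and hiT: "((\<lambda>r. B * N * fh r * r ^ (N - 1) * T r powr pp) has_integral H R) {0..1}"
  proof (rule transport_map[OF fc _ _ \<eta> integral_unique[OF mass] R0])
    show "\<eta> \<le> fh r" "fh r \<le> C" if "0 \<le> r" "r \<le> 1" for r using f_lo f_hi that by auto
    fix T T' L
    assume *: "radial_profile T T' L" "\<And>r. 0 \<le> r \<Longrightarrow> r \<le> 1 \<Longrightarrow> 0 \<le> T r" "\<And>r. 0 \<le> r \<Longrightarrow> r \<le> 1 \<Longrightarrow> T r \<le> R"
      "\<And>r. 0 < r \<Longrightarrow> r < 1 \<Longrightarrow> N * fh r powr (1 / N) * (1 + T r powr pp) \<le> T' r + (real N - 1) * (T r / r)"
      "((\<lambda>r. B * N * fh r * r ^ (N - 1) * T r powr pp) has_integral H R) {0..1}"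
    show thesis by (rule that[OF *])
  qed
  interpret radial_profile T T' L by (rule prof)
  let ?B = "ball (0::'a) 1"
  have [measurable]: "?B \<in> sets lebesgue" by simp
  define \<theta> where "\<theta> t = wfun \<mu> t powr \<beta>" for t
  define \<theta>' where "\<theta>' = wfun_powr_deriv \<mu> \<beta>"
  define w where "w x = wfun \<mu> (u x)" for x
  define fx where "fx x = indicator ?B x * fh (norm x)" for x
  define Tx where "Tx x = indicator ?B x * T (norm x)" for x
  have um [measurable]: "u \<in> borel_measurable lebesgue" and gm [measurable]: "g \<in> borel_measurable lebesgue"
    using W unfolding W0_def by auto
  have wfm [measurable]: "wfun \<mu> \<in> borel_measurable borel"
    by (rule borel_measurable_continuous_onI[OF wfun_continuous[OF \<mu>]])
  have wm [measurable]: "w \<in> borel_measurable lebesgue" unfolding w_def by measurable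
  have fm [measurable]: "f \<in> borel_measurable lebesgue" unfolding f_def by measurable
  have fxm [measurable]: "fx \<in> borel_measurable lebesgue"
    unfolding fx_def by (rule borel_measurable_lebesgueI[OF borel_measurable_radial[OF fc]])
  have Txm [measurable]: "Tx \<in> borel_measurable lebesgue"
    unfolding Tx_def by (rule borel_measurable_lebesgueI[OF borel_measurable_radial[OF T_cont]])
  have w0: "0 \<le> w x" and w1: "w x \<le> 1 / \<mu>" for x
    unfolding w_def using wfun_nonneg[OF \<mu>] wfun_bound[OF \<mu>] by auto
  have fx0: "\<eta> \<le> fx x" "0 < fx x" "fx x \<le> C" if "x \<in> ?B" for x
    using f_lo[of "norm x"] f_hi[of "norm x"] \<eta> that by (auto simp: fx_def)
  have Tx0: "0 \<le> Tx x" "Tx x \<le> R" for x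
    using T_ge[of "norm x"] T_le[of "norm x"] R0 by (auto simp: Tx_def indicator_def)
  have Tpp: "0 \<le> Tx x powr pp" "Tx x powr pp \<le> R powr pp" for x
    using Tx0[of x] pp1 by (auto intro: powr_mono2)
  have a01: "0 < a" "a < 1" "1 - a = 1 / N" using N2 by (auto simp: a_def field_simps)
  have f0: "0 \<le> f x" and fC: "f x \<le> \<kappa> * (1 / \<mu>) powr ps" for x
    unfolding f_def w_def[symmetric] using \<kappa> w0 w1 ps0 by (auto intro!: mult_left_mono powr_mono2)
  define c1 where "c1 = \<kappa> * (1 / \<mu>) powr ps"
  have C0: "0 < C" using fx0(2,3)[of 0] by simp
  \<comment> \<open>Because \<open>ps * a = \<beta>\<close>, the function
    \<open>\<theta> (u x)\<close> is a multiple of \<open>f x powr a\<close>. The exponent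
    \<open>a\<close> complements the \<open>1 / N\<close> of the arithmetic-geometric mean
    bound.\<close>
  have wb: "w x powr \<beta> = \<kappa> powr (- a) * f x powr a" for x
  proof -
    have "f x powr a = \<kappa> powr a * (w x powr ps) powr a" using \<kappa> w0 by (simp add: f_def w_def powr_mult)
    also have "(w x powr ps) powr a = w x powr \<beta>" unfolding powr_powr a_def ps_beta ..
    finally show ?thesis using \<kappa> by (simp add: powr_minus)
  qed
  define X where "X = (\<integral>x. indicator ?B x * (\<bar>f x powr a - fx x powr a\<bar> * fx x powr (1 / N)) \<partial>lebesgue)"
  define Y where "Y = (\<integral>x. indicator ?B x * \<bar>f x - fx x\<bar> \<partial>lebesgue)"
  have Xeq: "X = (\<integral>x. indicator ?B x * (\<bar>f x powr a - fh (norm x) powr a\<bar> * fh (norm x) powr (1 / N)) \<partial>lebesgue)"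
    unfolding X_def by (rule Bochner_Integration.integral_cong) (auto simp: fx_def indicator_def)
  have Yeq: "Y = (\<integral>x. indicator ?B x * \<bar>f x - fh (norm x)\<bar> \<partial>lebesgue)"
    unfolding Y_def by (rule Bochner_Integration.integral_cong) (auto simp: fx_def indicator_def)
  have fa: "0 \<le> f x powr a" "f x powr a \<le> c1 powr a" for x
    using f0 fC a01 by (auto simp: c1_def intro!: powr_mono2)
  have fxa: "0 \<le> fx x powr e" "fx x powr e \<le> C powr e" if "x \<in> ?B" "e \<ge> 0" for x e
    using fx0[OF that(1)] that(2) by (auto intro!: powr_mono2)
  have Xi: "integrable lebesgue (\<lambda>x. indicator ?B x * (\<bar>f x powr a - fx x powr a\<bar> * fx x powr (1 / N)))"
  proof (rule integrable_ball_bounded)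
    fix x assume x: "x \<in> ?B"
    have "\<bar>f x powr a - fx x powr a\<bar> \<le> c1 powr a + C powr a"
      using fa[of x] fxa[OF x, of a] a01 by linarith
    then show "\<bar>\<bar>f x powr a - fx x powr a\<bar> * fx x powr (1 / N)\<bar> \<le> (c1 powr a + C powr a) * C powr (1 / N)"
      unfolding abs_mult using fxa[OF x, of "1 / N"] by (intro mult_mono) auto
  qed measurable
  have Yi: "integrable lebesgue (\<lambda>x. indicator ?B x * \<bar>f x - fx x\<bar>)"
  proof (rule integrable_ball_bounded)
    fix x assume x: "x \<in> ?B"
    show "\<bar>\<bar>f x - fx x\<bar>\<bar> \<le> c1 + C" using f0[of x] fC[of x] fx0[OF x] by (simp add: c1_def)
  qed measurable
  have I1: "has_bochner_integral lebesgue (\<lambda>x. indicator ?B x * fx x) (G R)"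
  proof -
    have "has_bochner_integral lebesgue (\<lambda>x. indicator ?B x * fh (norm x)) (G R)"
    proof (rule integral_radial_continuous[OF fc])
      show "0 \<le> fh r" if "0 \<le> r" "r \<le> 1" for r using f_lo[OF that] \<eta> by linarith
      show "((\<lambda>r. measure lebesgue ?B * real DIM('a) * fh r * r ^ (DIM('a) - 1)) has_integral G R) {0..1}"
        using mass unfolding N B .
    qed
    moreover have "(\<lambda>x. indicator ?B x * fh (norm x)) = (\<lambda>x. indicator ?B x * fx x)"
      by (auto simp: fx_def indicator_def fun_eq_iff)
    ultimately show ?thesis by simp
  qed
  have I2: "has_bochner_integral lebesgue (\<lambda>x. indicator ?B x * (fx x * Tx x powr pp)) (H R)"
  proof -
    have "has_bochner_integral lebesgue (\<lambda>x. indicator ?B x * (fh (norm x) * T (norm x) powr pp)) (H R)"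
    proof (rule integral_radial_continuous)
      show "continuous_on {0..1} (\<lambda>r. fh r * T r powr pp)"
        using pp1 T_ge by (intro continuous_on_mult fc continuous_on_powr' T_cont continuous_on_const) auto
      show "0 \<le> fh r * T r powr pp" if "0 \<le> r" "r \<le> 1" for r using f_lo[OF that] \<eta> by simp
      show "((\<lambda>r. measure lebesgue ?B * real DIM('a) * (fh r * T r powr pp) * r ^ (DIM('a) - 1)) has_integral H R) {0..1}"
        using hiT unfolding N B by (simp add: mult_ac)
    qed
    moreover have "(\<lambda>x. indicator ?B x * (fh (norm x) * T (norm x) powr pp)) = (\<lambda>x. indicator ?B x * (fx x * Tx x powr pp))"
      by (auto simp: fx_def Tx_def indicator_def fun_eq_iff)
    ultimately show ?thesis by simp
  qed
  have gI: "integrable lebesgue (\<lambda>x. indicator ?B x * norm (g x) powr p)"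
    and gI1: "(\<integral>x. indicator ?B x * norm (g x) powr p \<partial>lebesgue) \<le> 1"
  proof -
    have nn: "(\<integral>\<^sup>+x. ennreal (indicator ?B x * norm (g x) powr p) \<partial>lebesgue) = lp_int p ?B g"
      unfolding lp_int_def by (rule nn_integral_cong) (auto simp: indicator_def)
    show i: "integrable lebesgue (\<lambda>x. indicator ?B x * norm (g x) powr p)"
      by (rule integrableI_nonneg) (use lp in \<open>auto simp: nn intro: le_less_trans\<close>)
    have "ennreal (\<integral>x. indicator ?B x * norm (g x) powr p \<partial>lebesgue) = lp_int p ?B g"
      using nn_integral_eq_integral[OF i] unfolding nn by auto
    then have "ennreal (\<integral>x. indicator ?B x * norm (g x) powr p \<partial>lebesgue) \<le> ennreal 1" using lp by simp
    then show "(\<integral>x. indicator ?B x * norm (g x) powr p \<partial>lebesgue) \<le> 1" by (subst (asm) ennreal_le_iff) auto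
  qed
  note div = W0_divergence[OF W less_imp_le[OF p1], of \<theta> \<theta>' "\<beta> * (1 / \<mu>) powr (\<beta> - 1)"]
  have \<theta>0: "\<theta> 0 = 0" by (simp add: \<theta>_def wfun_def)
  note div = div[OF \<theta>0 wfun_powr_has_deriv[OF \<mu> \<beta>1, folded \<theta>_def[abs_def] \<theta>'_def]
        wfun_powr_deriv_continuous[OF \<mu> \<beta>1, folded \<theta>'_def] wfun_powr_deriv_bound[OF \<mu> \<beta>1, folded \<theta>'_def]]
  have lower: "N * \<kappa> powr (- a) * (G R + H R - (1 + R powr pp) * X) \<le> (\<integral>x. \<theta> (u x) * radial_div T T' x \<partial>lebesgue)"
  proof -
    have i: "has_bochner_integral lebesgue (\<lambda>x. N * \<kappa> powr (- a) * (indicator ?B x * fx x + indicator ?B x * (fx x * Tx x powr pp)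
         - (1 + R powr pp) * (indicator ?B x * (\<bar>f x powr a - fx x powr a\<bar> * fx x powr (1 / N)))))
         (N * \<kappa> powr (- a) * (G R + H R - (1 + R powr pp) * X))"
      unfolding X_def
      by (intro has_bochner_integral_mult_right has_bochner_integral_diff has_bochner_integral_add I1 I2 has_bochner_integral_integrable Xi)
    have "AE x::'a in lebesgue. x \<noteq> 0"
      using AE_completion[OF AE_lborel_singleton[of "0::'a"]] by simp
    then have "AE x in lebesgue. N * \<kappa> powr (- a) * (indicator ?B x * fx x + indicator ?B x * (fx x * Tx x powr pp)
         - (1 + R powr pp) * (indicator ?B x * (\<bar>f x powr a - fx x powr a\<bar> * fx x powr (1 / N)))) \<le> \<theta> (u x) * radial_div T T' x"
    proof eventually_elim
      case (elim x)
      show ?case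
      proof (cases "x \<in> ?B")
        case False
        then show ?thesis by (simp add: radial_div_def)
      next
        case True
        define \<tau> where "\<tau> = Tx x powr pp"
        define fN where "fN = fx x powr (1 / N)"
        have \<tau>: "0 \<le> \<tau>" "\<tau> \<le> R powr pp" using Tpp by (auto simp: \<tau>_def)
        have fN: "0 \<le> fN" by (simp add: fN_def)
        have "a + 1 / N = 1" using a01(3) by linarith
        then have ffN: "fx x powr a * fN = fx x"
          using fx0[OF True] by (simp add: fN_def powr_add[symmetric])
        have d: "N * fN * (1 + \<tau>) \<le> radial_div T T' x"
          using amgm[of "norm x"] True elim by (simp add: radial_div_def N fN_def \<tau>_def fx_def Tx_def)
        \<comment> \<open>The map is built for \<open>fx\<close>, while
          \<open>\<theta> (u x)\<close> carries \<open>f\<close>. The exchange costs the error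
          integrated in \<open>X\<close>; after it \<open>fx powr a * fx powr (1 / N) = fx\<close>,
          so the main part integrates to mass plus moment.\<close>
        have le: "(fx x powr a - f x powr a) * fN * (1 + \<tau>) \<le> \<bar>f x powr a - fx x powr a\<bar> * fN * (1 + R powr pp)"
          using \<tau> fN by (intro mult_mono) auto
        then have "fx x + fx x * \<tau> - (1 + R powr pp) * (\<bar>f x powr a - fx x powr a\<bar> * fN) \<le> f x powr a * (fN * (1 + \<tau>))"
        proof -
          have "(fx x powr a - f x powr a) * fN * (1 + \<tau>) = (fx x powr a * fN) * (1 + \<tau>) - f x powr a * (fN * (1 + \<tau>))"
            by (simp add: left_diff_distrib)
          also have "\<dots> = fx x + fx x * \<tau> - f x powr a * (fN * (1 + \<tau>))" unfolding ffN by (simp add: distrib_left)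
          finally show ?thesis using le by (simp add: mult_ac)
        qed
        then have "N * \<kappa> powr (- a) * (fx x + fx x * \<tau> - (1 + R powr pp) * (\<bar>f x powr a - fx x powr a\<bar> * fN))
          \<le> N * \<kappa> powr (- a) * (f x powr a * (fN * (1 + \<tau>)))"
          by (intro mult_left_mono) auto
        also have "\<dots> = \<theta> (u x) * (N * fN * (1 + \<tau>))"
          using wb[of x] by (simp add: \<theta>_def w_def)
        also have "\<dots> \<le> \<theta> (u x) * radial_div T T' x"
          using d by (intro mult_left_mono) (auto simp: \<theta>_def)
        finally show ?thesis using True by (simp add: \<tau>_def fN_def)
      qed
    qed
    from integral_mono_AE[OF i[unfolded has_bochner_integral_iff, THEN conjunct1] div(1) this]
    show ?thesis unfolding has_bochner_integral_integral_eq[OF i] .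
  qed
  have upper: "- (\<integral>x. indicator ?B x * (\<theta>' (u x) * (g x \<bullet> radial_field T x)) \<partial>lebesgue) \<le>
      \<beta> * (\<sigma> powr p / p + \<sigma> powr (- pp) / pp * (inverse \<kappa> * (H R + R powr pp * Y)))"
  proof -
    let ?h = "\<lambda>x. \<beta> * (\<sigma> powr p / p * (indicator ?B x * norm (g x) powr p) + \<sigma> powr (- pp) / pp * (inverse \<kappa> *
        (indicator ?B x * (fx x * Tx x powr pp) + R powr pp * (indicator ?B x * \<bar>f x - fx x\<bar>))))"
    have i: "has_bochner_integral lebesgue ?h (\<beta> * (\<sigma> powr p / p * (\<integral>x. indicator ?B x * norm (g x) powr p \<partial>lebesgue) + \<sigma> powr (- pp) / pp * (inverse \<kappa> *
        (H R + R powr pp * Y))))"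
      unfolding Y_def
      by (intro has_bochner_integral_mult_right has_bochner_integral_add I2 has_bochner_integral_integrable Yi gI)
    have "(\<integral>x. - (indicator ?B x * (\<theta>' (u x) * (g x \<bullet> radial_field T x))) \<partial>lebesgue) \<le> (\<integral>x. ?h x \<partial>lebesgue)"
    proof (rule integral_mono)
      show "integrable lebesgue ?h" using i by (simp only: has_bochner_integral_iff)
      show "integrable lebesgue (\<lambda>x. - (indicator ?B x * (\<theta>' (u x) * (g x \<bullet> radial_field T x))))"
        using div(2) by (rule integrable_minus)
      fix x :: 'a
      show "- (indicator ?B x * (\<theta>' (u x) * (g x \<bullet> radial_field T x))) \<le> ?h x"
      proof (cases "x \<in> ?B")
        case False then show ?thesis by simp
      next
        case True
        have "norm (radial_field T x) \<le> Tx x" using norm_radial_field[of x] T_ge[of "norm x"] True by (simp add: Tx_def)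
        then have "\<bar>g x \<bullet> radial_field T x\<bar> \<le> norm (g x) * Tx x"
          by (intro order_trans[OF Cauchy_Schwarz_ineq2] mult_left_mono) auto
        moreover have "\<bar>\<theta>' (u x)\<bar> \<le> \<beta> * w x powr q"
          using abs_wfun_powr_deriv[OF \<mu> \<beta>1, of "u x"] by (simp add: \<theta>'_def w_def \<beta>_def)
        ultimately have "\<bar>\<theta>' (u x) * (g x \<bullet> radial_field T x)\<bar> \<le> (\<beta> * w x powr q) * (norm (g x) * Tx x)"
          unfolding abs_mult using \<beta>1 by (intro mult_mono) auto
        also have "\<dots> = \<beta> * (norm (g x) * (w x powr q * Tx x))" by simp
        also have "\<dots> \<le> \<beta> * (\<sigma> powr p / p * norm (g x) powr p + \<sigma> powr (- pp) / pp * (w x powr q * Tx x) powr pp)"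
          using \<beta>1 p1 pp1 inv_pp Tx0[of x] \<sigma> by (intro mult_left_mono powr_Young) auto
        \<comment> \<open>The relation \<open>q * pp = ps\<close> turns the power of
          \<open>w\<close> back into the density, and its product with \<open>Tx powr pp\<close>
          integrates to the moment up to the error \<open>Y\<close>.\<close>
        also have "(w x powr q * Tx x) powr pp = inverse \<kappa> * (f x * Tx x powr pp)"
          using Tx0[of x] \<kappa> by (simp add: powr_mult powr_powr q_pp f_def w_def)
        also have "\<beta> * (\<sigma> powr p / p * norm (g x) powr p + \<sigma> powr (- pp) / pp * (inverse \<kappa> * (f x * Tx x powr pp)))
           \<le> \<beta> * (\<sigma> powr p / p * norm (g x) powr p + \<sigma> powr (- pp) / pp * (inverse \<kappa> * (fx x * Tx x powr pp + R powr pp * \<bar>f x - fx x\<bar>)))"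
        proof -
          have "(f x - fx x) * Tx x powr pp \<le> \<bar>f x - fx x\<bar> * R powr pp"
            using Tpp[of x] by (intro mult_mono) auto
          then have "f x * Tx x powr pp \<le> fx x * Tx x powr pp + R powr pp * \<bar>f x - fx x\<bar>" by (simp add: algebra_simps)
          then show ?thesis using \<beta>1 pp1 \<kappa> by (intro mult_left_mono add_mono order.refl) auto
        qed
        finally show ?thesis using True by simp
      qed
    qed
    also have "\<dots> = \<beta> * (\<sigma> powr p / p * (\<integral>x. indicator ?B x * norm (g x) powr p \<partial>lebesgue) + \<sigma> powr (- pp) / pp * (inverse \<kappa> *
        (H R + R powr pp * Y)))" using i by (rule has_bochner_integral_integral_eq)
    also have "\<dots> \<le> \<beta> * (\<sigma> powr p / p * 1 + \<sigma> powr (- pp) / pp * (inverse \<kappa> * (H R + R powr pp * Y)))"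
      by (rule mult_left_mono[OF add_right_mono[OF mult_left_mono[OF gI1]]]) (use \<beta>1 p1 in auto)
    finally show ?thesis by simp
  qed
  show ?thesis using lower upper unfolding div(3) Xeq Yeq by linarith
qed

text \<open>The truncated density is a.e. a bounded Borel function of the radius, hence a limit of
  continuous ones. These are clamped away from 0 and infinity, renormalized to mass
  \<open>G R\<close> and fed to \<open>transport_inequality\<close>; both error integrals vanish by
  dominated convergence. Lower bounds of the densities and Lipschitz constants of the maps may
  degenerate, but they do not appear in that inequality.\<close>

lemma (in bliss) transport_limit:
  fixes u :: "'a::euclidean_space \<Rightarrow> real"
  assumes N: "N = DIM('a)" and B: "B = measure lebesgue (ball (0::'a) 1)"
    and W: "W0 p (ball 0 1) u g" and rad: "radial u" and lp: "lp_int p (ball 0 1) g \<le> 1"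
    and \<mu>: "\<mu> > 0" and \<sigma>: "\<sigma> > 0" and \<kappa>: "\<kappa> > 0" and R0: "R > 0"
    and mass: "\<kappa> * (\<integral>x. indicator (ball 0 1) x * wfun \<mu> (u x) powr ps \<partial>lebesgue) = G R"
  defines "a \<equiv> (real N - 1) / real N"
  shows "N * \<kappa> powr (- a) * (G R + H R) \<le> \<beta> * (\<sigma> powr p / p + \<sigma> powr (- pp) / pp * (inverse \<kappa> * H R))"
proof -
  let ?B = "ball (0::'a) 1"
  have [measurable]: "?B \<in> sets lebesgue" by simp
  define f where "f x = \<kappa> * wfun \<mu> (u x) powr ps" for x
  have um [measurable]: "u \<in> borel_measurable lebesgue" using W unfolding W0_def by auto
  have wfm [measurable]: "wfun \<mu> \<in> borel_measurable borel"
    by (rule borel_measurable_continuous_onI[OF wfun_continuous[OF \<mu>]])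
  have fm [measurable]: "f \<in> borel_measurable lebesgue" unfolding f_def by measurable
  define c1 where "c1 = \<kappa> * (1 / \<mu>) powr ps"
  have f0: "0 \<le> f x" and fC: "f x \<le> c1" for x
    unfolding f_def c1_def using \<kappa> wfun_nonneg[OF \<mu>] wfun_bound[OF \<mu>] ps0
    by (auto intro!: mult_left_mono powr_mono2)
  have c10: "0 \<le> c1" using order_trans[OF f0 fC] .
  obtain v0 where v0: "\<And>x. u x = v0 (norm x)" using rad unfolding radial_def by blast
  obtain v where vm: "v \<in> borel_measurable borel" and v_0: "\<And>r. 0 \<le> v r" and v_1: "\<And>r. v r \<le> c1"
    and fv: "AE x in lebesgue. f x = v (norm x)"
    by (rule radial_borel_representative[OF fm _ f0 fC, of "\<lambda>r. \<kappa> * wfun \<mu> (v0 r) powr ps"]) (auto simp: f_def v0)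
  have "v measurable_on UNIV"
    using measurable_on_iff_borel_measurable[of UNIV v] borel_measurable_lebesgueI[OF vm] by simp
  then obtain Z gj where Z: "negligible Z" and gjc: "\<And>j. continuous_on UNIV (gj j)"
    and gjl: "\<And>r. r \<notin> Z \<Longrightarrow> (\<lambda>j. gj j r) \<longlonglongrightarrow> v r"
    unfolding measurable_on_def by auto
  \<comment> \<open>Clamping between \<open>1 / (j + 1)\<close> and \<open>c1\<close> gives
    positivity and a uniform bound. The limit survives because \<open>v\<close> takes values in
    \<open>[0, c1]\<close>.\<close>
  define c where "c j r = max (inverse (real (Suc j))) (min c1 (gj j r))" for j r
  have Fp_coeff: "continuous_on {0..1} (c j)" for j
    unfolding c_def by (intro continuous_intros continuous_on_subset[OF gjc]) auto
  have c_lo: "inverse (real (Suc j)) \<le> c j r" and c_pos: "0 < c j r" and c_hi: "c j r \<le> c1 + 1" for j r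
  proof -
    have "inverse (real (Suc j)) \<le> 1" by (simp add: field_simps)
    then show "c j r \<le> c1 + 1" using c10 by (auto simp: c_def)
    show "inverse (real (Suc j)) \<le> c j r" by (simp add: c_def)
    moreover have "0 < inverse (real (Suc j))" by simp
    ultimately show "0 < c j r" by linarith
  qed
  have c_lim: "(\<lambda>j. c j r) \<longlonglongrightarrow> v r" if "r \<notin> Z" for r
  proof -
    have "(\<lambda>j. c j r) \<longlonglongrightarrow> max 0 (min c1 (v r))"
      unfolding c_def by (intro tendsto_max tendsto_min tendsto_const gjl that LIMSEQ_inverse_real_of_nat)
    moreover have "max 0 (min c1 (v r)) = v r" using v_0[of r] v_1[of r] by (simp add: min_absorb2 max_absorb2)
    ultimately show ?thesis by simp
  qed
  define ms where "ms j = integral {0..1} (\<lambda>r. B * N * c j r * r ^ (N - 1))" for j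
  have ms: "((\<lambda>r. B * N * c j r * r ^ (N - 1)) has_integral ms j) {0..1}" for j
    unfolding ms_def by (intro integrable_integral integrable_continuous_real continuous_intros Fp_coeff)
  have msb: "has_bochner_integral lebesgue (\<lambda>x. indicator ?B x * c j (norm x)) (ms j)" for j
    by (rule integral_radial_continuous[OF Fp_coeff]) (use ms[of j] c_pos in \<open>auto simp: N B less_imp_le\<close>)
  have AEc: "AE x in lebesgue. x \<in> ?B \<longrightarrow> (\<lambda>j. c j (norm x)) \<longlonglongrightarrow> f x"
    using fv AE_norm_notin_negligible[OF Z, where 'a='a] by eventually_elim (auto intro: c_lim)
  have ball_int: "integrable lebesgue (\<lambda>x. indicator ?B x * (K::real))" for K
    using integrable_ball_bounded[of "\<lambda>_. K" "\<bar>K\<bar>"] by simp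
  have "(\<lambda>j. \<integral>x. indicator ?B x * c j (norm x) \<partial>lebesgue) \<longlonglongrightarrow> (\<integral>x. indicator ?B x * f x \<partial>lebesgue)"
  proof (rule integral_dominated_convergence[where w="\<lambda>x. indicator ?B x * (c1 + 1)"])
    show "(\<lambda>x. indicator ?B x * f x) \<in> borel_measurable lebesgue" by measurable
    show "(\<lambda>x. indicator ?B x * c j (norm x)) \<in> borel_measurable lebesgue" for j
      by (rule borel_measurable_lebesgueI[OF borel_measurable_radial[OF Fp_coeff]])
    show "integrable lebesgue (\<lambda>x. indicator ?B x * (c1 + 1))" by (rule ball_int)
    show "AE x in lebesgue. (\<lambda>j. indicator ?B x * c j (norm x)) \<longlonglongrightarrow> indicator ?B x * f x"
      using AEc by eventually_elim (auto simp: indicator_def)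
    show "AE x in lebesgue. norm (indicator ?B x * c j (norm x)) \<le> indicator ?B x * (c1 + 1)" for j
    proof (rule AE_I2)
      fix x :: 'a
      have "\<bar>c j (norm x)\<bar> \<le> c1 + 1" using c_hi[of j "norm x"] c_pos[of j "norm x"] by linarith
      then show "norm (indicator ?B x * c j (norm x)) \<le> indicator ?B x * (c1 + 1)"
        by (auto simp: indicator_def)
    qed
  qed
  moreover have "(\<integral>x. indicator ?B x * f x \<partial>lebesgue) = G R"
    unfolding f_def mass[symmetric] by (subst integral_mult_right_zero[symmetric]) (simp add: mult_ac)
  ultimately have ms_lim: "ms \<longlonglongrightarrow> G R"
    using has_bochner_integral_integral_eq[OF msb] by simp
  have GR0: "G R > 0" using G_strict_mono[of 0 R] R0 G_0 by simp
  have "\<forall>\<^sub>F j in sequentially. G R / 2 < ms j" using order_tendstoD(1)[OF ms_lim, of "G R / 2"] GR0 by simp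
  \<comment> \<open>From this index on the masses exceed half of \<open>G R\<close>, so the
    normalizing factors are at most 2 and the rescaled densities keep a common bound.\<close>
  then obtain J where J: "\<And>j. j \<ge> J \<Longrightarrow> G R / 2 < ms j" unfolding eventually_sequentially by blast
  define s where "s j = G R / ms (j + J)" for j
  have msJ: "ms (j + J) > 0" "G R / 2 < ms (j + J)" for j using J[of "j + J"] GR0 by auto
  have s0: "s j > 0" "s j \<le> 2" for j using msJ[of j] GR0 by (auto simp: s_def divide_le_eq)
  have s_lim: "s \<longlonglongrightarrow> 1"
  proof -
    have "(\<lambda>j. G R / ms (j + J)) \<longlonglongrightarrow> G R / G R"
      using GR0 by (intro tendsto_divide tendsto_const LIMSEQ_ignore_initial_segment ms_lim) auto
    then show ?thesis using GR0 by (simp add: s_def[abs_def])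
  qed
  define fh where "fh j r = s j * c (j + J) r" for j r
  define C where "C = 2 * (c1 + 1)"
  have fhc: "continuous_on {0..1} (fh j)" for j unfolding fh_def by (intro continuous_intros Fp_coeff)
  have fh_lo: "s j * inverse (real (Suc (j + J))) \<le> fh j r" for j r
    unfolding fh_def using s0[of j] by (intro mult_left_mono c_lo) auto
  have fh_hi: "fh j r \<le> C" for j r
    unfolding fh_def C_def using s0[of j] c_hi c_pos[of "j + J" r] by (intro mult_mono) auto
  have fh_pos: "0 < fh j r" for j r unfolding fh_def using s0 c_pos by simp
  have fh_mass: "((\<lambda>r. B * N * fh j r * r ^ (N - 1)) has_integral G R) {0..1}" for j
  proof -
    have "((\<lambda>r. s j * (B * N * c (j + J) r * r ^ (N - 1))) has_integral s j * ms (j + J)) {0..1}"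
      by (rule has_integral_mult_right[OF ms])
    moreover have "s j * ms (j + J) = G R" using msJ[of j] by (simp add: s_def)
    ultimately show ?thesis by (simp add: fh_def mult_ac)
  qed
  define fx where "fx j x = indicator ?B x * fh j (norm x)" for j x
  have fxm [measurable]: "fx j \<in> borel_measurable lebesgue" for j
    unfolding fx_def by (rule borel_measurable_lebesgueI[OF borel_measurable_radial[OF fhc]])
  have AEf: "AE x in lebesgue. x \<in> ?B \<longrightarrow> (\<lambda>j. fx j x) \<longlonglongrightarrow> f x"
    using AEc
  proof eventually_elim
    case (elim x)
    show ?case
    proof
      assume x: "x \<in> ?B"
      then have "(\<lambda>j. c (j + J) (norm x)) \<longlonglongrightarrow> f x" using elim by (intro LIMSEQ_ignore_initial_segment) auto
      then have "(\<lambda>j. s j * c (j + J) (norm x)) \<longlonglongrightarrow> 1 * f x" by (intro tendsto_mult s_lim)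
      then show "(\<lambda>j. fx j x) \<longlonglongrightarrow> f x" using x by (simp add: fx_def fh_def)
    qed
  qed
  have a01: "0 < a" using N2 by (auto simp: a_def field_simps)
  have C0: "0 < C" using c10 by (simp add: C_def)
  define X where "X j = (\<integral>x. indicator ?B x * (\<bar>f x powr a - fx j x powr a\<bar> * fx j x powr (1 / N)) \<partial>lebesgue)" for j
  define Y where "Y j = (\<integral>x. indicator ?B x * \<bar>f x - fx j x\<bar> \<partial>lebesgue)" for j
  have fxb: "0 \<le> fx j x" "fx j x \<le> C" for j x
    using fh_pos[of j "norm x"] fh_hi[of j "norm x"] C0 by (auto simp: fx_def indicator_def)
  have "X \<longlonglongrightarrow> (\<integral>x. 0 \<partial>(lebesgue :: 'a measure))"
    unfolding X_def
  proof (rule integral_dominated_convergence[where w="\<lambda>x. indicator ?B x * ((c1 powr a + C powr a) * C powr (1 / N))"])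
    show "(\<lambda>x. indicator ?B x * (\<bar>f x powr a - fx j x powr a\<bar> * fx j x powr (1 / N))) \<in> borel_measurable lebesgue" for j
      by measurable
    show "integrable lebesgue (\<lambda>x. indicator ?B x * ((c1 powr a + C powr a) * C powr (1 / N)))" by (rule ball_int)
    show "AE x in lebesgue. (\<lambda>j. indicator ?B x * (\<bar>f x powr a - fx j x powr a\<bar> * fx j x powr (1 / N))) \<longlonglongrightarrow> 0"
      using AEf
    proof eventually_elim
      case (elim x)
      show ?case
      proof (cases "x \<in> ?B")
        case True
        then have l: "(\<lambda>j. fx j x) \<longlonglongrightarrow> f x" using elim by blast
        have p: "(\<lambda>j. fx j x powr e) \<longlonglongrightarrow> f x powr e" if "e > 0" for e
          by (rule tendsto_powr'[OF l tendsto_const]) (use fxb that in auto)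
        have "(\<lambda>j. indicator ?B x * (\<bar>f x powr a - fx j x powr a\<bar> * fx j x powr (1 / N)))
           \<longlonglongrightarrow> indicator ?B x * (\<bar>f x powr a - f x powr a\<bar> * f x powr (1 / N))"
          by (intro tendsto_intros p) (use a01 N2 in auto)
        then show ?thesis by simp
      qed simp
    qed
    show "AE x in lebesgue. norm (indicator ?B x * (\<bar>f x powr a - fx j x powr a\<bar> * fx j x powr (1 / N))) \<le> indicator ?B x * ((c1 powr a + C powr a) * C powr (1 / N))" for j
    proof (rule AE_I2)
      fix x :: 'a
      have "f x powr a \<le> c1 powr a" "fx j x powr a \<le> C powr a" "fx j x powr (1 / N) \<le> C powr (1 / N)"
        using f0 fC fxb a01 by (auto intro!: powr_mono2)
      then have "\<bar>f x powr a - fx j x powr a\<bar> * fx j x powr (1 / N) \<le> (c1 powr a + C powr a) * C powr (1 / N)"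
      proof (intro mult_mono)
        have "0 \<le> f x powr a" "0 \<le> fx j x powr a" by auto
        then show "\<bar>f x powr a - fx j x powr a\<bar> \<le> c1 powr a + C powr a"
          using \<open>f x powr a \<le> c1 powr a\<close> \<open>fx j x powr a \<le> C powr a\<close> by linarith
      qed (use \<open>fx j x powr (1 / N) \<le> C powr (1 / N)\<close> in auto)
      then show "norm (indicator ?B x * (\<bar>f x powr a - fx j x powr a\<bar> * fx j x powr (1 / N))) \<le> indicator ?B x * ((c1 powr a + C powr a) * C powr (1 / N))"
        by (auto simp: indicator_def abs_mult)
    qed
  qed simp
  then have X: "X \<longlonglongrightarrow> 0" by simp
  have "Y \<longlonglongrightarrow> (\<integral>x. 0 \<partial>(lebesgue :: 'a measure))"
    unfolding Y_def
  proof (rule integral_dominated_convergence[where w="\<lambda>x. indicator ?B x * (c1 + C)"])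
    show "(\<lambda>x. indicator ?B x * \<bar>f x - fx j x\<bar>) \<in> borel_measurable lebesgue" for j
      by measurable
    show "integrable lebesgue (\<lambda>x. indicator ?B x * (c1 + C))" by (rule ball_int)
    show "AE x in lebesgue. (\<lambda>j. indicator ?B x * \<bar>f x - fx j x\<bar>) \<longlonglongrightarrow> 0"
      using AEf
    proof eventually_elim
      case (elim x)
      show ?case
      proof (cases "x \<in> ?B")
        case True
        then have l: "(\<lambda>j. fx j x) \<longlonglongrightarrow> f x" using elim by blast
        have "(\<lambda>j. indicator ?B x * \<bar>f x - fx j x\<bar>) \<longlonglongrightarrow> indicator ?B x * \<bar>f x - f x\<bar>"
          by (intro tendsto_intros l)
        then show ?thesis by simp
      qed simp
    qed
    show "AE x in lebesgue. norm (indicator ?B x * \<bar>f x - fx j x\<bar>) \<le> indicator ?B x * (c1 + C)" for j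
    proof (rule AE_I2)
      fix x :: 'a
      have "\<bar>f x - fx j x\<bar> \<le> c1 + C" using f0[of x] fC[of x] fxb[of j x] by linarith
      then show "norm (indicator ?B x * \<bar>f x - fx j x\<bar>) \<le> indicator ?B x * (c1 + C)"
        by (auto simp: indicator_def)
    qed
  qed simp
  then have Y: "Y \<longlonglongrightarrow> 0" by simp
  have ineq: "N * \<kappa> powr (- a) * (G R + H R - (1 + R powr pp) * X j)
     \<le> \<beta> * (\<sigma> powr p / p + \<sigma> powr (- pp) / pp * (inverse \<kappa> * (H R + R powr pp * Y j)))" for j
  proof -
    have pos: "s j * inverse (real (Suc (j + J))) > 0" using s0 by simp
    have Xeq: "X j = (\<integral>x. indicator ?B x * (\<bar>f x powr a - fh j (norm x) powr a\<bar> * fh j (norm x) powr (1 / N)) \<partial>lebesgue)"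
      unfolding X_def by (rule Bochner_Integration.integral_cong) (auto simp: fx_def indicator_def)
    have Yeq: "Y j = (\<integral>x. indicator ?B x * \<bar>f x - fh j (norm x)\<bar> \<partial>lebesgue)"
      unfolding Y_def by (rule Bochner_Integration.integral_cong) (auto simp: fx_def indicator_def)
    show ?thesis
      unfolding Xeq Yeq f_def a_def
      by (rule transport_inequality[OF N B W lp \<mu> \<sigma> \<kappa> fhc fh_lo fh_hi pos fh_mass R0])
  qed
  have "(\<lambda>j. N * \<kappa> powr (- a) * (G R + H R - (1 + R powr pp) * X j)) \<longlonglongrightarrow> N * \<kappa> powr (- a) * (G R + H R - (1 + R powr pp) * 0)"
    by (intro tendsto_intros X)
  moreover have "(\<lambda>j. \<beta> * (\<sigma> powr p / p + \<sigma> powr (- pp) / pp * (inverse \<kappa> * (H R + R powr pp * Y j)))) \<longlonglongrightarrow>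
      \<beta> * (\<sigma> powr p / p + \<sigma> powr (- pp) / pp * (inverse \<kappa> * (H R + R powr pp * 0)))"
    by (intro tendsto_intros Y)
  ultimately have "N * \<kappa> powr (- a) * (G R + H R - (1 + R powr pp) * 0) \<le> \<beta> * (\<sigma> powr p / p + \<sigma> powr (- pp) / pp * (inverse \<kappa> * (H R + R powr pp * 0)))"
    by (rule LIMSEQ_le) (use ineq in blast)
  then show ?thesis by simp
qed

text \<open>The best constant of the radial Sobolev inequality, for gradients of norm at most 1.\<close>

definition (in bliss) K where "K = (q powr (1 / pp) / (N * M powr (1 / N))) powr ps"

text \<open>Three choices turn \<open>transport_limit\<close> into the inequality:
  \<open>\<kappa> = G R / I\<close> matches the masses, \<open>\<sigma>\<close> balances Young's
  inequality, and \<open>R\<close> tends to infinity. The powers of \<open>I\<close> on the two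
  sides then differ by exactly \<open>1 / ps\<close>.\<close>

lemma (in bliss) radial_inequality_truncated:
  fixes u :: "'a::euclidean_space \<Rightarrow> real"
  assumes N: "N = DIM('a)" and B: "B = measure lebesgue (ball (0::'a) 1)"
    and W: "W0 p (ball 0 1) u g" and rad: "radial u" and lp: "lp_int p (ball 0 1) g \<le> 1"
    and \<mu>: "\<mu> > 0"
  shows "(\<integral>x. indicator (ball 0 1) x * wfun \<mu> (u x) powr ps \<partial>lebesgue) \<le> K"
proof -
  define I where "I = (\<integral>x. indicator (ball 0 1) x * wfun \<mu> (u x) powr ps \<partial>lebesgue)"
  have "I \<ge> 0" unfolding I_def by (rule Bochner_Integration.integral_nonneg) simp
  then consider "I = 0" | "I > 0" by linarith
  then show ?thesis
  proof cases
    case 1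
    then show ?thesis by (simp add: I_def[symmetric] K_def)
  next
    case 2
    define a where "a = (real N - 1) / real N"
    have step: "N * (I / G R) powr a * (\<beta> * G R - q * \<rho> R) \<le> \<beta> * (q * I) powr (1 / pp)" if R: "R > 0" for R
    proof -
      have m: "G R > 0" using G_strict_mono[of 0 R] R G_0 by simp
      define \<kappa> where "\<kappa> = G R / I"
      have \<kappa>: "\<kappa> > 0" "\<kappa> * I = G R" using m 2 by (auto simp: \<kappa>_def)
      define E where "E = H R / \<kappa>"
      have E: "E > 0" using H_pos[OF R] \<kappa> by (simp add: E_def)
      \<comment> \<open>With this choice both terms of Young's inequality are multiples of
        \<open>E powr (1 / pp)\<close>, and their coefficients \<open>1 / p\<close> and
        \<open>1 / pp\<close> add up to 1.\<close>
      define \<sigma> where "\<sigma> = E powr (1 / (p * pp))"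
      have \<sigma>: "\<sigma> > 0" using E by (simp add: \<sigma>_def)
      have l1: "\<sigma> powr p = E powr (1 / pp)" using p1 pp1 by (simp add: \<sigma>_def powr_powr)
      have l2: "\<sigma> powr (- pp) * E = E powr (1 / pp)"
      proof -
        have "\<sigma> powr (- pp) = E powr (- (1 / p))" using p1 pp1 by (simp add: \<sigma>_def powr_powr)
        then have "\<sigma> powr (- pp) * E = E powr (- (1 / p)) * E powr 1" using E by simp
        also have "\<dots> = E powr (1 / pp)" unfolding powr_add[symmetric] inv_pp by simp
        finally show ?thesis .
      qed
      have "N * \<kappa> powr (- a) * (G R + H R) \<le> \<beta> * (\<sigma> powr p / p + \<sigma> powr (- pp) / pp * (inverse \<kappa> * H R))"
        unfolding a_def by (rule transport_limit[OF N B W rad lp \<mu> \<sigma> \<kappa>(1) R]) (use \<kappa>(2) in \<open>simp add: I_def\<close>)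
      also have "inverse \<kappa> * H R = E" by (simp add: E_def divide_inverse)
      also have "\<sigma> powr p / p + \<sigma> powr (- pp) / pp * E = E powr (1 / pp) * (1 / p + 1 / pp)"
        using l1 l2 by (simp add: distrib_left)
      also have "1 / p + 1 / pp = 1" using inv_pp by simp
      also have "E powr (1 / pp) \<le> (q * I) powr (1 / pp)"
      proof (rule powr_mono2)
        have "H R \<le> q * G R" using \<rho>_nonneg[of R] R q0 by (simp add: H_def)
        then show "E \<le> q * I" unfolding E_def \<kappa>_def using m 2 by (simp add: field_simps)
      qed (use E pp1 in auto)
      finally have *: "N * \<kappa> powr (- a) * (G R + H R) \<le> \<beta> * (q * I) powr (1 / pp)" using \<beta>1 by simp
      have "\<kappa> powr (- a) = (I / G R) powr a" using m 2 by (simp add: \<kappa>_def powr_minus powr_divide)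
      moreover have "G R + H R = \<beta> * G R - q * \<rho> R" by (simp add: H_def \<beta>_def algebra_simps)
      ultimately show ?thesis using * by simp
    qed
    \<comment> \<open>The boundary term disappears at infinity, the bracket becomes
      \<open>\<beta> * M\<close>, and \<open>\<beta>\<close> cancels against the factor on the
      right.\<close>
    have "((\<lambda>R. N * (I / G R) powr a * (\<beta> * G R - q * \<rho> R)) \<longlongrightarrow> N * (I / M) powr a * (\<beta> * M - q * 0)) at_top"
      using M_pos 2 by (intro tendsto_intros G_lim \<rho>_lim) auto
    then have "N * (I / M) powr a * (\<beta> * M - q * 0) \<le> \<beta> * (q * I) powr (1 / pp)"
      by (rule tendsto_upperbound) (use step in \<open>auto intro: eventually_mono[OF eventually_gt_at_top[of 0]]\<close>)
    then have "\<beta> * (N * (I / M) powr a * M) \<le> \<beta> * (q * I) powr (1 / pp)" by (simp add: mult_ac)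
    then have "N * (I / M) powr a * M \<le> (q * I) powr (1 / pp)" using \<beta>1 by simp
    moreover have "(I / M) powr a * M = I powr a * M powr (1 / N)"
    proof -
      have "(I / M) powr a * M = I powr a * (M powr (- a) * M powr 1)"
      proof -
        have "(I / M) powr a = I powr a / M powr a" using M_pos 2 by (simp add: powr_divide)
        then show ?thesis using M_pos by (simp add: powr_minus divide_inverse)
      qed
      also have "M powr (- a) * M powr 1 = M powr (1 / N)"
        unfolding powr_add[symmetric] a_def using N2 by (simp add: field_simps)
      finally show ?thesis .
    qed
    moreover have "(q * I) powr (1 / pp) = q powr (1 / pp) * I powr (1 / pp)" using q0 2 by (simp add: powr_mult)
    ultimately have "I powr a * (N * M powr (1 / N)) \<le> I powr (1 / pp) * q powr (1 / pp)" by (simp add: mult_ac)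
    moreover have "I powr a = I powr (1 / pp) * I powr (1 / ps)"
      unfolding powr_add[symmetric] inv_ps[symmetric] a_def by simp
    ultimately have "I powr (1 / pp) * (I powr (1 / ps) * (N * M powr (1 / N))) \<le> I powr (1 / pp) * q powr (1 / pp)"
      by (simp add: mult.assoc)
    then have "I powr (1 / ps) * (N * M powr (1 / N)) \<le> q powr (1 / pp)"
      using 2 by (subst (asm) mult_le_cancel_left_pos) auto
    then have "I powr (1 / ps) \<le> q powr (1 / pp) / (N * M powr (1 / N))"
      using N2 M_pos by (subst pos_le_divide_eq) auto
    then have "(I powr (1 / ps)) powr ps \<le> K" unfolding K_def by (rule powr_mono2[rotated 2]) (use ps0 in auto)
    then show ?thesis using 2 ps0 by (simp add: powr_powr I_def[symmetric])
  qed
qed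

text \<open>Fatou's lemma along \<open>\<mu> n\<close> tending to 0; the integrability of
  \<open>|u|\<close> to the critical power is obtained here rather than presupposed.\<close>

lemma (in bliss) radial_inequality:
  fixes u :: "'a::euclidean_space \<Rightarrow> real"
  assumes N: "N = DIM('a)" and B: "B = measure lebesgue (ball (0::'a) 1)"
    and W: "W0 p (ball 0 1) u g" and rad: "radial u" and lp: "lp_int p (ball 0 1) g \<le> 1"
  shows "(\<integral>\<^sup>+x\<in>ball 0 1. ennreal (\<bar>u x\<bar> powr ps) \<partial>lebesgue) \<le> ennreal K"
proof -
  let ?B = "ball (0::'a) 1"
  have [measurable]: "?B \<in> sets lebesgue" by simp
  have um [measurable]: "u \<in> borel_measurable lebesgue" using W unfolding W0_def by auto
  define \<mu> where "\<mu> n = inverse (real (Suc n))" for n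
  have \<mu>: "\<mu> n > 0" for n by (simp add: \<mu>_def)
  have wfm [measurable]: "wfun (\<mu> n) \<in> borel_measurable borel" for n
    by (rule borel_measurable_continuous_onI[OF wfun_continuous[OF \<mu>]])
  have each: "(\<integral>\<^sup>+x. ennreal (indicator ?B x * wfun (\<mu> n) (u x) powr ps) \<partial>lebesgue) \<le> ennreal K" for n
  proof -
    have "integrable lebesgue (\<lambda>x. indicator ?B x * wfun (\<mu> n) (u x) powr ps)"
    proof (rule integrable_ball_bounded)
      show "\<bar>wfun (\<mu> n) (u x) powr ps\<bar> \<le> (1 / \<mu> n) powr ps" for x
        using wfun_nonneg[OF \<mu>] wfun_bound[OF \<mu>] ps0 by (auto intro!: powr_mono2)
    qed measurable
    then have "(\<integral>\<^sup>+x. ennreal (indicator ?B x * wfun (\<mu> n) (u x) powr ps) \<partial>lebesgue) =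
      ennreal (\<integral>x. indicator ?B x * wfun (\<mu> n) (u x) powr ps \<partial>lebesgue)"
      by (intro nn_integral_eq_integral) auto
    then show ?thesis using radial_inequality_truncated[OF N B W rad lp \<mu>[of n]] by (simp add: ennreal_leI)
  qed
  have lim: "(\<lambda>n. ennreal (indicator ?B x * wfun (\<mu> n) (u x) powr ps)) \<longlonglongrightarrow> ennreal (\<bar>u x\<bar> powr ps) * indicator ?B x" for x
  proof -
    have "(\<lambda>n. wfun (\<mu> n) (u x)) \<longlonglongrightarrow> \<bar>u x\<bar> / (1 + 0 * \<bar>u x\<bar>)"
      unfolding wfun_def \<mu>_def by (intro tendsto_intros LIMSEQ_inverse_real_of_nat) auto
    then have "(\<lambda>n. wfun (\<mu> n) (u x) powr ps) \<longlonglongrightarrow> \<bar>u x\<bar> powr ps"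
      using ps0 wfun_nonneg[OF \<mu>] by (intro tendsto_powr') auto
    then have "(\<lambda>n. ennreal (indicator ?B x * wfun (\<mu> n) (u x) powr ps)) \<longlonglongrightarrow> ennreal (indicator ?B x * \<bar>u x\<bar> powr ps)"
      by (intro tendsto_ennrealI tendsto_mult tendsto_const)
    moreover have "ennreal (indicator ?B x * \<bar>u x\<bar> powr ps) = ennreal (\<bar>u x\<bar> powr ps) * indicator ?B x"
      by (auto simp: indicator_def)
    ultimately show ?thesis by simp
  qed
  have "(\<integral>\<^sup>+x\<in>?B. ennreal (\<bar>u x\<bar> powr ps) \<partial>lebesgue) = (\<integral>\<^sup>+x. liminf (\<lambda>n. ennreal (indicator ?B x * wfun (\<mu> n) (u x) powr ps)) \<partial>lebesgue)"
    using lim_imp_Liminf[OF _ lim] by (intro nn_integral_cong) simp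
  also have "\<dots> \<le> liminf (\<lambda>n. \<integral>\<^sup>+x. ennreal (indicator ?B x * wfun (\<mu> n) (u x) powr ps) \<partial>lebesgue)"
    by (rule nn_integral_liminf) measurable
  also have "\<dots> \<le> liminf (\<lambda>n::nat. ennreal K)" using each by (intro Liminf_mono) auto
  also have "\<dots> = ennreal K" by (simp add: Liminf_const)
  finally show ?thesis .
qed

subsection \<open>The upper bound for concentrating sequences\<close>

text \<open>Finiteness has to be assumed: \<open>enn2real\<close> sends infinity to 0, so an
  infinite integral would have \<open>lp_norm\<close> equal to 0.\<close>

lemma lp_norm_le_1_imp:
  assumes "lp_norm p A f \<le> 1" "lp_int p A f < \<infinity>" "p > 0"
  shows "lp_int p A f \<le> 1"
proof (rule ccontr)
  assume "\<not> lp_int p A f \<le> 1"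
  then have "1 < enn2real (lp_int p A f)"
  proof -
    have "ennreal 1 < lp_int p A f" using \<open>\<not> lp_int p A f \<le> 1\<close> by simp
    also have "lp_int p A f = ennreal (enn2real (lp_int p A f))" using assms(2) by simp
    finally show ?thesis by (subst (asm) ennreal_less_iff) auto
  qed
  then have "1 powr (1 / p) < enn2real (lp_int p A f) powr (1 / p)"
    using assms(3) by (intro powr_less_mono2) auto
  then show False using assms(1) by (simp add: lp_norm_def)
qed

text \<open>The energy inside the small ball tends to 1, the total is at most 1, and the integral is
  additive over the two regions.\<close>

lemma lp_int_outside_tendsto_0:
  fixes g :: "nat \<Rightarrow> 'a::euclidean_space \<Rightarrow> 'a"
  assumes p: "p > 0" and gm: "\<And>n. g n \<in> borel_measurable lebesgue"
    and le: "\<And>n. lp_int p (ball 0 1) (g n) \<le> 1"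
    and lim: "(\<lambda>n. lp_norm p (ball 0 \<epsilon> \<inter> ball 0 1) (g n)) \<longlonglongrightarrow> 1"
  shows "(\<lambda>n. lp_int p (ball 0 1 - ball 0 \<epsilon>) (g n)) \<longlonglongrightarrow> 0"
proof -
  let ?A = "\<lambda>n. lp_int p (ball 0 \<epsilon> \<inter> ball 0 1) (g n)"
  let ?D = "\<lambda>n. lp_int p (ball 0 1 - ball 0 \<epsilon>) (g n)"
  have [measurable]: "ball (0::'a) r \<in> sets lebesgue" for r by simp
  have sum: "?A n + ?D n \<le> 1" for n
  proof -
    have "?A n + ?D n = lp_int p (ball 0 1) (g n)"
    proof -
      have gn [measurable]: "g n \<in> borel_measurable lebesgue" by (rule gm)
      have "?A n + ?D n = (\<integral>\<^sup>+x. ennreal (norm (g n x) powr p) * indicator (ball 0 \<epsilon> \<inter> ball 0 1) x +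
          ennreal (norm (g n x) powr p) * indicator (ball 0 1 - ball 0 \<epsilon>) x \<partial>lebesgue)"
        unfolding lp_int_def by (rule nn_integral_add[symmetric]) measurable
      also have "\<dots> = lp_int p (ball 0 1) (g n)"
        unfolding lp_int_def by (rule nn_integral_cong) (simp add: indicator_def)
      finally show ?thesis .
    qed
    then show ?thesis using le[of n] by simp
  qed
  have fin: "?A n < top" "?D n < top" for n
    using sum[of n] by (auto simp: less_top[symmetric] top_unique)
  have "(\<lambda>n. (enn2real (?A n) powr (1 / p)) powr p) \<longlonglongrightarrow> 1 powr p"
    using lim unfolding lp_norm_def by (intro tendsto_powr tendsto_const) auto
  then have A: "(\<lambda>n. enn2real (?A n)) \<longlonglongrightarrow> 1" using p by (simp add: powr_powr)
  have D: "enn2real (?D n) \<le> 1 - enn2real (?A n)" for n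
  proof -
    have "ennreal (enn2real (?A n) + enn2real (?D n)) \<le> ennreal 1"
      using sum[of n] fin[of n] by (simp add: ennreal_plus)
    then show ?thesis by (subst (asm) ennreal_le_iff) auto
  qed
  have "(\<lambda>n. 1 - enn2real (?A n)) \<longlonglongrightarrow> 1 - 1" by (intro tendsto_intros A)
  then have L: "(\<lambda>n. 1 - enn2real (?A n)) \<longlonglongrightarrow> 0" by simp
  have "(\<lambda>n. enn2real (?D n)) \<longlonglongrightarrow> 0"
    by (rule tendsto_sandwich[OF always_eventually always_eventually tendsto_const L]) (use D in auto)
  from tendsto_ennrealI[OF this] show ?thesis using fin by simp
qed

lemma radial_profile_id: "radial_profile (\<lambda>r. r) (\<lambda>r. 1) 1"
  by unfold_locales (auto intro!: derivative_eq_intros)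

text \<open>The field \<open>T(r) = r\<close> has constant divergence and is small where the gradient concentrates.\<close>

lemma concentrating_imp_wfun_tendsto_0:
  fixes u :: "nat \<Rightarrow> 'a::euclidean_space \<Rightarrow> real" and g :: "nat \<Rightarrow> 'a \<Rightarrow> 'a"
  assumes W: "\<And>n. W0 p (ball 0 1) (u n) (g n)" and p: "p > 1" and b: "b > 1"
    and le: "\<And>n. lp_int p (ball 0 1) (g n) \<le> 1"
    and lim: "\<And>\<epsilon>. \<epsilon> > 0 \<Longrightarrow> (\<lambda>n. lp_norm p (ball 0 \<epsilon> \<inter> ball 0 1) (g n)) \<longlonglongrightarrow> 1"
  shows "(\<lambda>n. \<integral>\<^sup>+x\<in>ball 0 1. ennreal (wfun 1 (u n x) powr b) \<partial>lebesgue) \<longlonglongrightarrow> 0"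
proof -
  let ?B = "ball (0::'a) 1"
  let ?I = "\<lambda>n. \<integral>\<^sup>+x\<in>?B. ennreal (wfun 1 (u n x) powr b) \<partial>lebesgue"
  have [measurable]: "ball (0::'a) r \<in> sets lebesgue" for r by simp
  have um [measurable]: "u n \<in> borel_measurable lebesgue" and gm [measurable]: "g n \<in> borel_measurable lebesgue" for n
    using W[of n] unfolding W0_def by auto
  interpret radial_profile "\<lambda>r. r" "\<lambda>r. 1" 1 by (rule radial_profile_id)
  define \<theta> where "\<theta> t = wfun 1 t powr b" for t
  define \<theta>' where "\<theta>' = wfun_powr_deriv 1 b"
  have \<theta>0: "\<theta> 0 = 0" by (simp add: \<theta>_def wfun_def)
  have \<theta>'b: "\<bar>\<theta>' t\<bar> \<le> b" for t using wfun_powr_deriv_bound[of 1 b t] b by (simp add: \<theta>'_def)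
  note div = W0_divergence[OF W less_imp_le[OF p] \<theta>0 wfun_powr_has_deriv[OF _ b, of 1, folded \<theta>_def[abs_def] \<theta>'_def]
        wfun_powr_deriv_continuous[OF _ b, of 1, folded \<theta>'_def] \<theta>'b, simplified]
  define m where "m = emeasure lebesgue ?B"
  have mfin: "m < top" using emeasure_lebesgue_ball_finite[of "0::'a" 1] by (simp add: m_def)
  have gB: "(\<integral>\<^sup>+x\<in>?B. ennreal (norm (g n x)) \<partial>lebesgue) \<le> m + 1" for n
  proof -
    have "(\<integral>\<^sup>+x\<in>?B. ennreal (norm (g n x)) \<partial>lebesgue) \<le> (\<integral>\<^sup>+x. indicator ?B x + ennreal (norm (g n x) powr p) * indicator ?B x \<partial>lebesgue)"
    proof (rule nn_integral_mono)
      fix x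
      have "norm (g n x) \<le> 1 + norm (g n x) powr p" using le_add_powr[of p 1 "norm (g n x)"] p by simp
      then have "ennreal (norm (g n x)) \<le> ennreal (1 + norm (g n x) powr p)" by (rule ennreal_leI)
      then show "ennreal (norm (g n x)) * indicator ?B x \<le> indicator ?B x + ennreal (norm (g n x) powr p) * indicator ?B x"
        by (auto simp: indicator_def)
    qed
    also have "\<dots> = m + lp_int p ?B (g n)"
      unfolding lp_int_def m_def by (subst nn_integral_add) auto
    also have "\<dots> \<le> m + 1" using le[of n] by (intro add_left_mono)
    finally show ?thesis .
  qed
  \<comment> \<open>On the ball of radius \<open>\<epsilon>\<close> the field is shorter than
    \<open>\<epsilon>\<close> and the L1 norm of the gradient is bounded by \<open>m + 1\<close>.
    Outside, the field has length at most 1, but there the gradient tends to 0 in L1.\<close>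
  have key: "?I n \<le> ennreal (b * \<epsilon>) * (m + 1) + ennreal b * (\<integral>\<^sup>+x\<in>?B - ball 0 \<epsilon>. ennreal (norm (g n x)) \<partial>lebesgue)"
    if \<epsilon>: "\<epsilon> > 0" for n \<epsilon>
  proof -
    have i1: "integrable lebesgue (\<lambda>x. indicator ?B x * \<theta> (u n x))"
    proof (rule integrable_ball_bounded)
      show "(\<lambda>x. \<theta> (u n x)) \<in> borel_measurable lebesgue"
        unfolding \<theta>_def using borel_measurable_continuous_onI[OF wfun_continuous[of 1]] by measurable
      show "\<bar>\<theta> (u n x)\<bar> \<le> 1" for x
        using wfun_nonneg[of 1 "u n x"] wfun_bound[of 1 "u n x"] b
        by (simp add: \<theta>_def powr_le1)
    qed
    have "AE x::'a in lebesgue. x \<noteq> 0"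
      using AE_completion[OF AE_lborel_singleton[of "0::'a"]] by simp
    then have ae: "AE x in lebesgue. indicator ?B x * \<theta> (u n x) \<le> \<theta> (u n x) * radial_div (\<lambda>r. r) (\<lambda>r. 1) x"
    proof eventually_elim
      case (elim x)
      have "1 \<le> real DIM('a)" using DIM_positive[where 'a='a] by linarith
      then have "1 * \<theta> (u n x) \<le> real DIM('a) * \<theta> (u n x)" by (intro mult_right_mono) (auto simp: \<theta>_def)
      then show ?case using elim by (auto simp: radial_div_def indicator_def mult.commute)
    qed
    let ?r = "\<lambda>x. indicator ?B x * (\<theta>' (u n x) * (g n x \<bullet> radial_field (\<lambda>r. r) x))"
    have i2: "integrable lebesgue (\<lambda>x. norm (?r x))" using div(2)[of n] by (rule integrable_norm)
    have "(\<integral>x. indicator ?B x * \<theta> (u n x) \<partial>lebesgue) \<le> (\<integral>x. \<theta> (u n x) * radial_div (\<lambda>r. r) (\<lambda>r. 1) x \<partial>lebesgue)"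
      by (rule integral_mono_AE[OF i1 div(1) ae])
    also have "\<dots> \<le> (\<integral>x. norm (?r x) \<partial>lebesgue)"
    proof -
      have "norm (\<integral>x. ?r x \<partial>lebesgue) \<le> (\<integral>x. norm (?r x) \<partial>lebesgue)" by (rule integral_norm_bound)
      then show ?thesis unfolding div(3) by (simp only: real_norm_def)
    qed
    finally have "ennreal (\<integral>x. indicator ?B x * \<theta> (u n x) \<partial>lebesgue) \<le> ennreal (\<integral>x. norm (?r x) \<partial>lebesgue)"
      by (rule ennreal_leI)
    moreover have "ennreal (\<integral>x. indicator ?B x * \<theta> (u n x) \<partial>lebesgue) = (\<integral>\<^sup>+x. ennreal (indicator ?B x * \<theta> (u n x)) \<partial>lebesgue)"
      by (rule nn_integral_eq_integral[symmetric, OF i1]) (simp add: \<theta>_def)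
    moreover have "(\<integral>\<^sup>+x. ennreal (indicator ?B x * \<theta> (u n x)) \<partial>lebesgue) = ?I n"
      by (rule nn_integral_cong) (auto simp: \<theta>_def indicator_def)
    moreover have "ennreal (\<integral>x. norm (?r x) \<partial>lebesgue) = (\<integral>\<^sup>+x. ennreal (norm (?r x)) \<partial>lebesgue)"
      by (rule nn_integral_eq_integral[symmetric, OF i2]) simp
    ultimately have "?I n \<le> (\<integral>\<^sup>+x. ennreal (norm (?r x)) \<partial>lebesgue)" by simp
    also have "\<dots> \<le> (\<integral>\<^sup>+x. ennreal (b * \<epsilon>) * (ennreal (norm (g n x)) * indicator ?B x) +
         ennreal b * (ennreal (norm (g n x)) * indicator (?B - ball 0 \<epsilon>) x) \<partial>lebesgue)"
    proof (rule nn_integral_mono)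
      fix x :: 'a
      show "ennreal (norm (?r x)) \<le> ennreal (b * \<epsilon>) * (ennreal (norm (g n x)) * indicator ?B x) +
         ennreal b * (ennreal (norm (g n x)) * indicator (?B - ball 0 \<epsilon>) x)"
      proof (cases "x \<in> ?B")
        case True
        have rf: "norm (radial_field (\<lambda>r. r) x) \<le> norm x" using norm_radial_field[of x] by simp
        have "\<bar>g n x \<bullet> radial_field (\<lambda>r. r) x\<bar> \<le> norm (g n x) * norm x"
          by (intro order_trans[OF Cauchy_Schwarz_ineq2] mult_left_mono rf) simp
        then have *: "norm (?r x) \<le> b * (norm (g n x) * norm x)"
          using True b \<theta>'b[of "u n x"] by (simp add: abs_mult mult_mono)
        show ?thesis
        proof (cases "norm x < \<epsilon>")
          case c: True
          have "b * (norm (g n x) * norm x) \<le> b * (norm (g n x) * \<epsilon>)"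
            using b c by (intro mult_left_mono) auto
          then have "ennreal (norm (?r x)) \<le> ennreal (b * \<epsilon> * norm (g n x))"
            using * by (intro ennreal_leI) (simp add: mult_ac)
          then show ?thesis using True c b \<epsilon> by (simp add: ennreal_mult)
        next
          case c: False
          have "b * (norm (g n x) * norm x) \<le> b * (norm (g n x) * 1)"
            using b True by (intro mult_left_mono) auto
          then have "ennreal (norm (?r x)) \<le> ennreal (b * norm (g n x))"
            using * by (intro ennreal_leI) simp
          also have "\<dots> = ennreal b * (ennreal (norm (g n x)) * indicator (?B - ball 0 \<epsilon>) x)"
            using True c b by (simp add: ennreal_mult)
          finally show ?thesis by (simp add: add_increasing)
        qed
      qed simp
    qed
    also have "\<dots> = ennreal (b * \<epsilon>) * (\<integral>\<^sup>+x\<in>?B. ennreal (norm (g n x)) \<partial>lebesgue) + ennreal b * (\<integral>\<^sup>+x\<in>?B - ball 0 \<epsilon>. ennreal (norm (g n x)) \<partial>lebesgue)"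
      by (subst nn_integral_add) (auto simp: nn_integral_cmult)
    also have "\<dots> \<le> ennreal (b * \<epsilon>) * (m + 1) + ennreal b * (\<integral>\<^sup>+x\<in>?B - ball 0 \<epsilon>. ennreal (norm (g n x)) \<partial>lebesgue)"
      by (intro add_right_mono mult_left_mono gB) simp
    finally show ?thesis .
  qed
  have "limsup ?I \<le> ennreal (b * \<epsilon>) * (m + 1)" if \<epsilon>: "\<epsilon> > 0" for \<epsilon>
  proof -
    let ?D = "\<lambda>n. \<integral>\<^sup>+x\<in>?B - ball 0 \<epsilon>. ennreal (norm (g n x)) \<partial>lebesgue"
    have "emeasure lebesgue (?B - ball 0 \<epsilon>) \<le> emeasure lebesgue ?B" by (rule emeasure_mono) auto
    then have "emeasure lebesgue (?B - ball 0 \<epsilon>) < \<infinity>" using mfin by (simp add: m_def le_less_trans)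
    then have D: "?D \<longlonglongrightarrow> 0"
      by (intro lp_int_tendsto_imp_L1[where p=p]) (use p lp_int_outside_tendsto_0[of p g \<epsilon>] gm le lim[OF \<epsilon>] in auto)
    have "(\<lambda>n. ennreal (b * \<epsilon>) * (m + 1) + ennreal b * ?D n) \<longlonglongrightarrow> ennreal (b * \<epsilon>) * (m + 1) + ennreal b * 0"
      by (intro tendsto_intros ennreal_tendsto_cmult D) auto
    from lim_imp_Limsup[OF _ this] have "limsup (\<lambda>n. ennreal (b * \<epsilon>) * (m + 1) + ennreal b * ?D n) = ennreal (b * \<epsilon>) * (m + 1)"
      by simp
    moreover have "limsup ?I \<le> limsup (\<lambda>n. ennreal (b * \<epsilon>) * (m + 1) + ennreal b * ?D n)"
      using key[OF \<epsilon>] by (intro Limsup_mono) auto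
    ultimately show ?thesis by simp
  qed
  then have *: "limsup ?I \<le> (m + 1) * ennreal (b * inverse (real (Suc n)))" for n
    using mult.commute[of "m + 1"] by simp
  have "(\<lambda>n. (m + 1) * ennreal (b * inverse (real (Suc n)))) \<longlonglongrightarrow> (m + 1) * ennreal (b * 0)"
    using mfin by (intro ennreal_tendsto_cmult tendsto_ennrealI tendsto_mult tendsto_const LIMSEQ_inverse_real_of_nat) simp
  from LIMSEQ_le_const[OF this] have "limsup ?I \<le> (m + 1) * ennreal (b * 0)" using * by blast
  then show ?thesis by (intro tendsto_0_if_Limsup_eq_0_ennreal) simp
qed

section \<open>Comparison of \<open>Fp\<close> with 1 plus its leading term\<close>

context bliss
begin

definition Fp_coeff where "Fp_coeff = (real N - p) / (real N * (p - 1)) * alpha_p N B p"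

lemma Fp_coeff_pos: "Fp_coeff > 0"
  using p1 pN N2 B0 by (simp add: Fp_coeff_def alpha_p_def alphaN_def omega_def)

lemma Fp_eq: "Fp N B p s = (1 + Fp_coeff * \<bar>s\<bar> powr pp) powr q"
  by (simp add: Fp_def Fp_coeff_def pp_def q_def)

lemma Fp_coeff_powr: "(Fp_coeff * \<bar>s\<bar> powr pp) powr q = Fp_coeff powr q * \<bar>s\<bar> powr ps"
  using Fp_coeff_pos q_pp by (simp add: powr_mult powr_powr mult.commute)

text \<open>With \<open>t = Fp_coeff * \<bar>s\<bar> powr pp\<close>, one of the two summands of
  \<open>1 + t\<close> dominates if \<open>t\<close> is small or large, and the factor
  \<open>1 + \<eta>\<close> absorbs the other. In between \<open>(1 + t) powr q\<close> is bounded
  and \<open>\<bar>s\<bar>\<close> is bounded below, so a multiple of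
  \<open>wfun 1 s powr \<beta>\<close> suffices.\<close>

lemma Fp_upper:
  assumes "\<eta> > 0"
  obtains C where "C \<ge> 0" "\<And>s. Fp N B p s \<le> (1 + \<eta>) * (1 + Fp_coeff powr q * \<bar>s\<bar> powr ps) + C * wfun 1 s powr \<beta>"
proof -
  have "((\<lambda>d. (1 + d) powr q) \<longlongrightarrow> (1 + 0) powr q) (at_right 0)"
    by (intro tendsto_intros) auto
  then have "\<forall>\<^sub>F d in at_right 0. (1 + d) powr q < 1 + \<eta>"
    using assms by (intro order_tendstoD(2)) auto
  moreover have "\<forall>\<^sub>F d in at_right (0::real). d > 0" by (simp add: eventually_at_filter)
  ultimately have "\<forall>\<^sub>F d in at_right 0. (1 + d) powr q < 1 + \<eta> \<and> d > 0" by eventually_elim simp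
  then obtain d where d: "(1 + d) powr q < 1 + \<eta>" "d > 0"
    using eventually_happens[of _ "at_right (0::real)"] by auto
  \<comment> \<open>The value of \<open>\<bar>s\<bar>\<close> at which \<open>t\<close> equals
    \<open>d\<close>.\<close>
  define s0 where "s0 = (d / Fp_coeff) powr (1 / pp)"
  have s0: "s0 > 0" using d Fp_coeff_pos by (simp add: s0_def)
  have w0: "wfun 1 s0 > 0" using s0 by (simp add: wfun_def)
  define C where "C = (1 + 1 / d) powr q / wfun 1 s0 powr \<beta>"
  show ?thesis
  proof (rule that[of C])
    show "C \<ge> 0" by (simp add: C_def)
    fix s
    define t where "t = Fp_coeff * \<bar>s\<bar> powr pp"
    have t0: "t \<ge> 0" using Fp_coeff_pos by (simp add: t_def)
    have tq: "t powr q = Fp_coeff powr q * \<bar>s\<bar> powr ps" unfolding t_def by (rule Fp_coeff_powr)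
    have Cw: "0 \<le> C * wfun 1 s powr \<beta>" by (simp add: C_def)
    have F: "Fp N B p s = (1 + t) powr q" by (simp add: Fp_eq t_def)
    have tq0: "0 \<le> t powr q" by simp
    consider "t \<le> d" | "t \<ge> 1 / d" | "d < t" "t < 1 / d" by linarith
    then show "Fp N B p s \<le> (1 + \<eta>) * (1 + Fp_coeff powr q * \<bar>s\<bar> powr ps) + C * wfun 1 s powr \<beta>"
    proof cases
      case 1
      have "(1 + t) powr q \<le> (1 + d) powr q" using 1 t0 q0 by (intro powr_mono2) auto
      also have "\<dots> \<le> (1 + \<eta>) * 1" using d by simp
      also have "\<dots> \<le> (1 + \<eta>) * (1 + t powr q)" using assms by (intro mult_left_mono) auto
      finally show ?thesis using Cw F tq by simp
    next
      case 2
      have tp: "t > 0" using 2 d by (meson divide_pos_pos less_le_trans zero_less_one)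
      have "1 / t \<le> d" using 2 tp d by (simp add: field_simps)
      have "1 + t = t * (1 + 1 / t)" using tp by (simp add: field_simps)
      then have "(1 + t) powr q = (t * (1 + 1 / t)) powr q" by (simp only:)
      also have "\<dots> = t powr q * (1 + 1 / t) powr q" using tp by (simp add: powr_mult)
      also have "\<dots> \<le> t powr q * (1 + d) powr q"
        using \<open>1 / t \<le> d\<close> tp q0 by (intro mult_left_mono powr_mono2) auto
      also have "\<dots> \<le> t powr q * (1 + \<eta>)" using d by (intro mult_left_mono) auto
      also have "\<dots> \<le> (1 + \<eta>) * (1 + t powr q)" using assms by (simp add: algebra_simps)
      finally show ?thesis using Cw F tq by simp
    next
      case 3
      have "d / Fp_coeff < \<bar>s\<bar> powr pp" using 3 Fp_coeff_pos by (simp add: t_def field_simps)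
      then have "s0 \<le> (\<bar>s\<bar> powr pp) powr (1 / pp)"
        unfolding s0_def using d Fp_coeff_pos pp1 by (intro powr_mono2) auto
      then have s: "s0 \<le> \<bar>s\<bar>" using pp1 by (simp add: powr_powr)
      have "wfun 1 s0 \<le> wfun 1 s" using s s0 by (simp add: wfun_def frac_le_eq divide_le_eq field_simps)
      then have "wfun 1 s0 powr \<beta> \<le> wfun 1 s powr \<beta>" using w0 \<beta>1 by (intro powr_mono2) auto
      have "(1 + t) powr q \<le> (1 + 1 / d) powr q" using 3 t0 q0 by (intro powr_mono2) auto
      also have "\<dots> = C * wfun 1 s0 powr \<beta>" using w0 by (simp add: C_def)
      also have "\<dots> \<le> C * wfun 1 s powr \<beta>"
        using \<open>wfun 1 s0 powr \<beta> \<le> wfun 1 s powr \<beta>\<close> by (intro mult_left_mono) (auto simp: C_def)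
      also have "\<dots> \<le> (1 + \<eta>) * (1 + t powr q) + C * wfun 1 s powr \<beta>" using assms by simp
      finally show ?thesis using F tq by simp
    qed
  qed
qed

text \<open>\<open>Fp_upper\<close> is integrated: concentration removes the \<open>wfun\<close>
  term in the limit, the radial inequality bounds the critical power for each \<open>n\<close>, and
  \<open>\<eta>\<close> is arbitrary.\<close>

lemma limsup_Fp_le:
  fixes u :: "nat \<Rightarrow> 'a::euclidean_space \<Rightarrow> real" and g :: "nat \<Rightarrow> 'a \<Rightarrow> 'a"
  assumes N: "N = DIM('a)" and B: "B = measure lebesgue (ball (0::'a) 1)"
    and X: "(u, g) \<in> Xp p"
  shows "limsup (\<lambda>n. \<integral>\<^sup>+x\<in>ball 0 1. ennreal (Fp N B p (u n x)) \<partial>lebesgue) \<le> ennreal (B + Fp_coeff powr q * K)"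
proof -
  let ?B = "ball (0::'a) 1"
  let ?I = "\<lambda>n. \<integral>\<^sup>+x\<in>?B. ennreal (Fp N B p (u n x)) \<partial>lebesgue"
  let ?w = "\<lambda>n. \<integral>\<^sup>+x\<in>?B. ennreal (wfun 1 (u n x) powr \<beta>) \<partial>lebesgue"
  have [measurable]: "?B \<in> sets lebesgue" by simp
  from X have W: "\<And>n. W0 p ?B (u n) (g n)" and rad: "\<And>n. radial (u n)"
    and le1: "\<And>n. lp_norm p ?B (g n) \<le> 1"
    and lim: "\<And>\<epsilon>. \<epsilon> > 0 \<Longrightarrow> (\<lambda>n. lp_norm p (ball 0 \<epsilon> \<inter> ?B) (g n)) \<longlonglongrightarrow> 1"
    unfolding Xp_def by auto
  have um [measurable]: "u n \<in> borel_measurable lebesgue" for n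
    using W[of n] unfolding W0_def by auto
  have [measurable]: "wfun 1 \<in> borel_measurable borel"
    by (rule borel_measurable_continuous_onI[OF wfun_continuous]) simp
  have le: "lp_int p ?B (g n) \<le> 1" for n
    by (rule lp_norm_le_1_imp[OF le1]) (use W[of n] p1 in \<open>auto simp: W0_def\<close>)
  have w: "?w \<longlonglongrightarrow> 0"
    by (rule concentrating_imp_wfun_tendsto_0[OF W p1 \<beta>1 le lim])
  have emB: "emeasure lebesgue ?B = ennreal B"
    unfolding B using emeasure_lebesgue_ball_finite[of "0::'a" 1]
    by (intro emeasure_eq_ennreal_measure) (simp add: less_top)
  have K0: "K \<ge> 0" by (simp add: K_def)
  have bound: "limsup ?I \<le> ennreal ((1 + \<eta>) * (B + Fp_coeff powr q * K))" if \<eta>: "\<eta> > 0" for \<eta>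
  proof -
    obtain C where C: "C \<ge> 0" "\<And>s. Fp N B p s \<le> (1 + \<eta>) * (1 + Fp_coeff powr q * \<bar>s\<bar> powr ps) + C * wfun 1 s powr \<beta>"
      using Fp_upper[OF \<eta>] by blast
    have "?I n \<le> ennreal ((1 + \<eta>) * (B + Fp_coeff powr q * K)) + ennreal C * ?w n" for n
    proof -
      have "?I n \<le> (\<integral>\<^sup>+x. (ennreal (1 + \<eta>) * indicator ?B x + ennreal ((1 + \<eta>) * Fp_coeff powr q) * (ennreal (\<bar>u n x\<bar> powr ps) * indicator ?B x)) +
          ennreal C * (ennreal (wfun 1 (u n x) powr \<beta>) * indicator ?B x) \<partial>lebesgue)"
      proof (rule nn_integral_mono)
        fix x
        have "ennreal (Fp N B p (u n x)) \<le> ennreal ((1 + \<eta>) + (1 + \<eta>) * Fp_coeff powr q * \<bar>u n x\<bar> powr ps + C * wfun 1 (u n x) powr \<beta>)"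
          using C(2)[of "u n x"] by (intro ennreal_leI) (simp add: algebra_simps)
        also have "\<dots> = ennreal (1 + \<eta>) + ennreal ((1 + \<eta>) * Fp_coeff powr q) * ennreal (\<bar>u n x\<bar> powr ps) + ennreal C * ennreal (wfun 1 (u n x) powr \<beta>)"
          using \<eta> C(1) by (simp add: ennreal_plus ennreal_mult del: ennreal_plus[symmetric])
        finally show "ennreal (Fp N B p (u n x)) * indicator ?B x \<le> (ennreal (1 + \<eta>) * indicator ?B x + ennreal ((1 + \<eta>) * Fp_coeff powr q) * (ennreal (\<bar>u n x\<bar> powr ps) * indicator ?B x)) +
          ennreal C * (ennreal (wfun 1 (u n x) powr \<beta>) * indicator ?B x)"
          by (auto simp: indicator_def)
      qed
      also have "\<dots> = ennreal (1 + \<eta>) * ennreal B + ennreal ((1 + \<eta>) * Fp_coeff powr q) * (\<integral>\<^sup>+x\<in>?B. ennreal (\<bar>u n x\<bar> powr ps) \<partial>lebesgue) + ennreal C * ?w n"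
        by (simp add: nn_integral_add nn_integral_cmult emB)
      also have "\<dots> \<le> ennreal (1 + \<eta>) * ennreal B + ennreal ((1 + \<eta>) * Fp_coeff powr q) * ennreal K + ennreal C * ?w n"
        by (intro add_mono mult_left_mono order.refl radial_inequality[OF N B W rad le]) simp
      also have "ennreal (1 + \<eta>) * ennreal B + ennreal ((1 + \<eta>) * Fp_coeff powr q) * ennreal K = ennreal ((1 + \<eta>) * (B + Fp_coeff powr q * K))"
        using \<eta> B0 K0 by (simp add: ennreal_mult[symmetric] ennreal_plus[symmetric] algebra_simps del: ennreal_plus)
      finally show ?thesis .
    qed
    then have "limsup ?I \<le> limsup (\<lambda>n. ennreal ((1 + \<eta>) * (B + Fp_coeff powr q * K)) + ennreal C * ?w n)"
      by (intro Limsup_mono) auto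
    also have "\<dots> = ennreal ((1 + \<eta>) * (B + Fp_coeff powr q * K)) + ennreal C * 0"
      by (intro lim_imp_Limsup tendsto_add tendsto_const ennreal_tendsto_cmult w) auto
    finally show ?thesis by simp
  qed
  have "(\<lambda>n. ennreal ((1 + inverse (real (Suc n))) * (B + Fp_coeff powr q * K))) \<longlonglongrightarrow> ennreal ((1 + 0) * (B + Fp_coeff powr q * K))"
    by (intro tendsto_ennrealI tendsto_mult tendsto_add tendsto_const LIMSEQ_inverse_real_of_nat)
  from LIMSEQ_le_const[OF this] have "limsup ?I \<le> ennreal ((1 + 0) * (B + Fp_coeff powr q * K))"
    using bound by auto
  then show ?thesis by simp
qed

end

subsection \<open>Smooth test functions\<close>

lemma Ck_SucI:
  fixes f :: "'a::euclidean_space \<Rightarrow> real"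
  assumes "\<And>x. (f has_derivative f' x) (at x)" "\<And>i. i \<in> Basis \<Longrightarrow> Ck k (\<lambda>x. f' x i)"
  shows "Ck (Suc k) f"
proof -
  have "frechet_derivative f (at x) = f' x" for x using frechet_derivative_at[OF assms(1)] by simp
  moreover have "f differentiable_on UNIV"
    using assms(1) by (auto simp: differentiable_on_def differentiable_def)
  ultimately show ?thesis using assms(2) by simp
qed

lemma Ck_SucD:
  fixes f :: "'a::euclidean_space \<Rightarrow> real"
  assumes "Ck (Suc k) f"
  obtains f' where "\<And>x. (f has_derivative f' x) (at x)" "\<And>i. i \<in> Basis \<Longrightarrow> Ck k (\<lambda>x. f' x i)"
proof (rule that)
  show "(f has_derivative frechet_derivative f (at x)) (at x)" for x
    using assms by (simp add: differentiable_on_def frechet_derivative_works)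
  show "Ck k (\<lambda>x. frechet_derivative f (at x) i)" if "i \<in> Basis" for i using assms that by simp
qed

lemma Ck_Suc_imp_Ck: "Ck (Suc k) f \<Longrightarrow> Ck k (f :: 'a::euclidean_space \<Rightarrow> real)"
proof (induction k arbitrary: f)
  case 0
  then show ?case by (simp add: differentiable_imp_continuous_on)
next
  case (Suc k)
  obtain f' where f': "\<And>x. (f has_derivative f' x) (at x)" "\<And>i. i \<in> Basis \<Longrightarrow> Ck (Suc k) (\<lambda>x. f' x i)"
    by (rule Ck_SucD[OF Suc.prems]) blast
  show ?case by (rule Ck_SucI[OF f'(1)]) (rule Suc.IH[OF f'(2)])
qed

lemma Ck_const: "Ck k (\<lambda>x::'a::euclidean_space. c)"
proof (induction k arbitrary: c)
  case (Suc k)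
  show ?case by (rule Ck_SucI[where f'="\<lambda>x v. 0"]) (auto intro: Suc)
qed simp

lemma Ck_inner: "Ck k (\<lambda>x::'a::euclidean_space. x \<bullet> i)"
proof (cases k)
  case 0 then show ?thesis by (auto intro!: continuous_intros)
next
  case (Suc m)
  have "Ck (Suc m) (\<lambda>x::'a. x \<bullet> i)"
    by (rule Ck_SucI[where f'="\<lambda>x v. v \<bullet> i"]) (auto intro!: derivative_eq_intros Ck_const)
  then show ?thesis using Suc by simp
qed

lemma Ck_add: "Ck k f \<Longrightarrow> Ck k g \<Longrightarrow> Ck k (\<lambda>x::'a::euclidean_space. f x + g x)"
proof (induction k arbitrary: f g)
  case 0 then show ?case by (auto intro!: continuous_intros)
next
  case (Suc k)
  obtain f' where f': "\<And>x. (f has_derivative f' x) (at x)" "\<And>i. i \<in> Basis \<Longrightarrow> Ck k (\<lambda>x. f' x i)"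
    by (rule Ck_SucD[OF Suc.prems(1)]) blast
  obtain g' where g': "\<And>x. (g has_derivative g' x) (at x)" "\<And>i. i \<in> Basis \<Longrightarrow> Ck k (\<lambda>x. g' x i)"
    by (rule Ck_SucD[OF Suc.prems(2)]) blast
  show ?case
  proof (rule Ck_SucI[where f'="\<lambda>x v. f' x v + g' x v"])
    show "((\<lambda>x. f x + g x) has_derivative (\<lambda>v. f' x v + g' x v)) (at x)" for x
      by (rule has_derivative_add[OF f'(1) g'(1)])
    show "Ck k (\<lambda>x. f' x i + g' x i)" if "i \<in> Basis" for i
      by (rule Suc.IH[OF f'(2)[OF that] g'(2)[OF that]])
  qed
qed

lemma Ck_mult: "Ck k f \<Longrightarrow> Ck k g \<Longrightarrow> Ck k (\<lambda>x::'a::euclidean_space. f x * g x)"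
proof (induction k arbitrary: f g)
  case 0 then show ?case by (auto intro!: continuous_intros)
next
  case (Suc k)
  obtain f' where f': "\<And>x. (f has_derivative f' x) (at x)" "\<And>i. i \<in> Basis \<Longrightarrow> Ck k (\<lambda>x. f' x i)"
    by (rule Ck_SucD[OF Suc.prems(1)]) blast
  obtain g' where g': "\<And>x. (g has_derivative g' x) (at x)" "\<And>i. i \<in> Basis \<Longrightarrow> Ck k (\<lambda>x. g' x i)"
    by (rule Ck_SucD[OF Suc.prems(2)]) blast
  show ?case
  proof (rule Ck_SucI[where f'="\<lambda>x v. f x * g' x v + f' x v * g x"])
    show "((\<lambda>x. f x * g x) has_derivative (\<lambda>v. f x * g' x v + f' x v * g x)) (at x)" for x
      by (rule has_derivative_mult[OF f'(1) g'(1)])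
    show "Ck k (\<lambda>x. f x * g' x i + f' x i * g x)" if "i \<in> Basis" for i
      by (intro Ck_add Suc.IH Ck_Suc_imp_Ck[OF Suc.prems(1)] Ck_Suc_imp_Ck[OF Suc.prems(2)] f'(2)[OF that] g'(2)[OF that])
  qed
qed

text \<open>Taking all derivatives at once as a sequence \<open>D\<close> closes the induction on
  \<open>k\<close>: differentiating \<open>D n (f x)\<close> leads to
  \<open>D (Suc n) (f x)\<close>. The set \<open>S\<close> admits outer functions that are smooth
  only on part of the line, such as powers.\<close>

lemma Ck_compose:
  fixes f :: "'a::euclidean_space \<Rightarrow> real" and D :: "nat \<Rightarrow> real \<Rightarrow> real"
  assumes D: "\<And>n s. s \<in> S \<Longrightarrow> (D n has_real_derivative D (Suc n) s) (at s)" and f: "\<And>x. f x \<in> S"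
    and Ck: "Ck k f"
  shows "Ck k (\<lambda>x. D n (f x))"
  using Ck
proof (induction k arbitrary: n)
  case 0
  have "continuous_on S (D n)"
    using D by (intro continuous_at_imp_continuous_on ballI DERIV_isCont)
  then show ?case using 0 f by (auto intro: continuous_on_compose2)
next
  case (Suc k)
  obtain f' where f': "\<And>x. (f has_derivative f' x) (at x)" "\<And>i. i \<in> Basis \<Longrightarrow> Ck k (\<lambda>x. f' x i)"
    by (rule Ck_SucD[OF Suc.prems]) blast
  show ?case
  proof (rule Ck_SucI[where f'="\<lambda>x v. D (Suc n) (f x) * f' x v"])
    fix x
    show "((\<lambda>x. D n (f x)) has_derivative (\<lambda>v. D (Suc n) (f x) * f' x v)) (at x)"
      using has_derivative_compose[OF f'(1) D[OF f, unfolded has_field_derivative_def]] .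
    show "Ck k (\<lambda>x. D (Suc n) (f x) * f' x i)" if "i \<in> Basis" for i
      by (intro Ck_mult Suc.IH Ck_Suc_imp_Ck[OF Suc.prems] f'(2)[OF that])
  qed
qed

lemma Ck_powr:
  fixes f :: "'a::euclidean_space \<Rightarrow> real"
  assumes "\<And>x. f x > 0" "Ck k f"
  shows "Ck k (\<lambda>x. f x powr a)"
proof -
  define D where "D n s = (\<Prod>i<n. a - real i) * s powr (a - real n)" for n s
  have "Ck k (\<lambda>x. D 0 (f x))"
  proof (rule Ck_compose[where S="{0<..}" and D=D and n=0 and f=f])
    fix n s assume "s \<in> {0::real<..}"
    then have "(D n has_real_derivative (\<Prod>i<n. a - real i) * ((a - real n) * s powr (a - real n - 1))) (at s)"
      unfolding D_def[abs_def] by (intro DERIV_cmult has_real_derivative_powr) simp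
    then show "(D n has_real_derivative D (Suc n) s) (at s)"
      by (simp add: D_def mult.assoc algebra_simps)
  qed (use assms in auto)
  then show ?thesis by (simp add: D_def)
qed

definition flat_exp :: "real \<Rightarrow> real" where "flat_exp t = (if t > 0 then exp (- 1 / t) else 0)"

text \<open>With \<open>z = 1 / t\<close>, differentiating \<open>P z * exp (- z)\<close> with
  respect to \<open>t\<close> gives \<open>z^2 * (P z - P' z) * exp (- z)\<close>.\<close>

primrec flat_poly :: "nat \<Rightarrow> real poly" where
  "flat_poly 0 = 1"
| "flat_poly (Suc n) = [:0, 0, 1:] * (flat_poly n - pderiv (flat_poly n))"

definition flat_deriv :: "nat \<Rightarrow> real \<Rightarrow> real" where
  "flat_deriv n t = (if t > 0 then poly (flat_poly n) (1 / t) * exp (- 1 / t) else 0)"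

text \<open>The additional power of \<open>z\<close> serves the induction over the coefficients: the
  factor \<open>z\<close> in front of the remaining polynomial is absorbed into
  \<open>m\<close>.\<close>

lemma poly_exp_tendsto_0: "((\<lambda>z::real. z ^ m * poly P z * exp (- z)) \<longlongrightarrow> 0) at_top"
proof (induction P arbitrary: m)
  case 0 then show ?case by simp
next
  case (pCons a P)
  have "((\<lambda>z. a * (z ^ m / exp z) + z ^ Suc m * poly P z * exp (- z)) \<longlongrightarrow> a * 0 + 0) at_top"
    by (intro tendsto_add tendsto_mult tendsto_const tendsto_power_div_exp_0 pCons.IH)
  moreover have "a * (z ^ m / exp z) + z ^ Suc m * poly P z * exp (- z) = z ^ m * poly (pCons a P) z * exp (- z)" for z
    by (simp add: exp_minus field_simps)
  ultimately show ?case by simp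
qed

lemma flat_deriv_deriv: "(flat_deriv n has_real_derivative flat_deriv (Suc n) t) (at t)"
proof -
  consider "t > 0" | "t < 0" | "t = 0" by linarith
  then show ?thesis
  proof cases
    case 1
    have di: "((\<lambda>t. 1 / t) has_real_derivative - (1 / t^2)) (at t)"
      using 1 by (auto intro!: derivative_eq_intros simp: power2_eq_square)
    have dp: "((\<lambda>t. poly (flat_poly n) (1 / t)) has_real_derivative poly (pderiv (flat_poly n)) (1 / t) * - (1 / t^2)) (at t)"
      by (rule DERIV_chain2[OF poly_DERIV di])
    have de: "((\<lambda>t. exp (- (1 / t))) has_real_derivative exp (- (1 / t)) * - (- (1 / t^2))) (at t)"
      by (rule DERIV_chain2[OF DERIV_exp DERIV_minus[OF di]])
    have "((\<lambda>t. poly (flat_poly n) (1 / t) * exp (- (1 / t))) has_real_derivative flat_deriv (Suc n) t) (at t)"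
      by (rule DERIV_cong[OF DERIV_mult[OF dp de]])
         (use 1 in \<open>simp add: flat_deriv_def power2_eq_square algebra_simps\<close>)
    then show ?thesis
      by (rule has_field_derivative_transform_within_open[where S="{0<..}"]) (use 1 in \<open>auto simp: flat_deriv_def\<close>)
  next
    case 2
    have "((\<lambda>t. 0) has_real_derivative flat_deriv (Suc n) t) (at t)" using 2 by (simp add: flat_deriv_def)
    then show ?thesis
      by (rule has_field_derivative_transform_within_open[where S="{..<0}"]) (use 2 in \<open>auto simp: flat_deriv_def\<close>)
  next
    case 3
    \<comment> \<open>With \<open>z = 1 / h\<close> the right difference quotient at 0 is
      \<open>z\<close> times a polynomial in \<open>z\<close> times \<open>exp (- z)\<close>; the
      left one is identically 0.\<close>
    have "((\<lambda>h. flat_deriv n h / h) \<longlongrightarrow> 0) (at_right 0)"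
    proof (rule Lim_transform_eventually)
      have "((\<lambda>h. (inverse h) ^ 1 * poly (flat_poly n) (inverse h) * exp (- inverse h)) \<longlongrightarrow> 0) (at_right 0)"
        by (rule filterlim_compose[OF poly_exp_tendsto_0 filterlim_inverse_at_top_right])
      then show "((\<lambda>h. (inverse h) ^ 1 * poly (flat_poly n) (inverse h) * exp (- inverse h)) \<longlongrightarrow> 0) (at_right (0::real))" .
      show "\<forall>\<^sub>F h in at_right 0. inverse h ^ 1 * poly (flat_poly n) (inverse h) * exp (- inverse h) = flat_deriv n h / h"
        unfolding eventually_at_filter by (intro always_eventually) (auto simp: flat_deriv_def divide_inverse)
    qed
    moreover have "((\<lambda>h. flat_deriv n h / h) \<longlongrightarrow> 0) (at_left 0)"
    proof (rule Lim_transform_eventually[OF tendsto_const])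
      show "\<forall>\<^sub>F h in at_left 0. 0 = flat_deriv n h / h"
        unfolding eventually_at_filter by (intro always_eventually) (auto simp: flat_deriv_def)
    qed
    ultimately have "((\<lambda>h. flat_deriv n h / h) \<longlongrightarrow> 0) (at 0)"
      using filterlim_split_at by blast
    then show ?thesis using 3 by (simp add: has_field_derivative_iff flat_deriv_def)
  qed
qed

lemma Ck_flat_exp:
  fixes f :: "'a::euclidean_space \<Rightarrow> real"
  assumes "Ck k f"
  shows "Ck k (\<lambda>x. flat_exp (f x))"
proof -
  have "Ck k (\<lambda>x. flat_deriv 0 (f x))"
    by (rule Ck_compose[where S=UNIV and D=flat_deriv and n=0 and f=f, OF flat_deriv_deriv _ assms]) simp
  moreover have "flat_deriv 0 = flat_exp" by (auto simp: flat_deriv_def flat_exp_def)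
  ultimately show ?thesis by simp
qed

lemma Ck_norm_square: "Ck k (\<lambda>x::'a::euclidean_space. x \<bullet> x)"
proof (cases k)
  case 0 then show ?thesis by (auto intro!: continuous_intros)
next
  case (Suc m)
  have "Ck (Suc m) (\<lambda>x::'a. x \<bullet> x)"
  proof (rule Ck_SucI[where f'="\<lambda>x v. 2 * (x \<bullet> v)"])
    show "((\<lambda>x. x \<bullet> x) has_derivative (\<lambda>v. 2 * (x \<bullet> v))) (at x)" for x :: 'a
      by (auto intro!: derivative_eq_intros simp: inner_commute)
    show "Ck m (\<lambda>x::'a. 2 * (x \<bullet> i))" for i by (intro Ck_mult Ck_const Ck_inner)
  qed
  then show ?thesis using Suc by simp
qed

text \<open>\<open>cutoff \<tau>\<close> is smooth, vanishes for \<open>z \<le> 0\<close>, converges to the identity on \<open>z > 0\<close> as \<open>\<tau>\<close> tends to 0, and its slope is at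
most 1. Composing with it makes supports compact without increasing gradients.\<close>

definition cutoff :: "real \<Rightarrow> real \<Rightarrow> real" where "cutoff \<tau> z = z * flat_exp (z / \<tau>)"

lemma cutoff_nonneg: "0 \<le> cutoff \<tau> z" if "\<tau> > 0"
  using that by (auto simp: cutoff_def flat_exp_def zero_less_divide_iff)

lemma cutoff_eq_0: "cutoff \<tau> z = 0" if "z \<le> 0" "\<tau> > 0"
  using that by (auto simp: cutoff_def flat_exp_def zero_less_divide_iff)

lemma cutoff_deriv:
  assumes \<tau>: "\<tau> > 0"
  obtains d where "(cutoff \<tau> has_real_derivative d) (at z)" "\<bar>d\<bar> \<le> 1"
proof (cases "z > 0")
  case True
  have dl: "((\<lambda>z. z / \<tau>) has_real_derivative 1 / \<tau>) (at z)" using \<tau> by (auto intro!: derivative_eq_intros)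
  have e: "flat_deriv 0 = flat_exp" by (auto simp: flat_deriv_def flat_exp_def)
  have de: "((\<lambda>z. flat_exp (z / \<tau>)) has_real_derivative flat_deriv 1 (z / \<tau>) * (1 / \<tau>)) (at z)"
    using DERIV_chain2[OF flat_deriv_deriv[of 0] dl] by (simp add: e)
  let ?d = "1 * flat_exp (z / \<tau>) + (flat_deriv 1 (z / \<tau>) * (1 / \<tau>)) * z"
  have d: "(cutoff \<tau> has_real_derivative ?d) (at z)"
    unfolding cutoff_def[abs_def] by (rule DERIV_mult[OF DERIV_ident de])
  \<comment> \<open>The slope bound is the inequality \<open>1 + y \<le> exp y\<close> with
    \<open>y = \<tau> / z\<close>.\<close>
  have "?d = exp (- (\<tau> / z)) * (1 + \<tau> / z)"
    using True \<tau> by (simp add: flat_exp_def flat_deriv_def field_simps)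
  moreover have "exp (- (\<tau> / z)) * (1 + \<tau> / z) \<le> exp (- (\<tau> / z)) * exp (\<tau> / z)"
    by (intro mult_left_mono exp_ge_add_one_self) simp
  moreover have "exp (- (\<tau> / z)) * exp (\<tau> / z) = 1" by (simp flip: exp_add)
  moreover have "0 \<le> exp (- (\<tau> / z)) * (1 + \<tau> / z)" using True \<tau> by simp
  ultimately have "\<bar>?d\<bar> \<le> 1" by linarith
  with d show ?thesis by (rule that)
next
  case False
  have dl: "((\<lambda>z. z / \<tau>) has_real_derivative 1 / \<tau>) (at z)" using \<tau> by (auto intro!: derivative_eq_intros)
  have e: "flat_deriv 0 = flat_exp" by (auto simp: flat_deriv_def flat_exp_def)
  have de: "((\<lambda>z. flat_exp (z / \<tau>)) has_real_derivative flat_deriv 1 (z / \<tau>) * (1 / \<tau>)) (at z)"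
    using DERIV_chain2[OF flat_deriv_deriv[of 0] dl] by (simp add: e)
  let ?d = "1 * flat_exp (z / \<tau>) + (flat_deriv 1 (z / \<tau>) * (1 / \<tau>)) * z"
  have d: "(cutoff \<tau> has_real_derivative ?d) (at z)"
    unfolding cutoff_def[abs_def] by (rule DERIV_mult[OF DERIV_ident de])
  have "\<not> z / \<tau> > 0" using False \<tau> by (simp add: zero_less_divide_iff)
  then have "\<bar>?d\<bar> \<le> 1" by (simp add: flat_exp_def flat_deriv_def)
  with d show ?thesis by (rule that)
qed

lemma Ck_cutoff:
  fixes f :: "'a::euclidean_space \<Rightarrow> real"
  assumes "Ck k f"
  shows "Ck k (\<lambda>x. cutoff \<tau> (f x))"
proof -
  have "Ck k (\<lambda>x. f x * flat_exp (f x * (1 / \<tau>)))"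
    by (intro Ck_mult assms Ck_flat_exp Ck_const)
  then show ?thesis by (simp add: cutoff_def)
qed

lemma cutoff_tendsto:
  assumes z: "z \<longlonglongrightarrow> l" "l > 0" and \<tau>: "\<tau> \<longlonglongrightarrow> 0" "\<And>j. \<tau> j > 0"
  shows "(\<lambda>j::nat. cutoff (\<tau> j) (z j)) \<longlonglongrightarrow> l"
proof (rule Lim_transform_eventually)
  have "(\<lambda>j. z j * exp (- (\<tau> j / z j))) \<longlonglongrightarrow> l * exp (- (0 / l))"
    by (intro tendsto_intros z \<tau>) (use z in auto)
  then show "(\<lambda>j. z j * exp (- (\<tau> j / z j))) \<longlonglongrightarrow> l" by simp
  have "\<forall>\<^sub>F j in sequentially. 0 < z j" using order_tendstoD(1)[OF z] .
  then show "\<forall>\<^sub>F j in sequentially. z j * exp (- (\<tau> j / z j)) = cutoff (\<tau> j) (z j)"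
    by eventually_elim (use \<tau>(2) in \<open>simp add: cutoff_def flat_exp_def\<close>)
qed

subsection \<open>Truncated bubbles and the lower bound\<close>

text \<open>The derivative of \<open>F\<close> is available only away from 0. The half-line is
  exhausted by \<open>{t n..}\<close>; monotone convergence and the continuity of \<open>F\<close>
  at 0 give the rest.\<close>

lemma nn_integral_FTC_greaterThan:
  fixes F k :: "real \<Rightarrow> real"
  assumes kc: "continuous_on {0<..} k" and k0: "\<And>r. r > 0 \<Longrightarrow> 0 \<le> k r"
    and F: "\<And>r. r > 0 \<Longrightarrow> (F has_real_derivative k r) (at r)"
    and Fc: "continuous_on {0..} F" and F0: "F 0 = 0" and lim: "(F \<longlongrightarrow> T) at_top"
  shows "(\<integral>\<^sup>+r\<in>{0..}. ennreal (k r) \<partial>lborel) = ennreal T"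
proof -
  define kk where "kk r = indicator {0<..} r * k r" for r
  have [measurable]: "kk \<in> borel_measurable borel"
    unfolding kk_def using borel_measurable_continuous_on_indicator[OF _ kc] by simp
  define t where "t n = inverse (real (Suc n))" for n
  have t: "t n > 0" for n by (simp add: t_def)
  have tl: "t \<longlonglongrightarrow> 0" unfolding t_def by (rule LIMSEQ_inverse_real_of_nat)
  have tdec: "t n \<le> t m" if "m \<le> n" for m n unfolding t_def using that by (intro le_imp_inverse_le) auto
  have each: "(\<integral>\<^sup>+r\<in>{t n..}. ennreal (kk r) \<partial>lborel) = ennreal (T - F (t n))" for n
  proof (rule nn_integral_FTC_atLeast)
    show "(F has_real_derivative kk x) (at x)" if "t n \<le> x" for x
      using F[of x] less_le_trans[OF t that] by (simp add: kk_def)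
    show "0 \<le> kk x" if "t n \<le> x" for x using k0[of x] less_le_trans[OF t that] by (simp add: kk_def)
  qed (use lim in auto)
  have "(\<lambda>n. \<integral>\<^sup>+r\<in>{t n..}. ennreal (kk r) \<partial>lborel) \<longlonglongrightarrow> (\<integral>\<^sup>+r. ennreal (kk r) \<partial>lborel)"
  proof (rule nn_integral_LIMSEQ)
    show "incseq (\<lambda>n r. ennreal (kk r) * indicator {t n..} r)"
      using tdec by (auto simp: incseq_def le_fun_def indicator_def intro: order_trans)
    show "(\<lambda>n. ennreal (kk r) * indicator {t n..} r) \<longlonglongrightarrow> ennreal (kk r)" for r
    proof (cases "r > 0")
      case True
      then have "\<forall>\<^sub>F n in sequentially. t n < r" by (rule order_tendstoD(2)[OF tl])
      then have "\<forall>\<^sub>F n in sequentially. ennreal (kk r) = ennreal (kk r) * indicator {t n..} r"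
        by eventually_elim simp
      then show ?thesis by (rule Lim_transform_eventually[OF tendsto_const])
    qed (simp add: kk_def)
  qed measurable
  moreover have "(\<lambda>n. ennreal (T - F (t n))) \<longlonglongrightarrow> ennreal (T - 0)"
  proof (intro tendsto_ennrealI tendsto_diff tendsto_const)
    have "(\<lambda>n. F (t n)) \<longlonglongrightarrow> F 0"
      by (rule continuous_on_tendsto_compose[OF Fc tl]) (use t in \<open>auto intro!: always_eventually less_imp_le\<close>)
    then show "(\<lambda>n. F (t n)) \<longlonglongrightarrow> 0" by (simp add: F0)
  qed
  ultimately have "(\<integral>\<^sup>+r. ennreal (kk r) \<partial>lborel) = ennreal T"
    unfolding each using LIMSEQ_unique by fastforce
  moreover have "(\<integral>\<^sup>+r\<in>{0..}. ennreal (k r) \<partial>lborel) = (\<integral>\<^sup>+r. ennreal (kk r) \<partial>lborel)"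
  proof (rule nn_integral_cong_AE)
    show "AE r in lborel. ennreal (k r) * indicator {0..} r = ennreal (kk r)"
      using AE_lborel_singleton[of 0] by eventually_elim (auto simp: kk_def indicator_def)
  qed
  ultimately show ?thesis by simp
qed

lemma nn_integral_lborel_scaleR:
  fixes f :: "'a::euclidean_space \<Rightarrow> ennreal"
  assumes [measurable]: "f \<in> borel_measurable borel" and l: "l > 0"
  shows "(\<integral>\<^sup>+x. f x \<partial>lborel) = ennreal (l ^ DIM('a)) * (\<integral>\<^sup>+x. f (l *\<^sub>R x) \<partial>lborel)"
proof -
  have "(\<integral>\<^sup>+x. f x \<partial>lborel) = (\<integral>\<^sup>+x. f x \<partial>(density (distr lborel borel (\<lambda>x. 0 + l *\<^sub>R x)) (\<lambda>_. ennreal (\<bar>l\<bar> ^ DIM('a)))))"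
    using lborel_affine[of l "0::'a"] l by simp
  also have "\<dots> = (\<integral>\<^sup>+x. ennreal (l ^ DIM('a)) * f (l *\<^sub>R x) \<partial>lborel)"
    using l by (subst nn_integral_density) (auto simp: nn_integral_distr)
  also have "\<dots> = ennreal (l ^ DIM('a)) * (\<integral>\<^sup>+x. f (l *\<^sub>R x) \<partial>lborel)"
    by (rule nn_integral_cmult) measurable
  finally show ?thesis .
qed

context bliss
begin

lemma k_cont: "continuous_on {0<..} k"
  unfolding k_def[abs_def]
  by (intro continuous_on_mult continuous_on_const continuous_on_power continuous_on_id continuous_on_subset[OF one_plus_powr_cont]) auto

lemma H_lim: "(H \<longlongrightarrow> q * M) at_top"
proof -
  have "((\<lambda>y. q * G y - q * \<rho> y) \<longlongrightarrow> q * M - q * 0) at_top"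
    by (intro tendsto_intros G_lim \<rho>_lim)
  then show ?thesis by (simp add: H_def[abs_def])
qed

lemma radial_integrals:
  assumes N: "N = DIM('a::euclidean_space)" and B: "B = measure lebesgue (ball (0::'a) 1)"
  shows "(\<integral>\<^sup>+x. ennreal ((1 + norm (x::'a) powr pp) powr (- real N)) \<partial>lborel) = ennreal M"
    and "(\<integral>\<^sup>+x. ennreal (norm (x::'a) powr pp * (1 + norm x powr pp) powr (- real N)) \<partial>lborel) = ennreal (q * M)"
proof -
  have k_nonneg: "0 \<le> k r" if "r > 0" for r using k_pos[OF that] by simp
  have "(\<integral>\<^sup>+x. ennreal ((1 + norm (x::'a) powr pp) powr (- real N)) \<partial>lborel) = (\<integral>\<^sup>+r\<in>{0..}. ennreal (k r) \<partial>lborel)"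
    using B0 nn_integral_radial[where 'a='a and h="\<lambda>r. ennreal ((1 + r powr pp) powr (- real N))", folded N B]
    by (auto intro!: nn_integral_cong simp: indicator_def ennreal_mult[symmetric] k_def mult_ac)
  also have "\<dots> = ennreal M"
    by (rule nn_integral_FTC_greaterThan[OF k_cont k_nonneg G_deriv G_cont G_0 G_lim])
  finally show "(\<integral>\<^sup>+x. ennreal ((1 + norm (x::'a) powr pp) powr (- real N)) \<partial>lborel) = ennreal M" .
  have "(\<integral>\<^sup>+x. ennreal (norm (x::'a) powr pp * (1 + norm x powr pp) powr (- real N)) \<partial>lborel) = (\<integral>\<^sup>+r\<in>{0..}. ennreal (r powr pp * k r) \<partial>lborel)"
    using B0 nn_integral_radial[where 'a='a and h="\<lambda>r. ennreal (r powr pp * (1 + r powr pp) powr (- real N))", folded N B]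
    by (auto intro!: nn_integral_cong simp: indicator_def ennreal_mult[symmetric] k_def mult_ac)
  also have "\<dots> = ennreal (q * M)"
  proof (rule nn_integral_FTC_greaterThan[OF _ _ H_deriv H_cont H_0 H_lim])
    show "continuous_on {0<..} (\<lambda>r. r powr pp * k r)"
      by (intro continuous_on_mult k_cont continuous_on_subset[OF powr_pp_cont]) auto
    show "0 \<le> r powr pp * k r" if "r > 0" for r using k_pos[OF that] by simp
  qed
  finally show "(\<integral>\<^sup>+x. ennreal (norm (x::'a) powr pp * (1 + norm x powr pp) powr (- real N)) \<partial>lborel) = ennreal (q * M)" .
qed

text \<open>\<open>phi \<delta> c l\<close> is a multiple of the bubble, regularized at the origin by \<open>x \<bullet> x + \<delta>\<close>, cut off at level \<open>\<delta>\<close>, and concentrated by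
the dilation \<open>l\<close>.\<close>

definition a' where "a' = (real N - p) / p"
text \<open>The Sobolev bubble as a function of \<open>s = (norm x)^2\<close>; the exponent
  \<open>a'\<close> makes \<open>V s powr ps\<close> the bubble density. Working with the square
  avoids the singularity of the norm at the origin.\<close>

definition V where "V s = (1 + s powr (pp / 2)) powr (- a')"
text \<open>Up to the factor \<open>(N / q) powr p\<close>, the p-th power of the length of the
  gradient of the bubble, again as a function of \<open>s = (norm x)^2\<close>.\<close>

definition Q where "Q s = s powr (pp / 2) * (1 + s powr (pp / 2)) powr (- real N)"
definition phi :: "real \<Rightarrow> real \<Rightarrow> real \<Rightarrow> 'a::euclidean_space \<Rightarrow> real" where
  "phi \<delta> c l x = c * cutoff \<delta> (V (l^2 * (x \<bullet> x) + \<delta>) - \<delta>)"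

lemma a'_pos: "a' > 0" using p1 pN by (simp add: a'_def)
lemma a'_pp: "a' * pp = N / q" using p1 pN by (simp add: a'_def pp_def q_def)
lemma a'_ps: "a' * ps = N" using p1 pN by (simp add: a'_def ps_def)
lemma a'_p: "(a' + 1) * p = N" using p1 pN by (simp add: a'_def field_simps)
lemma pp_p: "(pp - 1) * p = pp" using p1 by (simp add: pp_def field_simps)

lemma V_pos: "V s > 0" using one_plus_powr_neq by (simp add: V_def)

text \<open>Adding \<open>\<delta>\<close> keeps the base of the power \<open>pp / 2\<close>
  positive, where the power is smooth; the polynomial \<open>x \<bullet> x\<close> is smooth
  everywhere.\<close>

lemma phi_smooth: "\<delta> > 0 \<Longrightarrow> smooth (phi \<delta> c l :: 'a::euclidean_space \<Rightarrow> real)"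
  unfolding smooth_def
proof
  fix k assume d: "\<delta> > 0"
  have s: "Ck k (\<lambda>x::'a. l^2 * (x \<bullet> x) + \<delta>)" by (intro Ck_add Ck_mult Ck_const Ck_norm_square)
  have "Ck k (\<lambda>x::'a. (1 + (l^2 * (x \<bullet> x) + \<delta>) powr (pp / 2)) powr (- a'))"
    by (intro Ck_powr Ck_add Ck_const s one_plus_powr_pos) (use d in \<open>auto intro: add_nonneg_pos\<close>)
  then have "Ck k (\<lambda>x::'a. V (l^2 * (x \<bullet> x) + \<delta>) + (- \<delta>))"
    unfolding V_def by (intro Ck_add Ck_const)
  then have "Ck k (\<lambda>x::'a. c * cutoff \<delta> (V (l^2 * (x \<bullet> x) + \<delta>) + (- \<delta>)))"
    by (intro Ck_mult Ck_const Ck_cutoff)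
  then show "Ck k (phi \<delta> c l :: 'a \<Rightarrow> real)" by (simp add: phi_def[abs_def])
qed

text \<open>The radius \<open>r\<close> at which \<open>r powr (- (a' * pp))\<close>, a majorant of
  the bubble, has fallen to the cut-off level \<open>\<delta>\<close>.\<close>

definition supp_radius where "supp_radius \<delta> = \<delta> powr (- 1 / (a' * pp))"

lemma supp_radius_pos: "\<delta> > 0 \<Longrightarrow> supp_radius \<delta> > 0" by (simp add: supp_radius_def)

lemma phi_support:
  assumes "\<delta> > 0" "l > 0" "supp_radius \<delta> \<le> l * norm x"
  shows "phi \<delta> c l x = 0"
proof -
  have lx: "l * norm x > 0" using supp_radius_pos[OF assms(1)] assms(3) by linarith
  have ap: "a' * pp > 0" using a'_pos pp1 by simp
  have eq: "l^2 * (x \<bullet> x) = (l * norm x) powr 2"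
    using lx by (simp add: power_mult_distrib power2_norm_eq_inner)
  have "V (l^2 * (x \<bullet> x) + \<delta>) \<le> ((l^2 * (x \<bullet> x)) powr (pp / 2)) powr (- a')"
    unfolding V_def
  proof (rule powr_mono2')
    have "(l^2 * (x \<bullet> x)) powr (pp / 2) \<le> (l^2 * (x \<bullet> x) + \<delta>) powr (pp / 2)"
      using assms(1) pp1 by (intro powr_mono2) auto
    then show "(l^2 * (x \<bullet> x)) powr (pp / 2) \<le> 1 + (l^2 * (x \<bullet> x) + \<delta>) powr (pp / 2)" by linarith
    show "0 < (l^2 * (x \<bullet> x)) powr (pp / 2)" using assms(2) lx by auto
  qed (use a'_pos in auto)
  also have "\<dots> = (l * norm x) powr (- (a' * pp))"
    unfolding eq by (simp add: powr_powr mult.commute)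
  also have "\<dots> \<le> supp_radius \<delta> powr (- (a' * pp))"
    using assms(3) supp_radius_pos[OF assms(1)] ap by (intro powr_mono2') auto
  also have "\<dots> = \<delta>" using a'_pos pp1 assms(1) by (simp add: supp_radius_def powr_powr)
  finally show ?thesis using assms(1) by (simp add: phi_def cutoff_eq_0)
qed

lemma phi_support_closure:
  assumes "\<delta> > 0" "l > 0"
  shows "{x::'a::euclidean_space. phi \<delta> c l x \<noteq> 0} \<subseteq> cball 0 (supp_radius \<delta> / l)"
    and "closure {x::'a. phi \<delta> c l x \<noteq> 0} \<subseteq> cball 0 (supp_radius \<delta> / l)"
proof -
  show sub: "{x::'a. phi \<delta> c l x \<noteq> 0} \<subseteq> cball 0 (supp_radius \<delta> / l)"
  proof
    fix x :: 'a assume "x \<in> {x. phi \<delta> c l x \<noteq> 0}"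
    then have "\<not> supp_radius \<delta> \<le> l * norm x" using phi_support[OF assms] by auto
    then show "x \<in> cball 0 (supp_radius \<delta> / l)" using assms(2) by (simp add: field_simps)
  qed
  show "closure {x::'a. phi \<delta> c l x \<noteq> 0} \<subseteq> cball 0 (supp_radius \<delta> / l)"
    by (rule closure_minimal[OF sub]) simp
qed

lemma phi_test_fn:
  assumes "\<delta> > 0" "l > 0" "cball 0 (supp_radius \<delta> / l) \<subseteq> S"
  shows "test_fn S (phi \<delta> c l :: 'a::euclidean_space \<Rightarrow> real)"
proof -
  have "compact (closure {x::'a. phi \<delta> c l x \<noteq> 0})"
    unfolding compact_closure by (rule bounded_subset[OF bounded_cball phi_support_closure(1)[OF assms(1,2)]])
  then show ?thesis
    unfolding test_fn_def using phi_smooth[OF assms(1)] phi_support_closure(2)[OF assms(1,2)] assms(3) by blast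
qed

lemma V_deriv: "(V has_real_derivative (- a' * (1 + s powr (pp / 2)) powr (- a' - 1) * ((pp / 2) * s powr (pp / 2 - 1)))) (at s)" if "s > 0"
proof -
  have "((\<lambda>s. 1 + s powr (pp / 2)) has_real_derivative (0 + (pp / 2) * s powr (pp / 2 - 1))) (at s)"
    by (intro DERIV_add DERIV_const has_real_derivative_powr that)
  from DERIV_chain2[OF has_real_derivative_powr[OF one_plus_powr_pos, where r="- a'"] this]
  show ?thesis unfolding V_def[abs_def] by (rule DERIV_cong) simp
qed

lemma grad_eqI: "(f has_derivative (\<lambda>v. w \<bullet> v)) (at x) \<Longrightarrow> grad f x = w" for f :: "'a::euclidean_space \<Rightarrow> real"
proof -
  assume "(f has_derivative (\<lambda>v. w \<bullet> v)) (at x)"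
  from frechet_derivative_at[OF this] have "frechet_derivative f (at x) = (\<lambda>v. w \<bullet> v)" by simp
  then show ?thesis by (simp add: grad_def euclidean_representation)
qed

lemma phi_grad:
  fixes x :: "'a::euclidean_space"
  assumes d: "\<delta> > 0" and l: "l > 0" and c: "c \<ge> 0"
  shows "grad (phi \<delta> c l) x = (c * l) *\<^sub>R grad (phi \<delta> 1 1) (l *\<^sub>R x)"
    and "norm (grad (phi \<delta> 1 1) x) powr p \<le> (N / q) powr p * Q (x \<bullet> x + \<delta>)"
proof -
  \<comment> \<open>The slope \<open>D\<close> of the cut-off is obtained only as some number.
    Fixing it once for all \<open>l\<close>, \<open>c\<close> and \<open>x\<close> with the same
    value of \<open>s\<close> makes the gradients on the two sides of the dilation identity
    comparable.\<close>
  have gen: "\<exists>D. \<bar>D\<bar> \<le> 1 \<and> (\<forall>l>0. \<forall>c x::'a. l^2 * (x \<bullet> x) + \<delta> = s \<longrightarrow> grad (phi \<delta> c l) x =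
      (c * (D * (- a' * (1 + s powr (pp / 2)) powr (- a' - 1) * ((pp / 2) * s powr (pp / 2 - 1)))) * (2 * l^2)) *\<^sub>R x)" if s: "s > 0" for s
  proof -
    obtain D where D: "(cutoff \<delta> has_real_derivative D) (at (V s - \<delta>))" "\<bar>D\<bar> \<le> 1"
      using cutoff_deriv[OF d] by blast
    let ?V' = "- a' * (1 + s powr (pp / 2)) powr (- a' - 1) * ((pp / 2) * s powr (pp / 2 - 1))"
    have "grad (phi \<delta> c l) x = (c * (D * ?V') * (2 * l^2)) *\<^sub>R x" if l: "l > 0" and sx: "l^2 * (x \<bullet> x) + \<delta> = s" for l c and x :: 'a
    proof (rule grad_eqI)
      have dV: "((\<lambda>s. c * cutoff \<delta> (V s - \<delta>)) has_real_derivative c * (D * (?V' - 0))) (at s)"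
        by (intro DERIV_cmult DERIV_chain2[where f="cutoff \<delta>" and g="\<lambda>s. V s - \<delta>", OF D(1)] DERIV_diff DERIV_const V_deriv s)
      have ds: "((\<lambda>x. l^2 * (x \<bullet> x) + \<delta>) has_derivative (\<lambda>v. l^2 * (2 * (x \<bullet> v)))) (at x)"
        by (auto intro!: derivative_eq_intros simp: inner_commute)
      have "((\<lambda>x. c * cutoff \<delta> (V (l^2 * (x \<bullet> x) + \<delta>) - \<delta>)) has_derivative (\<lambda>v. c * (D * (?V' - 0)) * (l^2 * (2 * (x \<bullet> v))))) (at x)"
      proof -
        have "((\<lambda>s. c * cutoff \<delta> (V s - \<delta>)) has_derivative (*) (c * (D * (?V' - 0)))) (at (l^2 * (x \<bullet> x) + \<delta>))"
          using dV unfolding sx has_field_derivative_def .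
        from has_derivative_compose[OF ds this] show ?thesis .
      qed
      moreover have "(\<lambda>v. c * (D * (?V' - 0)) * (l^2 * (2 * (x \<bullet> v)))) = (\<lambda>v. ((c * (D * ?V') * (2 * l^2)) *\<^sub>R x) \<bullet> v)"
        by (simp add: fun_eq_iff)
      ultimately show "(phi \<delta> c l has_derivative (\<lambda>v. ((c * (D * ?V') * (2 * l^2)) *\<^sub>R x) \<bullet> v)) (at x)"
        unfolding phi_def[abs_def] by simp
    qed
    then show ?thesis using D(2) by blast
  qed
  have s: "l^2 * (x \<bullet> x) + \<delta> > 0" using d by (simp add: add_nonneg_pos)
  from gen[OF s] obtain D where D: "\<And>l' c' (x'::'a). l' > 0 \<Longrightarrow> l'^2 * (x' \<bullet> x') + \<delta> = l^2 * (x \<bullet> x) + \<delta> \<Longrightarrow> grad (phi \<delta> c' l') x' =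
      (c' * (D * (- a' * (1 + (l^2 * (x \<bullet> x) + \<delta>) powr (pp / 2)) powr (- a' - 1) * ((pp / 2) * (l^2 * (x \<bullet> x) + \<delta>) powr (pp / 2 - 1)))) * (2 * l'^2)) *\<^sub>R x'"
    by blast
  show "grad (phi \<delta> c l) x = (c * l) *\<^sub>R grad (phi \<delta> 1 1) (l *\<^sub>R x)"
    unfolding D[OF l refl] by (subst D) (auto simp: power2_eq_square mult_ac)
  define s where "s = x \<bullet> x + \<delta>"
  have s0: "s > 0" using d by (simp add: s_def add_nonneg_pos)
  define u where "u = s powr (pp / 2)"
  have u0: "u > 0" using s0 by (simp add: u_def)
  from gen[OF s0] obtain D where D1: "\<bar>D\<bar> \<le> 1" and D2: "grad (phi \<delta> 1 1) x =
      (1 * (D * (- a' * (1 + u) powr (- a' - 1) * ((pp / 2) * s powr (pp / 2 - 1)))) * (2 * 1^2)) *\<^sub>R x"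
    unfolding u_def s_def by (metis mult_1 one_power2 zero_less_one)
  have "norm (grad (phi \<delta> 1 1) x) = \<bar>D\<bar> * (a' * pp * (1 + u) powr (- a' - 1) * s powr (pp / 2 - 1) * norm x)"
    unfolding D2 using a'_pos pp1 by (simp add: abs_mult)
  \<comment> \<open>The cut-off has slope at most 1 and \<open>norm x \<le> sqrt s\<close>, so
    neither modification raises the gradient above that of the bubble at \<open>s\<close>.\<close>
  also have "\<dots> \<le> 1 * (a' * pp * (1 + u) powr (- a' - 1) * s powr (pp / 2 - 1) * s powr (1 / 2))"
  proof (rule mult_mono[OF D1])
    have "norm x = sqrt (x \<bullet> x)" by (rule norm_eq_sqrt_inner)
    also have "\<dots> \<le> sqrt s" using d by (simp add: s_def)
    also have "\<dots> = s powr (1 / 2)" using s0 by (simp add: powr_half_sqrt)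
    finally show "a' * pp * (1 + u) powr (- a' - 1) * s powr (pp / 2 - 1) * norm x \<le> a' * pp * (1 + u) powr (- a' - 1) * s powr (pp / 2 - 1) * s powr (1 / 2)"
      using a'_pos pp1 by (intro mult_left_mono) auto
  qed (use a'_pos pp1 in auto)
  also have "\<dots> = (N / q) * (1 + u) powr (- (a' + 1)) * s powr ((pp - 1) / 2)"
  proof -
    have "s powr (pp / 2 - 1) * s powr (1 / 2) = s powr ((pp - 1) / 2)"
      unfolding powr_add[symmetric] by (rule arg_cong[where f="\<lambda>e. s powr e"]) (simp add: field_simps)
    moreover have "- a' - 1 = - (a' + 1)" by simp
    ultimately show ?thesis unfolding a'_pp by (simp add: mult.assoc)
  qed
  finally have "norm (grad (phi \<delta> 1 1) x) powr p \<le> ((N / q) * (1 + u) powr (- (a' + 1)) * s powr ((pp - 1) / 2)) powr p"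
    using p1 by (intro powr_mono2) auto
  also have "\<dots> = (N / q) powr p * ((1 + u) powr (- (a' + 1))) powr p * (s powr ((pp - 1) / 2)) powr p"
  proof -
    have m: "(X * Y * Z) powr p = X powr p * Y powr p * Z powr p" if "X \<ge> 0" "Y \<ge> 0" "Z \<ge> 0" for X Y Z :: real
      using that by (simp add: powr_mult)
    show ?thesis by (rule m) (use q0 in auto)
  qed
  also have "((1 + u) powr (- (a' + 1))) powr p = (1 + u) powr (- real N)"
    unfolding powr_powr by (rule arg_cong[where f="\<lambda>e. (1 + u) powr e"]) (use a'_p in \<open>simp add: algebra_simps\<close>)
  also have "(s powr ((pp - 1) / 2)) powr p = u"
    unfolding powr_powr u_def by (rule arg_cong[where f="\<lambda>e. s powr e"]) (use pp_p in \<open>simp add: field_simps\<close>)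
  finally show "norm (grad (phi \<delta> 1 1) x) powr p \<le> (N / q) powr p * Q (x \<bullet> x + \<delta>)"
    by (simp add: Q_def s_def u_def mult_ac)
qed

end

section \<open>Test functions as elements of \<open>W0\<close>\<close>

lemma continuous_compact_support_bounded:
  fixes f :: "'a::euclidean_space \<Rightarrow> 'b::real_normed_vector"
  assumes "continuous_on UNIV f" "compact C" "\<And>x. x \<notin> C \<Longrightarrow> f x = 0"
  obtains b where "b \<ge> 0" "\<And>x. norm (f x) \<le> b"
proof -
  have "compact (f ` C)" by (rule compact_continuous_image[OF continuous_on_subset[OF assms(1)] assms(2)]) simp
  then have "bounded (f ` C)" by (rule compact_imp_bounded)
  then obtain b where b: "\<And>x. x \<in> C \<Longrightarrow> norm (f x) \<le> b" unfolding bounded_iff by auto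
  have "norm (f x) \<le> max b 0" for x using b[of x] assms(3)[of x] by (cases "x \<in> C") auto
  then show ?thesis by (rule that[rotated]) simp
qed

lemma lp_int_bounded_finite:
  fixes f :: "'a::euclidean_space \<Rightarrow> 'b::real_normed_vector"
  assumes "\<And>x. norm (f x) \<le> b" "p > 0"
  shows "lp_int p (ball 0 1) f < \<infinity>"
proof -
  have [measurable]: "ball (0::'a) 1 \<in> sets lebesgue" by simp
  have "lp_int p (ball 0 1) f \<le> (\<integral>\<^sup>+x. ennreal (b powr p) * indicator (ball (0::'a) 1) x \<partial>lebesgue)"
    unfolding lp_int_def
  proof (rule nn_integral_mono)
    fix x
    have "norm (f x) powr p \<le> b powr p" using assms by (intro powr_mono2) auto
    then show "ennreal (norm (f x) powr p) * indicator (ball 0 1) x \<le> ennreal (b powr p) * indicator (ball 0 1) x"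
      by (intro mult_right_mono ennreal_leI) auto
  qed
  also have "\<dots> = ennreal (b powr p) * emeasure lebesgue (ball (0::'a) 1)"
    by (rule nn_integral_cmult_indicator) simp
  also have "\<dots> < \<infinity>" using emeasure_lebesgue_ball_finite[of "0::'a" 1] by (simp add: ennreal_mult_less_top)
  finally show ?thesis .
qed

lemma W0_test_fn:
  fixes \<phi> :: "'a::euclidean_space \<Rightarrow> real"
  assumes \<phi>: "test_fn (ball 0 1) \<phi>" and p: "p > 0"
  shows "W0 p (ball 0 1) \<phi> (grad \<phi>)"
proof -
  let ?C = "closure {x. \<phi> x \<noteq> 0}"
  have C: "compact ?C" using \<phi> by (simp add: test_fn_def)
  have c: "continuous_on UNIV \<phi>"
    using has_derivative_continuous[OF test_fnD(1)[OF \<phi>]] by (intro continuous_at_imp_continuous_on ballI)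
  have z: "\<phi> x = 0" if "x \<notin> ?C" for x using subsetD[OF closure_subset, of x "{x. \<phi> x \<noteq> 0}"] that by blast
  obtain b1 where b1: "\<And>x. norm (\<phi> x) \<le> b1" using continuous_compact_support_bounded[OF c C z] by blast
  obtain b2 where b2: "\<And>x. norm (grad \<phi> x) \<le> b2"
    using continuous_compact_support_bounded[OF test_fnD(2)[OF \<phi>] C test_fnD(3)[OF \<phi>]] by blast
  show ?thesis unfolding W0_def
  proof (intro conjI exI[of _ "\<lambda>_. \<phi>"] allI)
    show "\<phi> \<in> borel_measurable lebesgue" "grad \<phi> \<in> borel_measurable lebesgue"
      by (rule borel_measurable_lebesgueI, rule test_fn_borel[OF \<phi>])+
    show "lp_int p (ball 0 1) \<phi> < \<infinity>" by (rule lp_int_bounded_finite[OF b1 p])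
    show "lp_int p (ball 0 1) (grad \<phi>) < \<infinity>" by (rule lp_int_bounded_finite[OF b2 p])
  qed (use \<phi> p in \<open>simp_all add: lp_int_def\<close>)
qed

lemma lp_int_grad_eq:
  fixes \<phi> :: "'a::euclidean_space \<Rightarrow> real"
  assumes \<phi>: "test_fn S \<phi>" and sub: "closure {x. \<phi> x \<noteq> 0} \<subseteq> A" and p: "p > 0"
  shows "lp_int p A (grad \<phi>) = (\<integral>\<^sup>+x. ennreal (norm (grad \<phi> x) powr p) \<partial>lborel)"
proof -
  have "lp_int p A (grad \<phi>) = (\<integral>\<^sup>+x. ennreal (norm (grad \<phi> x) powr p) \<partial>lebesgue)"
    unfolding lp_int_def
  proof (rule nn_integral_cong)
    fix x
    show "ennreal (norm (grad \<phi> x) powr p) * indicator A x = ennreal (norm (grad \<phi> x) powr p)"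
      using test_fnD(3)[OF \<phi>, of x] sub p by (cases "x \<in> A") auto
  qed
  also have "\<dots> = (\<integral>\<^sup>+x. ennreal (norm (grad \<phi> x) powr p) \<partial>lborel)"
    using test_fn_borel(2)[OF \<phi>] by (intro nn_integral_completion) measurable
  finally show ?thesis .
qed

context bliss
begin

lemma inner_powr: "(x \<bullet> x) powr (pp / 2) = norm (x::'a::euclidean_space) powr pp"
proof (cases "x = 0")
  case False
  then have e: "x \<bullet> x = norm x powr 2" by (simp add: power2_norm_eq_inner)
  show ?thesis unfolding e powr_powr by simp
qed simp

lemma V_powr_ps: "V s powr ps = (1 + s powr (pp / 2)) powr (- real N)"
  unfolding V_def powr_powr using a'_ps by simp

lemma Q_nonneg: "0 \<le> Q s" by (simp add: Q_def)

lemma Q_bound: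
  fixes x :: "'a::euclidean_space"
  assumes "\<delta> \<ge> 0"
  shows "Q (x \<bullet> x + \<delta>) \<le> (1 + norm x powr pp) powr (- real N) + norm x powr pp * (1 + norm x powr pp) powr (- real N)"
proof -
  define u where "u = (x \<bullet> x + \<delta>) powr (pp / 2)"
  define v where "v = norm x powr pp"
  have uv: "v \<le> u" unfolding u_def v_def inner_powr[symmetric] using assms pp1 by (intro powr_mono2) auto
  have e: "(1 + s) powr (- real N) * (1 + s) = (1 + s) powr (1 - real N)" if "s \<ge> 0" for s :: real
    using that by (simp add: powr_diff powr_minus divide_inverse)
  have v0: "0 \<le> v" by (simp add: v_def)
  have "Q (x \<bullet> x + \<delta>) \<le> (1 + u) * (1 + u) powr (- real N)"
    unfolding Q_def u_def[symmetric] by (intro mult_right_mono) auto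
  also have "\<dots> = (1 + u) powr (1 - real N)" using e[of u] uv v0 by (simp add: mult.commute)
  also have "\<dots> \<le> (1 + v) powr (1 - real N)" using uv v0 N2 by (intro powr_mono2') auto
  also have "\<dots> = (1 + v) powr (- real N) + v * (1 + v) powr (- real N)"
    using e[OF v0] by (simp add: algebra_simps)
  finally show ?thesis by (simp add: v_def)
qed

lemma phi_borel:
  assumes "\<delta> > 0"
  shows "(phi \<delta> 1 1 :: 'a::euclidean_space \<Rightarrow> real) \<in> borel_measurable borel"
    "grad (phi \<delta> 1 1 :: 'a \<Rightarrow> real) \<in> borel_measurable borel"
  using test_fn_borel[OF phi_test_fn[OF assms zero_less_one subset_UNIV]] by auto

lemma phi_nonneg: "\<delta> > 0 \<Longrightarrow> c \<ge> 0 \<Longrightarrow> 0 \<le> phi \<delta> c l x"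
  by (simp add: phi_def cutoff_nonneg)

text \<open>One-sided bounds suffice as \<open>\<delta>\<close> tends to 0: Fatou's lemma keeps the
  critical integral above \<open>m'\<close>, and dominated convergence of the majorant
  \<open>Q\<close> keeps the energy below \<open>A'\<close>.\<close>

lemma profile_exists:
  assumes N: "N = DIM('a::euclidean_space)" and B: "B = measure lebesgue (ball (0::'a) 1)"
    and m': "m' < M" and A': "(N / q) powr p * (q * M) < A'"
  obtains \<delta> where "\<delta> > 0" "ennreal m' \<le> (\<integral>\<^sup>+x. ennreal (phi \<delta> 1 1 (x::'a) powr ps) \<partial>lborel)"
    "(\<integral>\<^sup>+x. ennreal (norm (grad (phi \<delta> 1 1) (x::'a)) powr p) \<partial>lborel) \<le> ennreal A'"
proof -
  define d where "d j = inverse (real (Suc j))" for j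
  have d: "d j > 0" for j by (simp add: d_def)
  have dl: "d \<longlonglongrightarrow> 0" unfolding d_def by (rule LIMSEQ_inverse_real_of_nat)
  have [measurable]: "(phi (d j) 1 1 :: 'a \<Rightarrow> real) \<in> borel_measurable borel"
    "grad (phi (d j) 1 1 :: 'a \<Rightarrow> real) \<in> borel_measurable borel" for j
    using phi_borel[OF d] by auto
  have sl: "(\<lambda>j. (x \<bullet> x + d j) powr (pp / 2)) \<longlonglongrightarrow> norm x powr pp" for x :: 'a
  proof -
    have "(\<lambda>j. x \<bullet> x + d j) \<longlonglongrightarrow> x \<bullet> x + 0" by (intro tendsto_intros dl)
    then have "(\<lambda>j. (x \<bullet> x + d j) powr (pp / 2)) \<longlonglongrightarrow> (x \<bullet> x + 0) powr (pp / 2)"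
      by (rule tendsto_powr'[OF _ tendsto_const]) (use pp1 d in \<open>auto intro!: always_eventually add_nonneg_nonneg less_imp_le\<close>)
    then show ?thesis by (simp add: inner_powr)
  qed
  have "M > 0" by (rule M_pos)
  let ?P = "\<lambda>j. \<integral>\<^sup>+x. ennreal (phi (d j) 1 1 (x::'a) powr ps) \<partial>lborel"
  let ?\<Gamma> = "\<lambda>j. \<integral>\<^sup>+x. ennreal (norm (grad (phi (d j) 1 1) (x::'a)) powr p) \<partial>lborel"
  have philim: "(\<lambda>j. ennreal (phi (d j) 1 1 x powr ps)) \<longlonglongrightarrow> ennreal ((1 + norm x powr pp) powr (- real N))" for x :: 'a
  proof -
    have "(\<lambda>j. V (x \<bullet> x + d j) - d j) \<longlonglongrightarrow> V (x \<bullet> x) - 0"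
      unfolding V_def inner_powr
      by (intro tendsto_diff dl tendsto_powr tendsto_add tendsto_const sl) (simp add: one_plus_powr_neq)
    then have "(\<lambda>j. V (x \<bullet> x + d j) - d j) \<longlonglongrightarrow> V (x \<bullet> x)" by simp
    from cutoff_tendsto[OF this V_pos dl d]
    have "(\<lambda>j. phi (d j) 1 1 x) \<longlonglongrightarrow> V (x \<bullet> x)" by (simp add: phi_def)
    then have "(\<lambda>j. phi (d j) 1 1 x powr ps) \<longlonglongrightarrow> V (x \<bullet> x) powr ps"
      using V_pos[of "x \<bullet> x"] by (intro tendsto_powr tendsto_const) auto
    then show ?thesis unfolding V_powr_ps inner_powr by (rule tendsto_ennrealI)
  qed
  have "ennreal M = (\<integral>\<^sup>+x. liminf (\<lambda>j. ennreal (phi (d j) 1 1 (x::'a) powr ps)) \<partial>lborel)"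
    unfolding radial_integrals(1)[OF N B, symmetric]
    using lim_imp_Liminf[OF _ philim] by (intro nn_integral_cong) simp
  also have "\<dots> \<le> liminf ?P" by (rule nn_integral_liminf) measurable
  finally have M: "ennreal M \<le> liminf ?P" .
  have "ennreal m' < ennreal M" using \<open>M > 0\<close> m' by (rule ennreal_lessI)
  then have "ennreal m' < liminf ?P" using M by (rule less_le_trans)
  then have ev1: "\<forall>\<^sub>F j in sequentially. ennreal m' < ?P j" by (rule less_LiminfD)
  let ?I = "\<lambda>j. \<integral>\<^sup>+x. ennreal (Q ((x::'a) \<bullet> x + d j)) \<partial>lborel"
  have I: "?I \<longlonglongrightarrow> (\<integral>\<^sup>+x. ennreal (norm (x::'a) powr pp * (1 + norm x powr pp) powr (- real N)) \<partial>lborel)"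
  proof (rule nn_integral_dominated_convergence[where w="\<lambda>x. ennreal ((1 + norm x powr pp) powr (- real N) + norm x powr pp * (1 + norm x powr pp) powr (- real N))"])
    show "(\<lambda>x::'a. ennreal (Q (x \<bullet> x + d j))) \<in> borel_measurable lborel" for j unfolding Q_def by measurable
    show "AE x::'a in lborel. ennreal (Q (x \<bullet> x + d j)) \<le> ennreal ((1 + norm x powr pp) powr (- real N) + norm x powr pp * (1 + norm x powr pp) powr (- real N))" for j
      using Q_bound[OF less_imp_le[OF d]] by (intro AE_I2 ennreal_leI)
    have "(\<integral>\<^sup>+(x::'a). ennreal ((1 + norm x powr pp) powr (- real N) + norm x powr pp * (1 + norm x powr pp) powr (- real N)) \<partial>lborel)
       = (\<integral>\<^sup>+(x::'a). ennreal ((1 + norm x powr pp) powr (- real N)) + ennreal (norm x powr pp * (1 + norm x powr pp) powr (- real N)) \<partial>lborel)"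
      by (intro nn_integral_cong ennreal_plus) auto
    also have "\<dots> = ennreal M + ennreal (q * M)"
      by (subst nn_integral_add) (auto simp: radial_integrals[OF N B])
    finally show "(\<integral>\<^sup>+(x::'a). ennreal ((1 + norm x powr pp) powr (- real N) + norm x powr pp * (1 + norm x powr pp) powr (- real N)) \<partial>lborel) < \<infinity>"
      by simp
    show "AE x::'a in lborel. (\<lambda>j. ennreal (Q (x \<bullet> x + d j))) \<longlonglongrightarrow> ennreal (norm x powr pp * (1 + norm x powr pp) powr (- real N))"
      unfolding Q_def
      by (intro AE_I2 tendsto_ennrealI tendsto_mult tendsto_powr tendsto_add tendsto_const sl) (simp add: one_plus_powr_neq)
  qed measurable
  have bd: "?\<Gamma> j \<le> ennreal ((N / q) powr p) * ?I j" for j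
  proof -
    have "?\<Gamma> j \<le> (\<integral>\<^sup>+x. ennreal ((N / q) powr p) * ennreal (Q ((x::'a) \<bullet> x + d j)) \<partial>lborel)"
      using phi_grad(2)[OF d[of j] zero_less_one zero_le_one]
      by (intro nn_integral_mono) (auto simp: ennreal_mult[symmetric] Q_nonneg intro!: ennreal_leI)
    also have "\<dots> = ennreal ((N / q) powr p) * ?I j"
      by (rule nn_integral_cmult) (unfold Q_def, measurable)
    finally show ?thesis .
  qed
  have "(\<lambda>j. ennreal ((N / q) powr p) * ?I j) \<longlonglongrightarrow> ennreal ((N / q) powr p) * ennreal (q * M)"
    using I unfolding radial_integrals(2)[OF N B] by (intro ennreal_tendsto_cmult) auto
  moreover have "ennreal ((N / q) powr p) * ennreal (q * M) < ennreal A'"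
    using A' q0 \<open>M > 0\<close> by (subst ennreal_mult[symmetric]) (auto simp: ennreal_less_iff)
  ultimately have "\<forall>\<^sub>F j in sequentially. ennreal ((N / q) powr p) * ?I j < ennreal A'"
    by (rule order_tendstoD(2))
  with ev1 have "\<forall>\<^sub>F j in sequentially. ennreal m' < ?P j \<and> ennreal ((N / q) powr p) * ?I j < ennreal A'"
    by eventually_elim simp
  then obtain j where j: "ennreal m' < ?P j" "ennreal ((N / q) powr p) * ?I j < ennreal A'"
    using eventually_happens[of _ sequentially] by auto
  show ?thesis
    by (rule that[OF d[of j]]) (use j bd[of j] in auto)
qed

end

lemma one_plus_powr_ge:
  fixes t q :: real
  assumes "t \<ge> 0" "q \<ge> 1"
  shows "1 + t powr q \<le> (1 + t) powr q"
proof (cases "t = 0")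
  case False
  have "t powr q = t * t powr (q - 1)" using assms False by (simp add: powr_diff)
  also have "\<dots> \<le> t * (1 + t) powr (q - 1)" using assms by (intro mult_left_mono powr_mono2) auto
  finally have "t powr q \<le> t * (1 + t) powr (q - 1)" .
  moreover have "1 \<le> (1 + t) powr (q - 1)" using assms by (intro ge_one_powr_ge_zero) auto
  moreover have "(1 + t) powr q = (1 + t) powr (q - 1) + t * (1 + t) powr (q - 1)"
  proof -
    have "(1 + t) powr q = (1 + t) powr (q - 1) * (1 + t)" using assms by (simp add: powr_diff)
    then show ?thesis by (simp add: algebra_simps)
  qed
  ultimately show ?thesis by linarith
qed (use assms in simp)

context bliss
begin

text \<open>The exponent for which the critical integral divided by the energy to the power
  \<open>\<nu>\<close> is invariant under multiplication by constants and under dilation.\<close>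

definition \<nu> where "\<nu> = real N / (real N - p)"

lemma ps_p: "ps / p = \<nu>" using p1 pN by (simp add: ps_def \<nu>_def)

lemma phi_scaled_integrals:
  assumes N: "N = DIM('a::euclidean_space)" and d: "\<delta> > 0" and l: "l > 0" and c: "c \<ge> 0"
  shows "(\<integral>\<^sup>+x. ennreal (norm (grad (phi \<delta> c l) (x::'a)) powr p) \<partial>lborel) =
      ennreal ((c * l) powr p * l powr (- real N)) * (\<integral>\<^sup>+x. ennreal (norm (grad (phi \<delta> 1 1) (x::'a)) powr p) \<partial>lborel)"
    and "(\<integral>\<^sup>+x. ennreal (phi \<delta> c l (x::'a) powr ps) \<partial>lborel) =
      ennreal (c powr ps * l powr (- real N)) * (\<integral>\<^sup>+x. ennreal (phi \<delta> 1 1 (x::'a) powr ps) \<partial>lborel)"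
proof -
  note [measurable] = phi_borel[OF d, where 'a='a]
  have scale: "(\<integral>\<^sup>+x. f (l *\<^sub>R x) \<partial>lborel) = ennreal (l powr (- real N)) * (\<integral>\<^sup>+x. f x \<partial>lborel)"
    if f: "f \<in> borel_measurable borel" for f :: "'a \<Rightarrow> ennreal"
  proof -
    have "ennreal (l powr (- real N)) * (\<integral>\<^sup>+x. f x \<partial>lborel) = ennreal (l powr (- real N)) * (ennreal (l ^ N) * (\<integral>\<^sup>+x. f (l *\<^sub>R x) \<partial>lborel))"
      unfolding N by (simp only: nn_integral_lborel_scaleR[OF f l])
    also have "\<dots> = (ennreal (l powr (- real N)) * ennreal (l ^ N)) * (\<integral>\<^sup>+x. f (l *\<^sub>R x) \<partial>lborel)"
      by (simp only: mult.assoc)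
    also have "ennreal (l powr (- real N)) * ennreal (l ^ N) = 1"
      using l by (simp add: ennreal_mult[symmetric] powr_minus powr_realpow)
    finally show ?thesis by simp
  qed
  have "(\<integral>\<^sup>+x. ennreal (norm (grad (phi \<delta> c l) (x::'a)) powr p) \<partial>lborel) =
     (\<integral>\<^sup>+x. ennreal ((c * l) powr p) * ennreal (norm (grad (phi \<delta> 1 1) (l *\<^sub>R (x::'a))) powr p) \<partial>lborel)"
    using phi_grad(1)[OF d l c, where 'a='a] c l
    by (intro nn_integral_cong) (simp add: powr_mult ennreal_mult abs_mult)
  also have "\<dots> = ennreal ((c * l) powr p) * (\<integral>\<^sup>+x. ennreal (norm (grad (phi \<delta> 1 1) (l *\<^sub>R (x::'a))) powr p) \<partial>lborel)"
    by (rule nn_integral_cmult) measurable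
  also have "(\<integral>\<^sup>+x. ennreal (norm (grad (phi \<delta> 1 1) (l *\<^sub>R (x::'a))) powr p) \<partial>lborel) = ennreal (l powr (- real N)) * (\<integral>\<^sup>+x. ennreal (norm (grad (phi \<delta> 1 1) (x::'a)) powr p) \<partial>lborel)"
    by (rule scale) measurable
  finally show "(\<integral>\<^sup>+x. ennreal (norm (grad (phi \<delta> c l) (x::'a)) powr p) \<partial>lborel) =
      ennreal ((c * l) powr p * l powr (- real N)) * (\<integral>\<^sup>+x. ennreal (norm (grad (phi \<delta> 1 1) (x::'a)) powr p) \<partial>lborel)"
    using c l by (simp add: ennreal_mult mult.assoc)
  have "phi \<delta> c l x = c * phi \<delta> 1 1 (l *\<^sub>R x)" for x :: 'a by (simp add: phi_def power2_eq_square mult.assoc)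
  then have "(\<integral>\<^sup>+x. ennreal (phi \<delta> c l (x::'a) powr ps) \<partial>lborel) =
     (\<integral>\<^sup>+x. ennreal (c powr ps) * ennreal (phi \<delta> 1 1 (l *\<^sub>R (x::'a)) powr ps) \<partial>lborel)"
    using c phi_nonneg[OF d zero_le_one]
    by (intro nn_integral_cong) (simp add: powr_mult ennreal_mult)
  also have "\<dots> = ennreal (c powr ps) * (\<integral>\<^sup>+x. ennreal (phi \<delta> 1 1 (l *\<^sub>R (x::'a)) powr ps) \<partial>lborel)"
    by (rule nn_integral_cmult) measurable
  also have "(\<integral>\<^sup>+x. ennreal (phi \<delta> 1 1 (l *\<^sub>R (x::'a)) powr ps) \<partial>lborel) = ennreal (l powr (- real N)) * (\<integral>\<^sup>+x. ennreal (phi \<delta> 1 1 (x::'a) powr ps) \<partial>lborel)"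
    by (rule scale) measurable
  finally show "(\<integral>\<^sup>+x. ennreal (phi \<delta> c l (x::'a) powr ps) \<partial>lborel) =
      ennreal (c powr ps * l powr (- real N)) * (\<integral>\<^sup>+x. ennreal (phi \<delta> 1 1 (x::'a) powr ps) \<partial>lborel)"
    using c l by (simp add: ennreal_mult mult.assoc)
qed

lemma phi_radial: "radial (phi \<delta> c l :: 'a::euclidean_space \<Rightarrow> real)"
  unfolding radial_def
  by (rule exI[of _ "\<lambda>r. c * cutoff \<delta> (V (l^2 * r^2 + \<delta>) - \<delta>)"]) (simp add: phi_def power2_norm_eq_inner)

lemma phi_ball_integral:
  assumes d: "\<delta> > 0" and l: "l > supp_radius \<delta>" and c: "c \<ge> 0"
  shows "(\<integral>\<^sup>+x\<in>ball (0::'a::euclidean_space) 1. ennreal (\<bar>phi \<delta> c l x\<bar> powr ps) \<partial>lebesgue) = (\<integral>\<^sup>+x. ennreal (phi \<delta> c l (x::'a::euclidean_space) powr ps) \<partial>lborel)"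
proof -
  have l0: "l > 0" using supp_radius_pos[OF d] l by linarith
  have "(\<integral>\<^sup>+x\<in>ball (0::'a) 1. ennreal (\<bar>phi \<delta> c l x\<bar> powr ps) \<partial>lebesgue) = (\<integral>\<^sup>+x. ennreal (phi \<delta> c l (x::'a) powr ps) \<partial>lebesgue)"
  proof (rule nn_integral_cong)
    fix x :: 'a
    have z: "phi \<delta> c l x = 0" if "x \<notin> ball 0 1"
    proof (rule phi_support[OF d l0])
      have "l * 1 \<le> l * norm x" using that l0 by (intro mult_left_mono) auto
      then show "supp_radius \<delta> \<le> l * norm x" using l by linarith
    qed
    show "ennreal (\<bar>phi \<delta> c l x\<bar> powr ps) * indicator (ball 0 1) x = ennreal (phi \<delta> c l x powr ps)"
      using z phi_nonneg[OF d c, of l x] by (cases "x \<in> ball 0 1") auto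
  qed
  also have "\<dots> = (\<integral>\<^sup>+x. ennreal (phi \<delta> c l (x::'a) powr ps) \<partial>lborel)"
  proof -
    have [measurable]: "(phi \<delta> c l :: 'a \<Rightarrow> real) \<in> borel_measurable borel"
      by (rule test_fn_borel(1)[OF phi_test_fn[OF d l0 subset_UNIV]])
    show ?thesis by (intro nn_integral_completion) measurable
  qed
  finally show ?thesis .
qed

text \<open>Dilations shrink the support of one fixed profile to the origin, so that eventually its
  whole energy lies in any given ball. Normalizing the energy to 1 by \<open>c n\<close> leaves the
  critical integral independent of \<open>n\<close>, by the invariance behind
  \<open>\<nu>\<close>.\<close>

lemma concentrating_sequence:
  assumes N: "N = DIM('a::euclidean_space)" and B: "B = measure lebesgue (ball (0::'a) 1)"
    and q1: "q \<ge> 1" and m': "m' > 0" and A': "A' > 0" and d: "\<delta> > 0"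
    and P: "ennreal m' \<le> (\<integral>\<^sup>+x. ennreal (phi \<delta> 1 1 (x::'a) powr ps) \<partial>lborel)"
    and Gam: "(\<integral>\<^sup>+x. ennreal (norm (grad (phi \<delta> 1 1) (x::'a)) powr p) \<partial>lborel) \<le> ennreal A'"
  obtains u :: "nat \<Rightarrow> 'a::euclidean_space \<Rightarrow> real" and g :: "nat \<Rightarrow> 'a::euclidean_space \<Rightarrow> 'a" where "(u, g) \<in> Xp p"
    "\<And>n. ennreal (B + Fp_coeff powr q * (m' * A' powr (- \<nu>))) \<le> (\<integral>\<^sup>+x\<in>ball 0 1. ennreal (Fp N B p (u n x)) \<partial>lebesgue)"
proof -
  let ?\<Gamma> = "\<integral>\<^sup>+x. ennreal (norm (grad (phi \<delta> 1 1) (x::'a)) powr p) \<partial>lborel"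
  let ?P = "\<integral>\<^sup>+x. ennreal (phi \<delta> 1 1 (x::'a) powr ps) \<partial>lborel"
  let ?B = "ball (0::'a) 1"
  have p0: "p > 0" using p1 by linarith
  have "?\<Gamma> < top" using Gam by (rule le_less_trans) simp
  then obtain \<gamma> where \<gamma>: "\<gamma> \<ge> 0" "?\<Gamma> = ennreal \<gamma>" by (cases ?\<Gamma>) auto
  have \<gamma>A: "\<gamma> \<le> A'" using Gam A' unfolding \<gamma>(2) by (simp add: ennreal_le_iff)
  have cb: "cball (0::'a) (supp_radius \<delta> / l) \<subseteq> ?B" if "l > supp_radius \<delta>" for l
  proof -
    have "supp_radius \<delta> / l < 1" using that supp_radius_pos[OF d] by simp
    then show ?thesis by auto
  qed
  have tf: "test_fn ?B (phi \<delta> c l)" if "l > supp_radius \<delta>" for c l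
    by (rule phi_test_fn[OF d _ cb[OF that]]) (use that supp_radius_pos[OF d] in linarith)
  have lp: "lp_int p A (grad (phi \<delta> c l)) = ennreal ((c * l) powr p * l powr (- real N)) * ennreal \<gamma>"
    if "l > supp_radius \<delta>" "c \<ge> 0" "cball (0::'a) (supp_radius \<delta> / l) \<subseteq> A" for c l A
  proof -
    have l0: "l > 0" using supp_radius_pos[OF d] that by linarith
    have "lp_int p A (grad (phi \<delta> c l)) = (\<integral>\<^sup>+x. ennreal (norm (grad (phi \<delta> c l) (x::'a)) powr p) \<partial>lborel)"
      by (rule lp_int_grad_eq[OF tf[OF that(1)] _ p0]) (use phi_support_closure(2)[OF d l0, where 'a='a] that(3) in blast)
    also have "\<dots> = ennreal ((c * l) powr p * l powr (- real N)) * ennreal \<gamma>"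
      unfolding \<gamma>(2)[symmetric] by (rule phi_scaled_integrals(1)[OF N d l0 that(2)])
    finally show ?thesis .
  qed
  have \<gamma>0: "\<gamma> > 0"
  proof (rule ccontr)
    \<comment> \<open>If the energy vanished, arbitrarily large multiples would violate the radial inequality.\<close>
    assume "\<not> \<gamma> > 0"
    then have z: "\<gamma> = 0" using \<gamma> by simp
    define l where "l = supp_radius \<delta> + 1"
    have l: "l > supp_radius \<delta>" "l > 0" using supp_radius_pos[OF d] by (auto simp: l_def)
    \<comment> \<open>Chosen so that \<open>c powr ps * l powr (- N) * m' = K + 1\<close>, just
      above the admissible bound.\<close>
    define c where "c = (l powr real N * (K + 1) / m') powr (1 / ps)"
    have K0: "K \<ge> 0" by (simp add: K_def)
    have c0: "c \<ge> 0" by (simp add: c_def)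
    have "c powr ps = l powr real N * (K + 1) / m'"
      using ps0 l K0 m' by (simp add: c_def powr_powr)
    then have "c powr ps * l powr (- real N) * m' = K + 1" using l m' by (simp add: powr_minus)
    then have "ennreal (K + 1) = ennreal (c powr ps * l powr (- real N)) * ennreal m'"
      using m' by (simp add: ennreal_mult[symmetric])
    also have "\<dots> \<le> ennreal (c powr ps * l powr (- real N)) * ?P" by (intro mult_left_mono P) simp
    also have "\<dots> = (\<integral>\<^sup>+x\<in>?B. ennreal (\<bar>phi \<delta> c l x\<bar> powr ps) \<partial>lebesgue)"
      unfolding phi_ball_integral[OF d l(1) c0] by (rule phi_scaled_integrals(2)[OF N d l(2) c0, symmetric])
    also have "\<dots> \<le> ennreal K"
      by (rule radial_inequality[OF N B W0_test_fn[OF tf[OF l(1)] p0] phi_radial])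
         (use lp[OF l(1) c0 cb[OF l(1)]] z in simp)
    finally show False using K0 by (simp add: ennreal_le_iff)
  qed
  define l where "l n = supp_radius \<delta> + 1 + real n" for n
  have l: "l n > supp_radius \<delta>" "l n > 0" for n using supp_radius_pos[OF d] by (auto simp: l_def)
  \<comment> \<open>The constant that makes the energy
    \<open>c powr p * l powr (p - N) * \<gamma>\<close> equal to 1.\<close>
  define c where "c n = (l n powr (real N - p) / \<gamma>) powr (1 / p)" for n
  have c0: "c n \<ge> 0" for n by (simp add: c_def)
  have cp: "c n powr p = l n powr (real N - p) / \<gamma>" for n using \<gamma>0 l[of n] p0 by (simp add: c_def powr_powr)
  have one: "(c n * l n) powr p * l n powr (- real N) * \<gamma> = 1" for n
  proof -
    have "(c n * l n) powr p * l n powr (- real N) * \<gamma> = (c n powr p * \<gamma>) * (l n powr p * l n powr (- real N))"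
      using c0[of n] l[of n] by (simp add: powr_mult)
    also have "\<dots> = l n powr (real N - p) * l n powr (p - real N)"
      using \<gamma>0 unfolding cp by (simp add: powr_add[symmetric])
    also have "\<dots> = 1" using l[of n] by (simp add: powr_add[symmetric])
    finally show ?thesis .
  qed
  have lp1: "lp_int p A (grad (phi \<delta> (c n) (l n))) = 1" if "cball (0::'a) (supp_radius \<delta> / l n) \<subseteq> A" for A n
    unfolding lp[OF l(1) c0 that] using one[of n] \<gamma>0 by (subst ennreal_mult[symmetric]) auto
  \<comment> \<open>The dilation factors cancel because \<open>ps = p * \<nu>\<close> and
    \<open>(N - p) * \<nu> = N\<close>.\<close>
  have cps: "c n powr ps * l n powr (- real N) = \<gamma> powr (- \<nu>)" for n
  proof -
    have "c n powr ps = (c n powr p) powr \<nu>"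
      unfolding powr_powr using ps_p p0 by (intro arg_cong[where f="\<lambda>e. c n powr e"]) (simp add: field_simps)
    also have "\<dots> = (l n powr (real N - p)) powr \<nu> * \<gamma> powr (- \<nu>)"
    proof -
      have "(l n powr (real N - p) / \<gamma>) powr \<nu> = (l n powr (real N - p)) powr \<nu> / \<gamma> powr \<nu>"
        using \<gamma>0 by (simp only: powr_divide powr_ge_zero less_imp_le)
      then show ?thesis unfolding cp by (simp add: powr_minus divide_inverse)
    qed
    also have "(l n powr (real N - p)) powr \<nu> = l n powr real N"
      unfolding powr_powr using pN by (simp add: \<nu>_def)
    finally show ?thesis using l[of n] by (simp add: powr_minus)
  qed
  show ?thesis
  proof (rule that[of "\<lambda>n. phi \<delta> (c n) (l n)" "\<lambda>n. grad (phi \<delta> (c n) (l n))"])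
    show "(\<lambda>n. phi \<delta> (c n) (l n) :: 'a \<Rightarrow> real, \<lambda>n. grad (phi \<delta> (c n) (l n))) \<in> Xp p"
      unfolding Xp_def
    proof (clarsimp, intro conjI allI impI)
      fix n
      show "W0 p ?B (phi \<delta> (c n) (l n)) (grad (phi \<delta> (c n) (l n)))" by (rule W0_test_fn[OF tf[OF l(1)] p0])
      show "radial (phi \<delta> (c n) (l n) :: 'a \<Rightarrow> real)" by (rule phi_radial)
      show "lp_norm p ?B (grad (phi \<delta> (c n) (l n))) \<le> 1"
        unfolding lp_norm_def lp1[OF cb[OF l(1)]] by simp
    next
      fix \<epsilon> :: real assume \<epsilon>: "\<epsilon> > 0"
      obtain n0 where n0: "supp_radius \<delta> / \<epsilon> < real n0" using reals_Archimedean2 by blast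
      have "\<forall>\<^sub>F n in sequentially. 1 = lp_norm p (ball 0 \<epsilon> \<inter> ?B) (grad (phi \<delta> (c n) (l n)))"
        using eventually_ge_at_top[of n0]
      proof eventually_elim
        case (elim n)
        have "supp_radius \<delta> / \<epsilon> < l n" using n0 elim supp_radius_pos[OF d] by (simp add: l_def)
        then have "supp_radius \<delta> / l n < \<epsilon>" using \<epsilon> l[of n] by (simp add: field_simps)
        then have "cball (0::'a) (supp_radius \<delta> / l n) \<subseteq> ball 0 \<epsilon> \<inter> ?B" using cb[OF l(1)[of n]] by auto
        then show ?case unfolding lp_norm_def by (simp add: lp1)
      qed
      then show "(\<lambda>n. lp_norm p (ball 0 \<epsilon> \<inter> ?B) (grad (phi \<delta> (c n) (l n)))) \<longlonglongrightarrow> 1"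
        by (rule Lim_transform_eventually[OF tendsto_const])
    qed
    fix n
    let ?u = "phi \<delta> (c n) (l n) :: 'a \<Rightarrow> real"
    have um [measurable]: "?u \<in> borel_measurable lebesgue"
      by (rule borel_measurable_lebesgueI[OF test_fn_borel(1)[OF tf[OF l(1)]]])
    have [measurable]: "?B \<in> sets lebesgue" by simp
    have emB: "emeasure lebesgue ?B = ennreal B"
      unfolding B using emeasure_lebesgue_ball_finite[of "0::'a" 1]
      by (intro emeasure_eq_ennreal_measure) (simp add: less_top)
    have "m' * A' powr (- \<nu>) \<le> m' * \<gamma> powr (- \<nu>)"
      using m' \<gamma>0 \<gamma>A pN N2 by (intro mult_left_mono powr_mono2') (auto simp: \<nu>_def)
    then have "ennreal (m' * A' powr (- \<nu>)) \<le> ennreal (\<gamma> powr (- \<nu>)) * ennreal m'"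
      using m' by (simp add: ennreal_mult[symmetric] ennreal_leI mult.commute)
    also have "\<dots> \<le> ennreal (\<gamma> powr (- \<nu>)) * ?P" by (intro mult_left_mono P) simp
    also have "\<dots> = (\<integral>\<^sup>+x\<in>?B. ennreal (\<bar>?u x\<bar> powr ps) \<partial>lebesgue)"
      unfolding phi_ball_integral[OF d l(1) c0] cps[of n, symmetric] by (rule phi_scaled_integrals(2)[OF N d l(2) c0, symmetric])
    finally have low: "ennreal (m' * A' powr (- \<nu>)) \<le> (\<integral>\<^sup>+x\<in>?B. ennreal (\<bar>?u x\<bar> powr ps) \<partial>lebesgue)" .
    have "ennreal (B + Fp_coeff powr q * (m' * A' powr (- \<nu>))) = ennreal B + ennreal (Fp_coeff powr q) * ennreal (m' * A' powr (- \<nu>))"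
      using B0 m' by (simp add: ennreal_plus ennreal_mult)
    also have "\<dots> \<le> emeasure lebesgue ?B + ennreal (Fp_coeff powr q) * (\<integral>\<^sup>+x\<in>?B. ennreal (\<bar>?u x\<bar> powr ps) \<partial>lebesgue)"
      unfolding emB by (intro add_left_mono mult_left_mono low) simp
    also have "\<dots> = (\<integral>\<^sup>+x. indicator ?B x + ennreal (Fp_coeff powr q) * (ennreal (\<bar>?u x\<bar> powr ps) * indicator ?B x) \<partial>lebesgue)"
      by (simp add: nn_integral_add nn_integral_cmult)
    also have "\<dots> \<le> (\<integral>\<^sup>+x\<in>?B. ennreal (Fp N B p (?u x)) \<partial>lebesgue)"
    proof (rule nn_integral_mono)
      fix x
      have "1 + Fp_coeff powr q * \<bar>?u x\<bar> powr ps \<le> Fp N B p (?u x)"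
        unfolding Fp_eq Fp_coeff_powr[symmetric] using Fp_coeff_pos q1 by (intro one_plus_powr_ge) auto
      then have "ennreal (1 + Fp_coeff powr q * \<bar>?u x\<bar> powr ps) \<le> ennreal (Fp N B p (?u x))" by (rule ennreal_leI)
      then show "indicator ?B x + ennreal (Fp_coeff powr q) * (ennreal (\<bar>?u x\<bar> powr ps) * indicator ?B x) \<le> ennreal (Fp N B p (?u x)) * indicator ?B x"
        by (auto simp: indicator_def ennreal_mult)
    qed
    finally show "ennreal (B + Fp_coeff powr q * (m' * A' powr (- \<nu>))) \<le> (\<integral>\<^sup>+x\<in>?B. ennreal (Fp N B p (?u x)) \<partial>lebesgue)" .
  qed
qed

text \<open>Sharpness of the transport inequality: \<open>M\<close> is the critical integral of the
  bubble and \<open>(N / q) powr p * (q * M)\<close> is its energy, so its invariant quotient equals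
  the constant obtained as the upper bound.\<close>

lemma K_eq_bubble_quotient: "M * ((N / q) powr p * (q * M)) powr (- \<nu>) = K"
proof -
  have p0: "p > 0" using p1 by linarith
  have N0: "real N > 0" using N2 by simp
  note pos = M_pos q0 N0
  have e1: "p * \<nu> = ps" using ps_p p0 by (simp add: field_simps)
  have e2: "ps / pp = q" using q_pp pp1 by (simp add: field_simps)
  have e3: "ps - \<nu> = q" by (simp add: ps_def \<nu>_def q_def diff_divide_distrib[symmetric] right_diff_distrib)
  have e4: "1 - \<nu> = - ps / N" using p1 pN N2 by (simp add: ps_def \<nu>_def field_simps)
  have "M * ((N / q) powr p * (q * M)) powr (- \<nu>) = M powr 1 * (real N powr (- ps) * q powr ps * (q powr (- \<nu>) * M powr (- \<nu>)))"
  proof -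
    have "(real N / q) powr p = real N powr p / q powr p" using pos by (simp only: powr_divide less_imp_le)
    also have "\<dots> = real N powr p * q powr (- p)" by (simp add: powr_minus divide_inverse)
    finally show ?thesis using pos by (simp add: powr_mult powr_powr e1)
  qed
  also have "\<dots> = real N powr (- ps) * (q powr ps * q powr (- \<nu>)) * (M powr 1 * M powr (- \<nu>))" by (simp only: mult_ac)
  also have "\<dots> = real N powr (- ps) * q powr q * M powr (- ps / N)"
    unfolding powr_add[symmetric] using e3 e4 by simp
  also have "\<dots> = K"
  proof -
    have "K = (q powr (1 / pp)) powr ps / (real N powr ps * (M powr (1 / N)) powr ps)"
      unfolding K_def using pos by (simp add: powr_divide powr_mult)
    also have "(q powr (1 / pp)) powr ps = q powr q" unfolding powr_powr using e2 by (simp add: mult.commute)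
    also have "(M powr (1 / N)) powr ps = M powr (ps / N)" unfolding powr_powr by simp
    finally show ?thesis using pos by (simp add: powr_minus divide_inverse mult_ac)
  qed
  finally show ?thesis .
qed

text \<open>The assumption \<open>q \<ge> 1\<close> serves the lower bound, through
  \<open>one_plus_powr_ge\<close>. There the critical integral and the energy of the profiles are
  prescribed only approximately, and the bounds \<open>m n\<close> and \<open>a n\<close> tend to
  those of the bubble.\<close>

lemma sup_Xp_eq:
  assumes N: "N = DIM('a::euclidean_space)" and B: "B = measure lebesgue (ball (0::'a) 1)"
    and q1: "q \<ge> 1"
  shows "(SUP ug \<in> (Xp p :: ((nat \<Rightarrow> 'a \<Rightarrow> real) \<times> (nat \<Rightarrow> 'a \<Rightarrow> 'a)) set).
     limsup (\<lambda>n. \<integral>\<^sup>+ x\<in>ball 0 1. ennreal (Fp N B p (fst ug n x)) \<partial>lebesgue)) = ennreal (B + Fp_coeff powr q * K)"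
  (is "?S = _")
proof (rule antisym)
  show "?S \<le> ennreal (B + Fp_coeff powr q * K)"
    by (rule SUP_least) (auto intro: limsup_Fp_le[OF N B])
  define A where "A = (N / q) powr p * (q * M)"
  have A: "A > 0" using M_pos q0 N2 by (simp add: A_def)
  \<comment> \<open>The double successor keeps the factor positive already at
    \<open>n = 0\<close>.\<close>
  define m where "m n = M * (1 - inverse (real (Suc (Suc n))))" for n
  define a where "a n = A * (1 + inverse (real (Suc n)))" for n
  have m: "0 < m n" "m n < M" for n
  proof -
    have i: "0 < inverse (real (Suc (Suc n)))" "inverse (real (Suc (Suc n))) < 1" by (auto simp: field_simps)
    then show "0 < m n" unfolding m_def using M_pos by (intro mult_pos_pos) auto
    have "M * (1 - inverse (real (Suc (Suc n)))) < M * 1" using i M_pos by (intro mult_strict_left_mono) auto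
    then show "m n < M" by (simp add: m_def)
  qed
  have a: "A < a n" "0 < a n" for n
  proof -
    have "A * 1 < A * (1 + inverse (real (Suc n)))" using A by (intro mult_strict_left_mono) auto
    then show "A < a n" by (simp add: a_def)
    then show "0 < a n" using A by linarith
  qed
  have ml: "m \<longlonglongrightarrow> M * (1 - 0)"
    unfolding m_def by (intro tendsto_intros LIMSEQ_Suc[OF LIMSEQ_inverse_real_of_nat])
  have al: "a \<longlonglongrightarrow> A * (1 + 0)"
    unfolding a_def by (intro tendsto_intros LIMSEQ_inverse_real_of_nat)
  have "ennreal (B + Fp_coeff powr q * (m n * a n powr (- \<nu>))) \<le> ?S" for n
  proof -
    obtain \<delta> where d: "\<delta> > 0" "ennreal (m n) \<le> (\<integral>\<^sup>+x. ennreal (phi \<delta> 1 1 (x::'a) powr ps) \<partial>lborel)"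
      "(\<integral>\<^sup>+x. ennreal (norm (grad (phi \<delta> 1 1) (x::'a)) powr p) \<partial>lborel) \<le> ennreal (a n)"
      using profile_exists[OF N B m(2)[of n], of "a n"] a(1)[of n] unfolding A_def by blast
    obtain u and g :: "nat \<Rightarrow> 'a \<Rightarrow> 'a" where ug: "(u, g) \<in> Xp p"
      "\<And>k. ennreal (B + Fp_coeff powr q * (m n * a n powr (- \<nu>))) \<le> (\<integral>\<^sup>+x\<in>ball 0 1. ennreal (Fp N B p (u k x)) \<partial>lebesgue)"
      using concentrating_sequence[OF N B q1 m(1) a(2) d] by blast
    have "ennreal (B + Fp_coeff powr q * (m n * a n powr (- \<nu>))) = limsup (\<lambda>k::nat. ennreal (B + Fp_coeff powr q * (m n * a n powr (- \<nu>))))"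
      by (simp add: Limsup_const)
    also have "\<dots> \<le> limsup (\<lambda>k. \<integral>\<^sup>+x\<in>ball 0 1. ennreal (Fp N B p (fst (u, g) k x)) \<partial>lebesgue)"
      using ug(2) by (intro Limsup_mono) auto
    also have "\<dots> \<le> ?S" by (rule SUP_upper[OF ug(1)])
    finally show ?thesis .
  qed
  moreover have "(\<lambda>n. ennreal (B + Fp_coeff powr q * (m n * a n powr (- \<nu>)))) \<longlonglongrightarrow> ennreal (B + Fp_coeff powr q * (M * (1 - 0) * (A * (1 + 0)) powr (- \<nu>)))"
    by (intro tendsto_ennrealI tendsto_add tendsto_mult[of "\<lambda>_. Fp_coeff powr q"] tendsto_const tendsto_mult[of m] ml tendsto_powr al) (use A in auto)
  ultimately have "ennreal (B + Fp_coeff powr q * (M * (1 - 0) * (A * (1 + 0)) powr (- \<nu>))) \<le> ?S"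
    by (intro LIMSEQ_le_const2) auto
  then show "ennreal (B + Fp_coeff powr q * K) \<le> ?S" using K_eq_bubble_quotient by (simp add: A_def)
qed

text \<open>The normalization of \<open>alpha_p\<close> is made for this: \<open>N powr ps\<close>
  and \<open>q powr q\<close> in the power of \<open>Fp_coeff\<close> cancel against those in
  \<open>K\<close>. What remains is \<open>B\<close> times a power of \<open>B / M\<close>, the
  reciprocal of the Beta-type factor in \<open>M_eq\<close>.\<close>

lemma sup_level_eq: "Fp_coeff powr q * K = B * (Gamma (real N) / (Gamma (real N / p) * Gamma (real N + 1 - real N / p))) powr (p / (real N - p))"
proof -
  have p0: "p > 0" using p1 by linarith
  have N0: "real N > 0" using N2 by simp
  note pos = M_pos q0 N0 B0
  have qe: "(real N - p) / (real N * (p - 1)) = 1 / q" using p1 pN N2 by (simp add: q_def)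
  have N1: "real N - 1 > 0" using N2 by simp
  have "alphaN N B powr ((real N - 1) / N) = real N powr ((real N - 1) / N) * ((real N * B) powr (1 / (real N - 1))) powr ((real N - 1) / N)"
    unfolding alphaN_def omega_def using pos by (simp add: powr_mult)
  also have "((real N * B) powr (1 / (real N - 1))) powr ((real N - 1) / N) = (real N * B) powr (1 / N)"
    unfolding powr_powr using N1 by simp
  also have "\<dots> = real N powr (1 / N) * B powr (1 / N)" using pos by (simp add: powr_mult)
  finally have "alphaN N B powr ((real N - 1) / N) = (real N powr ((real N - 1) / N) * real N powr (1 / N)) * B powr (1 / N)"
    by simp
  also have "real N powr ((real N - 1) / N) * real N powr (1 / N) = real N"
  proof -
    have "(real N - 1) / N + 1 / N = 1" using N0 by (simp add: field_simps)
    then show ?thesis unfolding powr_add[symmetric] using N0 by simp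
  qed
  finally have aN: "alphaN N B powr ((real N - 1) / N) = real N * B powr (1 / N)" .
  have "alpha_p N B p = (real N * (B powr (1 / N) * B powr (1 / p - 1 / N))) powr pp"
    unfolding alpha_p_def aN pp_def by (simp add: mult.assoc)
  also have "B powr (1 / N) * B powr (1 / p - 1 / N) = B powr (1 / p)" unfolding powr_add[symmetric] by simp
  finally have ap: "alpha_p N B p = (real N * B powr (1 / p)) powr pp" .
  have "Fp_coeff powr q = ((real N * B powr (1 / p)) powr pp / q) powr q"
    unfolding Fp_coeff_def qe ap by simp
  also have "\<dots> = ((real N * B powr (1 / p)) powr pp) powr q / q powr q" using pos by (simp add: powr_divide)
  also have "((real N * B powr (1 / p)) powr pp) powr q = (real N * B powr (1 / p)) powr ps"
    unfolding powr_powr using q_pp by (simp add: mult.commute)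
  also have "\<dots> = real N powr ps * B powr \<nu>"
    using pos ps_p by (simp add: powr_mult powr_powr)
  finally have cq: "Fp_coeff powr q = real N powr ps * B powr \<nu> / q powr q" .
  have e2: "ps / pp = q" using q_pp pp1 by (simp add: field_simps)
  have "K = (q powr (1 / pp)) powr ps / (real N powr ps * (M powr (1 / N)) powr ps)"
    unfolding K_def using pos by (simp add: powr_divide powr_mult)
  also have "(q powr (1 / pp)) powr ps = q powr q" unfolding powr_powr using e2 by (simp add: mult.commute)
  also have "(M powr (1 / N)) powr ps = M powr (ps / N)" unfolding powr_powr by simp
  finally have K: "K = q powr q / (real N powr ps * M powr (ps / N))" .
  have eN: "ps / N = p / (real N - p)" using N0 by (simp add: ps_def)
  have ee1: "\<nu> = 1 + p / (real N - p)" using pN by (simp add: \<nu>_def field_simps)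
  have "Fp_coeff powr q * K = B powr \<nu> / M powr (ps / N)" unfolding cq K using pos by simp
  also have "\<dots> = B * (B powr (p / (real N - p)) / M powr (p / (real N - p)))"
    unfolding eN ee1 powr_add using pos by simp
  also have "B powr (p / (real N - p)) / M powr (p / (real N - p)) = (B / M) powr (p / (real N - p))"
    using pos by (simp add: powr_divide)
  also have "B / M = Gamma (real N) / (Gamma (real N / p) * Gamma (real N + 1 - real N / p))"
    unfolding M_eq using pos by simp
  finally show ?thesis .
qed

end

section \<open>The limit as \<open>p\<close> tends to \<open>N\<close>\<close>

lemma Gamma_quotient_limit:
  assumes "N \<ge> 2"
  shows "((\<lambda>p. (Gamma (real N) / (Gamma (real N / p) * Gamma (real N + 1 - real N / p))) powr (p / (real N - p)))
     \<longlongrightarrow> exp (\<Sum>k=1..N - 1. 1 / real k)) (at_left (real N))"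
proof -
  have N0: "real N > 0" using assms by simp
  \<comment> \<open>For \<open>x = N / p\<close> the logarithm of the Gamma quotient is
    \<open>L x - L 1\<close>, because \<open>ln_Gamma 1 = 0\<close>, and the exponent
    \<open>p / (N - p)\<close> is \<open>1 / (x - 1)\<close>. The logarithm of the whole power is
    thus a difference quotient of \<open>L\<close> at 1.\<close>
  define L where "L x = - ln_Gamma x - ln_Gamma (real N + 1 - x)" for x :: real
  define D where "D = - Digamma 1 - Digamma (real N + 1 - 1) * (0 - 1)"
  have dL: "(L has_real_derivative D) (at 1)"
    unfolding L_def D_def
    by (intro DERIV_diff DERIV_minus has_field_derivative_ln_Gamma_real DERIV_chain2[where f=ln_Gamma and g="\<lambda>x. real N + 1 - x"] DERIV_const DERIV_ident)
       (use N0 in auto)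
  have D: "D = (\<Sum>k=1..N - 1. 1 / real k)"
  proof -
    \<comment> \<open>The derivative of \<open>L\<close> at 1 is a difference of two Digamma values
      at positive integers, in which the Euler-Mascheroni constant cancels and the harmonic number
      remains.\<close>
    have "Digamma (real (Suc (N - 1))) = harm (N - 1) - euler_mascheroni" by (rule Digamma_of_nat)
    then have "D = harm (N - 1)" using assms Digamma_1[where 'a=real] by (simp add: D_def)
    then show ?thesis by (simp add: harm_def inverse_eq_divide)
  qed
  have lim: "((\<lambda>x. (L x - L 1) / (x - 1)) \<longlongrightarrow> D) (at 1)" using dL by (simp add: has_field_derivative_iff)
  have "((\<lambda>p. real N / p) \<longlongrightarrow> real N / real N) (at_left (real N))"
    using N0 by (intro tendsto_intros filterlim_ident) auto
  \<comment> \<open>The punctured filter at 1 requires \<open>N / p \<noteq> 1\<close> as well,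
    which holds since \<open>p < N\<close>.\<close>
  then have xl: "filterlim (\<lambda>p. real N / p) (at 1) (at_left (real N))"
    using N0 unfolding filterlim_at
    by (auto simp: eventually_at_filter field_simps intro!: always_eventually)
  have "((\<lambda>p. exp ((L (real N / p) - L 1) / (real N / p - 1))) \<longlongrightarrow> exp D) (at_left (real N))"
    by (intro tendsto_exp filterlim_compose[OF lim xl])
  moreover have "\<forall>\<^sub>F p in at_left (real N). exp ((L (real N / p) - L 1) / (real N / p - 1)) =
      (Gamma (real N) / (Gamma (real N / p) * Gamma (real N + 1 - real N / p))) powr (p / (real N - p))"
  proof -
    have "\<forall>\<^sub>F p in at_left (real N). 1 < p \<and> p < real N"
      using assms by (auto simp: eventually_at_left_field intro!: exI[of _ 1])
    then show ?thesis
    proof eventually_elim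
      case (elim p)
      define x where "x = real N / p"
      have "x \<le> real N" using elim N0 by (simp add: x_def divide_le_eq)
      moreover have "0 < x" using elim N0 by (simp add: x_def)
      ultimately have x: "0 < x" "0 < real N + 1 - x" by auto
      define g where "g = Gamma (real N) / (Gamma x * Gamma (real N + 1 - x))"
      have g: "g > 0" using x N0 by (simp add: g_def Gamma_real_pos)
      have "ln g = ln_Gamma (real N) - ln_Gamma x - ln_Gamma (real N + 1 - x)"
      proof -
        have pos: "Gamma (real N) > 0" "Gamma x > 0" "Gamma (real N + 1 - x) > 0"
          using x N0 by (auto intro: Gamma_real_pos)
        show ?thesis unfolding g_def ln_Gamma_real_pos[OF N0] ln_Gamma_real_pos[OF x(1)] ln_Gamma_real_pos[OF x(2)]
          using ln_divide_pos[OF pos(1) mult_pos_pos[OF pos(2,3)]] ln_mult_pos[OF pos(2,3)] by simp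
      qed
      then have "ln g = L x - L 1" using ln_Gamma_real_pos[of 1] by (simp add: L_def)
      moreover have "x - 1 = (real N - p) / p" using elim by (simp add: x_def field_simps)
      ultimately have "exp ((L x - L 1) / (x - 1)) = exp (p / (real N - p) * ln g)" by simp
      also have "\<dots> = g powr (p / (real N - p))" using g by (simp add: powr_def)
      finally show ?case by (simp add: x_def g_def)
    qed
  qed
  ultimately have "((\<lambda>p. (Gamma (real N) / (Gamma (real N / p) * Gamma (real N + 1 - real N / p))) powr (p / (real N - p))) \<longlongrightarrow> exp D) (at_left (real N))"
    by (rule Lim_transform_eventually)
  then show ?thesis by (simp only: D)
qed

theorem theorem1p2:
  assumes "DIM('a::euclidean_space) \<ge> 2"
  shows "((\<lambda>p. SUP ug \<in> (Xp p :: ((nat \<Rightarrow> 'a \<Rightarrow> real) \<times> (nat \<Rightarrow> 'a \<Rightarrow> 'a)) set).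
              limsup (\<lambda>n. \<integral>\<^sup>+ x\<in>ball 0 1.
                 ennreal (Fp DIM('a) (measure lebesgue (ball (0::'a) 1)) p (fst ug n x)) \<partial>lebesgue))
          \<longlongrightarrow> ennreal (measure lebesgue (ball (0::'a) 1) *
                 (1 + exp (\<Sum>k=1..DIM('a) - 1. 1 / real k))))
         (at_left (real DIM('a)))"
proof -
  define N where "N = DIM('a)"
  define B where "B = measure lebesgue (ball (0::'a) 1)"
  have N2: "N \<ge> 2" using assms by (simp add: N_def)
  have B0: "B > 0" unfolding B_def using content_ball_pos[of 1 "0::'a"] by simp
  let ?g = "\<lambda>p. (Gamma (real N) / (Gamma (real N / p) * Gamma (real N + 1 - real N / p))) powr (p / (real N - p))"
  let ?S = "\<lambda>p. SUP ug \<in> (Xp p :: ((nat \<Rightarrow> 'a \<Rightarrow> real) \<times> (nat \<Rightarrow> 'a \<Rightarrow> 'a)) set).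
              limsup (\<lambda>n. \<integral>\<^sup>+ x\<in>ball 0 1. ennreal (Fp N B p (fst ug n x)) \<partial>lebesgue)"
  have "((\<lambda>p. ennreal (B * (1 + ?g p))) \<longlongrightarrow> ennreal (B * (1 + exp (\<Sum>k=1..N - 1. 1 / real k)))) (at_left (real N))"
    by (intro tendsto_ennrealI tendsto_mult tendsto_add tendsto_const Gamma_quotient_limit[OF N2])
  moreover have "\<forall>\<^sub>F p in at_left (real N). ennreal (B * (1 + ?g p)) = ?S p"
  proof -
    \<comment> \<open>\<open>q \<ge> 1\<close> is equivalent to
      \<open>N * (p - 1) \<ge> N - p\<close>, that is to \<open>p \<ge> 2 * N / (N + 1)\<close>. For
      \<open>N \<ge> 2\<close> this threshold lies strictly between 1 and \<open>N\<close>.\<close>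
    define p0 where "p0 = 2 * real N / (real N + 1)"
    have p0: "1 < p0" "p0 < real N" using N2 by (auto simp: p0_def field_simps)
    have "\<forall>\<^sub>F p in at_left (real N). p0 < p \<and> p < real N"
      using p0 by (auto simp: eventually_at_left_field intro!: exI[of _ p0])
    then show ?thesis
    proof eventually_elim
      case (elim p)
      interpret bliss N p B
        by unfold_locales (use N2 B0 p0 elim in auto)
      have "real N - p \<le> real N * (p - 1)"
        using elim N2 unfolding p0_def by (simp add: field_simps)
      then have q1: "q \<ge> 1" using elim by (simp add: q_def)
      have "?S p = ennreal (B + Fp_coeff powr q * K)" by (rule sup_Xp_eq[OF N_def B_def q1])
      also have "B + Fp_coeff powr q * K = B * (1 + ?g p)" unfolding sup_level_eq by (simp add: distrib_left)
      finally show ?case by simp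
    qed
  qed
  ultimately have "(?S \<longlongrightarrow> ennreal (B * (1 + exp (\<Sum>k=1..N - 1. 1 / real k)))) (at_left (real N))"
    by (rule Lim_transform_eventually)
  then show ?thesis by (simp only: N_def B_def)
qed

end
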